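(* Let $c\in\mathbb{C}$. If $M$ is an irreducible $o(10,\mathbb{C})$-module, then $U(\mathcal{G}_-)(M)$ (the subspace of $\widehat M$ obtained by applying the universal enveloping algebra of $\mathcal{G}_-$ to $M=1\otimes M\subset\widehat M$) is an irreducible $\mathcal{G}^{E_6}$-module.
   Context: **The Lie algebra $\mathcal{G}^{E_6}$.** Let $\alpha_1,\dots,\alpha_6$ be the simple roots of $E_6$, where the Dynkin diagram has edges $\{1,3\},\{3,4\},\{4,5\},\{5,6\},\{2,4\}$. Let $Q=\bigoplus_{i=1}^6\mathbb{Z}\alpha_i$ with the symmetric $\mathbb{Z}$-bilinear form $(\cdot,\cdot)$ given by $(\alpha_i,\alpha_i)=2$, $(\alpha_i,\alpha_j)=-1$ if $\{i,j\}$ is an edge, $0$ otherwise; $\Phi_{E_6}=\{\alpha\in Q:(\alpha,\alpha)=2\}$. Define $F:Q\times Q\to\{1,-1\}$ by $$F\Big(\sum_i k_i\alpha_i,\sum_j l_j\alpha_j\Big)=(-1)^{\sum_{i=1}^6k_il_i+k_1l_3+k_4l_2+k_3l_4+k_5l_4+k_6l_5}.$$ Let $H=\bigoplus_{i=1}^6\mathbb{C}\alpha_i$ with the form extended bilinearly, and $\mathcal{G}^{E_6}=H\oplus\bigoplus_{\alpha\in\Phi_{E_6}}\mathbb{C}E_\alpha$ with bracket $[H,H]=0$, $[h,E_\alpha]=-[E_\alpha,h]=(h,\alpha)E_\alpha$, $[E_\alpha,E_{-\alpha}]=-\alpha$, and for $\alpha+\beta\neq0$: $[E_\alpha,E_\beta]=F(\alpha,\beta)E_{\alpha+\beta}$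 if $\alpha+\beta\in\Phi_{E_6}$, and $0$ if $\alpha+\beta\notin\Phi_{E_6}$. This is the simple Lie algebra of type $E_6$. Put $\Phi_{D_5}=\Phi_{E_6}\cap\sum_{i=1}^5\mathbb{Z}\alpha_i$, $\mathcal{G}^{D_5}=\sum_{i=1}^5\mathbb{C}\alpha_i+\sum_{\beta\in\Phi_{D_5}}\mathbb{C}E_\beta$, and $\mathcal{G}_0=\mathcal{G}^{D_5}+\mathbb{C}\alpha_6=\mathcal{G}^{D_5}\oplus\mathbb{C}\widehat\alpha$, where $\widehat\alpha=2\alpha_1+3\alpha_2+4\alpha_3+6\alpha_4+5\alpha_5+4\alpha_6$ commutes with $\mathcal{G}^{D_5}$. The positive roots not in $\Phi_{D_5}$ are $\beta_1=\alpha_6$, $\beta_2=\alpha_5+\alpha_6$, $\beta_3=\alpha_4+\alpha_5+\alpha_6$, $\beta_4=\alpha_3+\alpha_4+\alpha_5+\alpha_6$, $\beta_5=\alpha_2+\alpha_4+\alpha_5+\alpha_6$, $\beta_6=\alpha_2+\alpha_3+\alpha_4+\alpha_5+\alpha_6$, $\beta_7=\alpha_1+\alpha_3+\alpha_4+\alpha_5+\alpha_6$, $\beta_8=\sum_{i=1}^6\alpha_i$, $\beta_9=\alpha_2+\alpha_3+2\alpha_4+\alpha_5+\alpha_6$, $\beta_{10}=\alpha_1+\alpha_2+\alpha_3+2\alpha_4+\alpha_5+\alpha_6$, $\beta_{11}=\alpha_2+\alpha_3+2\alpha_4+2\alpha_5+\alpha_6$, $\beta_{12}=\alpha_1+\alpha_2+2\alpha_3+2\alpha_4+\alpha_5+\alpha_6$,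 $\beta_{13}=\alpha_1+\alpha_2+\alpha_3+2\alpha_4+2\alpha_5+\alpha_6$, $\beta_{14}=\alpha_1+\alpha_2+2\alpha_3+2\alpha_4+2\alpha_5+\alpha_6$, $\beta_{15}=\alpha_1+\alpha_2+2\alpha_3+3\alpha_4+2\alpha_5+\alpha_6$, $\beta_{16}=\alpha_1+2\alpha_2+2\alpha_3+3\alpha_4+2\alpha_5+\alpha_6$. Set $\xi_i=E_{\beta_i}$, $\eta_i=E_{-\beta_i}$, $\mathcal{G}_+=\sum_i\mathbb{C}\xi_i$, $\mathcal{G}_-=\sum_i\mathbb{C}\eta_i$; then $\mathcal{G}^{E_6}=\mathcal{G}_-\oplus\mathcal{G}_0\oplus\mathcal{G}_+$ and $[\xi_r,\eta_i]\in\mathcal{G}_0$. **The isomorphism $\nu$.** $o(10,\mathbb{C})$ is the Lie algebra of $10\times10$ matrices spanned by $E_{i,j}-E_{5+j,5+i}$ ($1\le i,j\le5$), $E_{p,5+q}-E_{q,5+p}$ and $E_{5+p,q}-E_{5+q,p}$ ($1\le p<q\le5$). The Lie algebra isomorphism $\nu:o(10,\mathbb{C})\to\mathcal{G}^{D_5}$ is determined by $E_{1,2}-E_{7,6}\mapsto E_{\alpha_1}$, $E_{2,3}-E_{8,7}\mapsto E_{\alpha_3}$, $E_{3,4}-E_{9,8}\mapsto E_{\alpha_4}$, $E_{4,5}-E_{10,9}\mapsto E_{\alpha_5}$, $E_{4,10}-E_{5,9}\mapsto E_{\alpha_2}$, $E_{2,1}-E_{6,7}\mapsto -E_{-\alpha_1}$,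 $E_{3,2}-E_{7,8}\mapsto -E_{-\alpha_3}$, $E_{4,3}-E_{8,9}\mapsto -E_{-\alpha_4}$, $E_{5,4}-E_{9,10}\mapsto -E_{-\alpha_5}$, $E_{10,4}-E_{9,5}\mapsto -E_{-\alpha_2}$. **Differential operators.** $\mathcal{A}=\mathbb{C}[x_1,\dots,x_{16}]$. For $u\in\mathcal{G}_0$ write $[u,\eta_i]=\sum_{j}\varphi_{i,j}(u)\eta_j$ and set $u|_{\mathcal{A}}=\sum_{i,j=1}^{16}\varphi_{i,j}(u)x_j\partial_{x_i}$. Let $D=\sum_{i=1}^{16}x_i\partial_{x_i}$ and $\zeta_1=x_1x_{11}+x_2x_9-x_3x_6+x_4x_5$, $\zeta_2=x_1x_{13}+x_2x_{10}-x_3x_8+x_5x_7$, $\zeta_3=x_1x_{14}+x_2x_{12}-x_4x_8+x_6x_7$, $\zeta_4=x_1x_{15}-x_3x_{12}+x_4x_{10}-x_7x_9$, $\zeta_5=-x_2x_{15}-x_3x_{14}+x_4x_{13}-x_7x_{11}$, $\zeta_6=x_7x_{16}+x_8x_{15}+x_{10}x_{14}-x_{12}x_{13}$, $\zeta_7=-x_4x_{16}-x_6x_{15}-x_9x_{14}+x_{11}x_{12}$, $\zeta_8=x_3x_{16}+x_5x_{15}+x_9x_{13}-x_{10}x_{11}$, $\zeta_9=x_2x_{16}-x_5x_{14}+x_6x_{13}-x_8x_{11}$, $\zeta_{10}=x_1x_{16}+x_5x_{12}-x_6x_{10}+x_8x_9$, $$P_i=x_iD-\sum_{k=1}^{10}\zeta_k\sum_{j=1}^{16}\frac{\partial^2\zeta_k}{\partial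 x_i\partial x_j}\,\partial_{x_j}\qquad(1\le i\le16).$$ **The $\mathcal{G}^{E_6}$-module $\widehat M$.** Fix $c\in\mathbb{C}$. Let $M$ be an $o(10,\mathbb{C})$-module, $\widehat M=\mathcal{A}\otimes_{\mathbb{C}}M$, and write $fv=f\otimes v$. Let $\varrho_c:\mathcal{G}_0\to\mathrm{End}(M)$ be the linear map with $\varrho_c(u)v=\nu^{-1}(u)v$ for $u\in\mathcal{G}^{D_5}$ and $\varrho_c(\widehat\alpha)=2c\,\mathrm{id}_M$. Then $\widehat M$ is a $\mathcal{G}^{E_6}$-module via $$\xi_i(fv)=\partial_{x_i}(f)\,v,\qquad u(fv)=(u|_{\mathcal{A}}f)\,v+f\,\varrho_c(u)v\ \ (u\in\mathcal{G}_0),\qquad \eta_i(fv)=P_i(f)\,v+\sum_{r=1}^{16}x_rf\,\varrho_c([\xi_r,\eta_i])v,$$ for $f\in\mathcal{A}$, $v\in M$, $1\le i\le16$. *)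

theory Defs
  imports "HOL-Analysis.Analysis" "HOL-Library.Poly_Mapping" "HOL-Library.Numeral_Type"
begin

section \<open>Modules over complex Lie algebras\<close>

text \<open>
  A Lie algebra is given by its carrier, scalar multiplication and bracket, and a module by its
  scalar multiplication, carrier and action. All conditions are relative to the carriers.
\<close>

definition lie_module ::
  "'g::ab_group_add set \<Rightarrow> (complex \<Rightarrow> 'g \<Rightarrow> 'g) \<Rightarrow> ('g \<Rightarrow> 'g \<Rightarrow> 'g) \<Rightarrow>
   (complex \<Rightarrow> 'v::ab_group_add \<Rightarrow> 'v) \<Rightarrow> 'v set \<Rightarrow> ('g \<Rightarrow> 'v \<Rightarrow> 'v) \<Rightarrow> bool"
  where "lie_module g sg br sv V act \<longleftrightarrow>
    vector_space sv \<and> module.subspace sv V \<and>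
    (\<forall>x\<in>g. \<forall>v\<in>V. act x v \<in> V) \<and>
    (\<forall>x\<in>g. \<forall>y\<in>g. \<forall>v\<in>V. act (x + y) v = act x v + act y v) \<and>
    (\<forall>k. \<forall>x\<in>g. \<forall>v\<in>V. act (sg k x) v = sv k (act x v)) \<and>
    (\<forall>x\<in>g. \<forall>v\<in>V. \<forall>w\<in>V. act x (v + w) = act x v + act x w) \<and>
    (\<forall>k. \<forall>x\<in>g. \<forall>v\<in>V. act x (sv k v) = sv k (act x v)) \<and>
    (\<forall>x\<in>g. \<forall>y\<in>g. \<forall>v\<in>V. act (br x y) v = act x (act y v) - act y (act x v))"

definition lie_submodule ::
  "'g set \<Rightarrow> (complex \<Rightarrow> 'v::ab_group_add \<Rightarrow> 'v) \<Rightarrow> 'v set \<Rightarrow> ('g \<Rightarrow> 'v \<Rightarrow> 'v) \<Rightarrow> 'v set \<Rightarrow> bool"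
  where "lie_submodule g sv V act W \<longleftrightarrow>
    W \<subseteq> V \<and> module.subspace sv W \<and> (\<forall>x\<in>g. \<forall>w\<in>W. act x w \<in> W)"

definition irreducible_lie_module ::
  "'g::ab_group_add set \<Rightarrow> (complex \<Rightarrow> 'g \<Rightarrow> 'g) \<Rightarrow> ('g \<Rightarrow> 'g \<Rightarrow> 'g) \<Rightarrow>
   (complex \<Rightarrow> 'v::ab_group_add \<Rightarrow> 'v) \<Rightarrow> 'v set \<Rightarrow> ('g \<Rightarrow> 'v \<Rightarrow> 'v) \<Rightarrow> bool"
  where "irreducible_lie_module g sg br sv V act \<longleftrightarrow>
    lie_module g sg br sv V act \<and> V \<noteq> {0} \<and>
    (\<forall>W. lie_submodule g sv V act W \<longrightarrow> W = {0} \<or> W = V)"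

text \<open>
  \<open>U(g)(X)\<close>: since \<open>U(g)\<close> is spanned by the products \<open>y\<^sub>1 \<cdots> y\<^sub>k\<close> (\<open>k \<ge> 0\<close>) of elements of \<open>g\<close>,
  the result of applying it to \<open>X\<close> is the span of the vectors \<open>y\<^sub>1 (\<dots> (y\<^sub>k v))\<close> with \<open>v \<in> X\<close>.
\<close>

definition enveloping_image ::
  "'g set \<Rightarrow> (complex \<Rightarrow> 'v::ab_group_add \<Rightarrow> 'v) \<Rightarrow> ('g \<Rightarrow> 'v \<Rightarrow> 'v) \<Rightarrow> 'v set \<Rightarrow> 'v set"
  where "enveloping_image g sv act X =
    module.span sv {foldr act ys v | ys v. set ys \<subseteq> g \<and> v \<in> X}"


section \<open>The Lie algebra of type \<open>E\<^sub>6\<close>\<close>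

text \<open>
  The numeral type \<open>6\<close> has elements \<open>1, \<dots>, 5, 6\<close> with \<open>6 = 0\<close>; likewise for the index types
  \<open>10\<close> and \<open>16\<close> below. The root lattice \<open>Q\<close> is \<open>int ^ 6\<close> and the Cartan subalgebra \<open>H\<close> is
  \<open>complex ^ 6\<close>, both in coordinates with respect to the simple roots.
\<close>

definition E6_edges :: "6 set set"
  where "E6_edges = {{1,3}, {3,4}, {4,5}, {5,6}, {2,4}}"

definition cartan :: "6 \<Rightarrow> 6 \<Rightarrow> int"
  where "cartan i j = (if i = j then 2 else if {i, j} \<in> E6_edges then -1 else 0)"

definition form :: "'a::comm_ring_1 ^ 6 \<Rightarrow> 'a ^ 6 \<Rightarrow> 'a"
  where "form a b = (\<Sum>i\<in>UNIV. \<Sum>j\<in>UNIV. of_int (cartan i j) * a $ i * b $ j)"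

definition simple_root :: "6 \<Rightarrow> int ^ 6"
  where "simple_root i = axis i 1"

definition Phi_E6 :: "(int ^ 6) set"
  where "Phi_E6 = {\<alpha>. form \<alpha> \<alpha> = 2}"

definition Phi_D5 :: "(int ^ 6) set"
  where "Phi_D5 = Phi_E6 \<inter> range (\<lambda>k. \<Sum>i\<in>{1,2,3,4,5}. k i *s simple_root i)"

definition cocycle :: "int ^ 6 \<Rightarrow> int ^ 6 \<Rightarrow> complex"
  where "cocycle k l = (-1) powi
    ((\<Sum>i\<in>UNIV. k $ i * l $ i) + k $ 1 * l $ 3 + k $ 4 * l $ 2 + k $ 3 * l $ 4
      + k $ 5 * l $ 4 + k $ 6 * l $ 5)"

definition to_H :: "int ^ 6 \<Rightarrow> complex ^ 6"
  where "to_H \<alpha> = (\<chi> i. of_int (\<alpha> $ i))"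

text \<open>
  The pair \<open>(h, e)\<close> stands for \<open>h + (\<Sum>\<alpha>. e\<^sub>\<alpha> E\<^sub>\<alpha>)\<close>; it lies in the algebra when \<open>e\<close> is supported
  on roots.
\<close>

type_synonym e6_vec = "(complex ^ 6) \<times> ((int ^ 6) \<Rightarrow>\<^sub>0 complex)"

definition e6 :: "e6_vec set"
  where "e6 = {x. Poly_Mapping.keys (snd x) \<subseteq> Phi_E6}"

definition e6_scale :: "complex \<Rightarrow> e6_vec \<Rightarrow> e6_vec"
  where "e6_scale k x = (k *s fst x, Poly_Mapping.map (\<lambda>a. k * a) (snd x))"

definition hvec :: "int ^ 6 \<Rightarrow> e6_vec"
  where "hvec \<alpha> = (to_H \<alpha>, 0)"

definition Evec :: "int ^ 6 \<Rightarrow> e6_vec"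
  where "Evec \<alpha> = (0, Poly_Mapping.single \<alpha> 1)"

text \<open>
  The bilinear extension of the bracket on \<open>H\<close> and the \<open>E\<^sub>\<alpha>\<close>. The \<open>H\<close>-component comes from
  \<open>[E\<^sub>\<alpha>, E\<^sub>-\<^sub>\<alpha>] = -\<alpha>\<close>; in the last sum the case \<open>\<alpha> + \<beta> = 0\<close> is excluded because \<open>0\<close> is not a root.
\<close>

definition e6_bracket :: "e6_vec \<Rightarrow> e6_vec \<Rightarrow> e6_vec"
  where "e6_bracket x y =
    (let h = fst x; e = Poly_Mapping.lookup (snd x); K = Poly_Mapping.keys (snd x);
         h' = fst y; e' = Poly_Mapping.lookup (snd y); K' = Poly_Mapping.keys (snd y)
     in (- (\<Sum>\<alpha>\<in>K. (e \<alpha> * e' (- \<alpha>)) *s to_H \<alpha>),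
         (\<Sum>\<beta>\<in>K'. Poly_Mapping.single \<beta> (form h (to_H \<beta>) * e' \<beta>))
         - (\<Sum>\<alpha>\<in>K. Poly_Mapping.single \<alpha> (form h' (to_H \<alpha>) * e \<alpha>))
         + (\<Sum>\<alpha>\<in>K. \<Sum>\<beta>\<in>K'. if \<alpha> + \<beta> \<in> Phi_E6
             then Poly_Mapping.single (\<alpha> + \<beta>) (cocycle \<alpha> \<beta> * e \<alpha> * e' \<beta>) else 0)))"

definition gD5 :: "e6_vec set"
  where "gD5 = module.span e6_scale
    ((\<lambda>i. hvec (simple_root i)) ` {1,2,3,4,5} \<union> Evec ` Phi_D5)"

definition alpha_hat :: e6_vec
  where "alpha_hat = hvec (2 *s simple_root 1 + 3 *s simple_root 2 + 4 *s simple_root 3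
    + 6 *s simple_root 4 + 5 *s simple_root 5 + 4 *s simple_root 6)"

definition beta :: "16 \<Rightarrow> int ^ 6"
  where "beta = (let a1 = simple_root 1; a2 = simple_root 2; a3 = simple_root 3;
                     a4 = simple_root 4; a5 = simple_root 5; a6 = simple_root 6
    in (\<lambda>_. 0)(
      1 := a6,
      2 := a5 + a6,
      3 := a4 + a5 + a6,
      4 := a3 + a4 + a5 + a6,
      5 := a2 + a4 + a5 + a6,
      6 := a2 + a3 + a4 + a5 + a6,
      7 := a1 + a3 + a4 + a5 + a6,
      8 := a1 + a2 + a3 + a4 + a5 + a6,
      9 := a2 + a3 + 2 *s a4 + a5 + a6,
      10 := a1 + a2 + a3 + 2 *s a4 + a5 + a6,
      11 := a2 + a3 + 2 *s a4 + 2 *s a5 + a6,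
      12 := a1 + a2 + 2 *s a3 + 2 *s a4 + a5 + a6,
      13 := a1 + a2 + a3 + 2 *s a4 + 2 *s a5 + a6,
      14 := a1 + a2 + 2 *s a3 + 2 *s a4 + 2 *s a5 + a6,
      15 := a1 + a2 + 2 *s a3 + 3 *s a4 + 2 *s a5 + a6,
      16 := a1 + 2 *s a2 + 2 *s a3 + 3 *s a4 + 2 *s a5 + a6))"

definition xi :: "16 \<Rightarrow> e6_vec"
  where "xi i = Evec (beta i)"

definition eta :: "16 \<Rightarrow> e6_vec"
  where "eta i = Evec (- beta i)"

definition g_minus :: "e6_vec set"
  where "g_minus = module.span e6_scale (range eta)"


section \<open>The orthogonal Lie algebra and the isomorphism \<open>\<nu>\<close>\<close>

definition mat_scale :: "complex \<Rightarrow> complex ^ 10 ^ 10 \<Rightarrow> complex ^ 10 ^ 10"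
  where "mat_scale k A = (\<chi> i j. k * A $ i $ j)"

definition mat_commutator :: "complex ^ 10 ^ 10 \<Rightarrow> complex ^ 10 ^ 10 \<Rightarrow> complex ^ 10 ^ 10"
  where "mat_commutator A B = A ** B - B ** A"

definition mat_unit :: "nat \<Rightarrow> nat \<Rightarrow> complex ^ 10 ^ 10"
  where "mat_unit i j = (\<chi> r s. if r = of_nat i \<and> s = of_nat j then 1 else 0)"

definition o10 :: "(complex ^ 10 ^ 10) set"
  where "o10 = module.span mat_scale
    ({mat_unit i j - mat_unit (5 + j) (5 + i) | i j. i \<in> {1..5} \<and> j \<in> {1..5}} \<union>
     {mat_unit p (5 + q) - mat_unit q (5 + p) | p q. 1 \<le> p \<and> p < q \<and> q \<le> 5} \<union>
     {mat_unit (5 + p) q - mat_unit (5 + q) p | p q. 1 \<le> p \<and> p < q \<and> q \<le> 5})"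

definition is_nu :: "(complex ^ 10 ^ 10 \<Rightarrow> e6_vec) \<Rightarrow> bool"
  where "is_nu \<nu> \<longleftrightarrow>
    bij_betw \<nu> o10 gD5 \<and>
    (\<forall>A\<in>o10. \<forall>B\<in>o10. \<nu> (A + B) = \<nu> A + \<nu> B) \<and>
    (\<forall>k. \<forall>A\<in>o10. \<nu> (mat_scale k A) = e6_scale k (\<nu> A)) \<and>
    (\<forall>A\<in>o10. \<forall>B\<in>o10. \<nu> (mat_commutator A B) = e6_bracket (\<nu> A) (\<nu> B)) \<and>
    \<nu> (mat_unit 1 2 - mat_unit 7 6) = Evec (simple_root 1) \<and>
    \<nu> (mat_unit 2 3 - mat_unit 8 7) = Evec (simple_root 3) \<and>
    \<nu> (mat_unit 3 4 - mat_unit 9 8) = Evec (simple_root 4) \<and>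
    \<nu> (mat_unit 4 5 - mat_unit 10 9) = Evec (simple_root 5) \<and>
    \<nu> (mat_unit 4 10 - mat_unit 5 9) = Evec (simple_root 2) \<and>
    \<nu> (mat_unit 2 1 - mat_unit 6 7) = - Evec (- simple_root 1) \<and>
    \<nu> (mat_unit 3 2 - mat_unit 7 8) = - Evec (- simple_root 3) \<and>
    \<nu> (mat_unit 4 3 - mat_unit 8 9) = - Evec (- simple_root 4) \<and>
    \<nu> (mat_unit 5 4 - mat_unit 9 10) = - Evec (- simple_root 5) \<and>
    \<nu> (mat_unit 10 4 - mat_unit 9 5) = - Evec (- simple_root 2)"


section \<open>Polynomials and differential operators\<close>

type_synonym monom16 = "16 \<Rightarrow>\<^sub>0 nat"
type_synonym poly16 = "monom16 \<Rightarrow>\<^sub>0 complex"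

definition pconst :: "complex \<Rightarrow> poly16"
  where "pconst k = Poly_Mapping.single 0 k"

definition pvar :: "16 \<Rightarrow> poly16"
  where "pvar i = Poly_Mapping.single (Poly_Mapping.single i 1) 1"

definition pdiff :: "16 \<Rightarrow> poly16 \<Rightarrow> poly16"
  where "pdiff i f = (\<Sum>m\<in>Poly_Mapping.keys f.
    Poly_Mapping.single (m - Poly_Mapping.single i 1)
      (of_nat (Poly_Mapping.lookup m i) * Poly_Mapping.lookup f m))"

text \<open>The coefficient of \<open>\<eta>\<^sub>j\<close> in \<open>[u, \<eta>\<^sub>i]\<close>.\<close>

definition phi :: "16 \<Rightarrow> 16 \<Rightarrow> e6_vec \<Rightarrow> complex"
  where "phi i j u = Poly_Mapping.lookup (snd (e6_bracket u (eta i))) (- beta j)"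

definition g0_diffop :: "e6_vec \<Rightarrow> poly16 \<Rightarrow> poly16"
  where "g0_diffop u f =
    (\<Sum>i\<in>UNIV. \<Sum>j\<in>UNIV. pconst (phi i j u) * pvar j * pdiff i f)"

definition euler_op :: "poly16 \<Rightarrow> poly16"
  where "euler_op f = (\<Sum>i\<in>UNIV. pvar i * pdiff i f)"

definition zeta :: "10 \<Rightarrow> poly16"
  where "zeta = (let x = pvar in (\<lambda>_. 0)(
      1 := x 1 * x 11 + x 2 * x 9 - x 3 * x 6 + x 4 * x 5,
      2 := x 1 * x 13 + x 2 * x 10 - x 3 * x 8 + x 5 * x 7,
      3 := x 1 * x 14 + x 2 * x 12 - x 4 * x 8 + x 6 * x 7,
      4 := x 1 * x 15 - x 3 * x 12 + x 4 * x 10 - x 7 * x 9,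
      5 := - x 2 * x 15 - x 3 * x 14 + x 4 * x 13 - x 7 * x 11,
      6 := x 7 * x 16 + x 8 * x 15 + x 10 * x 14 - x 12 * x 13,
      7 := - x 4 * x 16 - x 6 * x 15 - x 9 * x 14 + x 11 * x 12,
      8 := x 3 * x 16 + x 5 * x 15 + x 9 * x 13 - x 10 * x 11,
      9 := x 2 * x 16 - x 5 * x 14 + x 6 * x 13 - x 8 * x 11,
      10 := x 1 * x 16 + x 5 * x 12 - x 6 * x 10 + x 8 * x 9))"

definition P_op :: "16 \<Rightarrow> poly16 \<Rightarrow> poly16"
  where "P_op i f = pvar i * euler_op f
    - (\<Sum>k\<in>UNIV. zeta k * (\<Sum>j\<in>UNIV. pdiff i (pdiff j (zeta k)) * pdiff j f))"


section \<open>The module \<open>A \<otimes> M\<close>\<close>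

text \<open>
  The \<open>o(10)\<close>-module \<open>M\<close> is a type \<open>'m\<close> with scalar multiplication \<open>sm\<close> and action \<open>am\<close>.
  Monomials form a basis of the polynomial ring, so its tensor product with \<open>M\<close> is the space of
  finitely supported families in \<open>M\<close> indexed by monomials: \<open>w\<close> stands for
  the sum of \<open>x\<^sup>\<mu> \<otimes> w\<^sub>\<mu>\<close> over the monomials \<open>x\<^sup>\<mu>\<close>.
\<close>

type_synonym 'm mhat = "monom16 \<Rightarrow>\<^sub>0 'm"

definition mhat_scale :: "(complex \<Rightarrow> 'm \<Rightarrow> 'm) \<Rightarrow> complex \<Rightarrow> 'm::ab_group_add mhat \<Rightarrow> 'm mhat"
  where "mhat_scale sm k w = Poly_Mapping.map (sm k) w"

definition tensor :: "(complex \<Rightarrow> 'm \<Rightarrow> 'm) \<Rightarrow> poly16 \<Rightarrow> 'm::ab_group_add \<Rightarrow> 'm mhat"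
  where "tensor sm f v = Poly_Mapping.map (\<lambda>a. sm a v) f"

text \<open>The linear map sending \<open>f \<otimes> v\<close> to \<open>B f v\<close>, for bilinear \<open>B\<close>.\<close>

definition tensor_lift ::
  "(poly16 \<Rightarrow> 'm \<Rightarrow> 'm mhat) \<Rightarrow> 'm::ab_group_add mhat \<Rightarrow> 'm mhat"
  where "tensor_lift B w = (\<Sum>m\<in>Poly_Mapping.keys w.
    B (Poly_Mapping.single m 1) (Poly_Mapping.lookup w m))"

definition rho ::
  "complex \<Rightarrow> (complex ^ 10 ^ 10 \<Rightarrow> e6_vec) \<Rightarrow> (complex \<Rightarrow> 'm \<Rightarrow> 'm) \<Rightarrow>
   (complex ^ 10 ^ 10 \<Rightarrow> 'm \<Rightarrow> 'm) \<Rightarrow> e6_vec \<Rightarrow> 'm::ab_group_add \<Rightarrow> 'm"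
  where "rho c \<nu> sm am u v =
    (let t = (THE t. u - e6_scale t alpha_hat \<in> gD5)
     in am (inv_into o10 \<nu> (u - e6_scale t alpha_hat)) v + sm (t * (2 * c)) v)"

definition xi_op :: "(complex \<Rightarrow> 'm \<Rightarrow> 'm) \<Rightarrow> 16 \<Rightarrow> 'm::ab_group_add mhat \<Rightarrow> 'm mhat"
  where "xi_op sm i = tensor_lift (\<lambda>f v. tensor sm (pdiff i f) v)"

definition g0_op ::
  "complex \<Rightarrow> (complex ^ 10 ^ 10 \<Rightarrow> e6_vec) \<Rightarrow> (complex \<Rightarrow> 'm \<Rightarrow> 'm) \<Rightarrow>
   (complex ^ 10 ^ 10 \<Rightarrow> 'm \<Rightarrow> 'm) \<Rightarrow> e6_vec \<Rightarrow> 'm::ab_group_add mhat \<Rightarrow> 'm mhat"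
  where "g0_op c \<nu> sm am u = tensor_lift (\<lambda>f v.
    tensor sm (g0_diffop u f) v + tensor sm f (rho c \<nu> sm am u v))"

definition eta_op ::
  "complex \<Rightarrow> (complex ^ 10 ^ 10 \<Rightarrow> e6_vec) \<Rightarrow> (complex \<Rightarrow> 'm \<Rightarrow> 'm) \<Rightarrow>
   (complex ^ 10 ^ 10 \<Rightarrow> 'm \<Rightarrow> 'm) \<Rightarrow> 16 \<Rightarrow> 'm::ab_group_add mhat \<Rightarrow> 'm mhat"
  where "eta_op c \<nu> sm am i = tensor_lift (\<lambda>f v.
    tensor sm (P_op i f) v
    + (\<Sum>r\<in>UNIV. tensor sm (pvar r * f) (rho c \<nu> sm am (e6_bracket (xi r) (eta i)) v)))"

text \<open>
  The action of \<open>x = (\<Sum>i. a\<^sub>i \<eta>\<^sub>i) + u + (\<Sum>i. b\<^sub>i \<xi>\<^sub>i)\<close>, where \<open>u\<close> is the component of \<open>x\<close> of degree zero.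
\<close>

definition e6_action ::
  "complex \<Rightarrow> (complex ^ 10 ^ 10 \<Rightarrow> e6_vec) \<Rightarrow> (complex \<Rightarrow> 'm \<Rightarrow> 'm) \<Rightarrow>
   (complex ^ 10 ^ 10 \<Rightarrow> 'm \<Rightarrow> 'm) \<Rightarrow> e6_vec \<Rightarrow> 'm::ab_group_add mhat \<Rightarrow> 'm mhat"
  where "e6_action c \<nu> sm am x w =
    (let a = (\<lambda>i. Poly_Mapping.lookup (snd x) (- beta i));
         b = (\<lambda>i. Poly_Mapping.lookup (snd x) (beta i));
         u = x - (\<Sum>i\<in>UNIV. e6_scale (a i) (eta i)) - (\<Sum>i\<in>UNIV. e6_scale (b i) (xi i))
     in (\<Sum>i\<in>UNIV. mhat_scale sm (a i) (eta_op c \<nu> sm am i w))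
        + g0_op c \<nu> sm am u w
        + (\<Sum>i\<in>UNIV. mhat_scale sm (b i) (xi_op sm i w)))"

text \<open>\<open>M\<close> is identified with \<open>1 \<otimes> M\<close>.\<close>

definition U_minus_M ::
  "complex \<Rightarrow> (complex ^ 10 ^ 10 \<Rightarrow> e6_vec) \<Rightarrow> (complex \<Rightarrow> 'm \<Rightarrow> 'm) \<Rightarrow>
   (complex ^ 10 ^ 10 \<Rightarrow> 'm \<Rightarrow> 'm) \<Rightarrow> 'm::ab_group_add mhat set"
  where "U_minus_M c \<nu> sm am =
    enveloping_image g_minus (mhat_scale sm) (e6_action c \<nu> sm am) (range (tensor sm 1))"

end

theory Submission
  imports Defs
begin

text \<open>
  Grade the algebra by the coefficient of \<open>\<alpha>\<^sub>6\<close>. The \<open>\<xi>\<^sub>s\<close> act as the partial derivatives, and a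
  homogeneous element \<open>x\<close> satisfies \<open>[\<partial>\<^sub>s, x] = [\<xi>\<^sub>s, x]\<close> as operators. For \<open>x = \<eta>\<^sub>i\<close> this is where
  the quadrics \<open>\<zeta>\<^sub>k\<close> enter: up to a sign depending only on \<open>k\<close>, the monomial \<open>x\<^sub>a x\<^sub>b\<close> occurs in
  \<open>\<zeta>\<^sub>k\<close> with coefficient \<open>F(\<beta>\<^sub>a, \<beta>\<^sub>b)\<close>, precisely for the orthogonal pairs with a given sum
  \<open>\<beta>\<^sub>a + \<beta>\<^sub>b\<close>, which turns \<open>P\<^sub>i\<close> into \<open>1/2 \<Sum>\<^sub>s x\<^sub>s [\<xi>\<^sub>s, \<eta>\<^sub>i]\<close>. By the Jacobi identity the defect
  \<open>[x, y] - (x y - y x)\<close> then commutes with all derivatives modulo defects of higher degree. It has no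
  constant term, so it vanishes by descending induction on the degree, and \<open>A \<otimes> M\<close> is a module.
  A nonzero submodule of \<open>U(G\<^sub>-)(M)\<close> can be differentiated down to a nonzero vector of \<open>1 \<otimes> M\<close>,
  so it contains \<open>M\<close> by irreducibility, hence everything.
\<close>

section \<open>Index types and roots\<close>

text \<open>Irreducibility as defined includes the module axioms, so most of the work goes into the
  bracket law and not into submodules. Origin of the operators: let x be the sum of all
  \<open>x_s\<close> times \<open>xi s\<close>. The components of exp(ad x) applied to
  \<open>eta i\<close> in degrees 0 and 1 are [x, eta i] and 1/2 [x, [x, eta i]]. The first, acting
  on M, is the linear part of \<open>eta_op\<close>; the second, with \<open>xi l\<close> read as
  the l-th partial derivative, is the vector field \<open>P_op i\<close>. This explains the factor
  1/2, and why the part acting on M has none. Expanding the commutator of two \<open>eta\<close>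
  operators directly would require cubic identities among the quadrics, mixed with the action on M.
  Comparison of derivatives avoids this: it involves only the coefficients of the double brackets
  [[xi j, eta i], eta l], which are quadratic in the Hessians of the quadrics.\<close>

lemma UNIV_6: "(UNIV :: 6 set) = {1, 2, 3, 4, 5, 6}"
proof -
  have "card {1, 2, 3, 4, 5, 6 :: 6} = CARD(6)" by simp
  then show ?thesis by (metis card_subset_eq finite subset_UNIV)
qed

lemma UNIV_10: "(UNIV :: 10 set) = {1, 2, 3, 4, 5, 6, 7, 8, 9, 10}"
proof -
  have "card {1, 2, 3, 4, 5, 6, 7, 8, 9, 10 :: 10} = CARD(10)" by simp
  then show ?thesis by (metis card_subset_eq finite subset_UNIV)
qed

lemma UNIV_16: "(UNIV :: 16 set) = {1, 2, 3, 4, 5, 6, 7, 8, 9, 10, 11, 12, 13, 14, 15, 16}"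
proof -
  have "card {1, 2, 3, 4, 5, 6, 7, 8, 9, 10, 11, 12, 13, 14, 15, 16 :: 16} = CARD(16)" by simp
  then show ?thesis by (metis card_subset_eq finite subset_UNIV)
qed

lemma forall_6: "(\<forall>i :: 6. P i) \<longleftrightarrow> P 1 \<and> P 2 \<and> P 3 \<and> P 4 \<and> P 5 \<and> P 6"
  using UNIV_6 by (metis (mono_tags, opaque_lifting) UNIV_I empty_iff insert_iff)

lemma forall_16: "(\<forall>i :: 16. P i) \<longleftrightarrow> P 1 \<and> P 2 \<and> P 3 \<and> P 4 \<and> P 5 \<and> P 6 \<and> P 7 \<and> P 8 \<and>
   P 9 \<and> P 10 \<and> P 11 \<and> P 12 \<and> P 13 \<and> P 14 \<and> P 15 \<and> P 16"
proof -
  have "(\<forall>i :: 16. P i) \<longleftrightarrow> (\<forall>i\<in>UNIV. P i)" by simp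
  then show ?thesis unfolding UNIV_16 by simp
qed

lemma forall_10: "(\<forall>i :: 10. P i) \<longleftrightarrow> P 1 \<and> P 2 \<and> P 3 \<and> P 4 \<and> P 5 \<and> P 6 \<and> P 7 \<and> P 8 \<and>
   P 9 \<and> P 10"
proof -
  have "(\<forall>i :: 10. P i) \<longleftrightarrow> (\<forall>i\<in>UNIV. P i)" by simp
  then show ?thesis unfolding UNIV_10 by simp
qed

lemma cartan_sym: "cartan i j = cartan j i"
  by (simp add: cartan_def insert_commute)

lemma form_sym: "form a b = form b a"
proof -
  have "form a b = (\<Sum>i\<in>UNIV. \<Sum>j\<in>UNIV. of_int (cartan j i) * a $ i * b $ j)"
    unfolding form_def by (simp add: cartan_sym)
  also have "\<dots> = form b a" unfolding form_def
    by (subst sum.swap) (simp add: mult_ac)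
  finally show ?thesis .
qed

lemma form_add: "form (a + a') b = form a b + form a' b" "form a (b + b') = form a b + form a b'"
  by (simp_all add: form_def algebra_simps sum.distrib)
lemma form_minus: "form (- a) b = - form a b" "form a (- b) = - form a b"
  by (simp_all add: form_def sum_negf)
lemma form_diff: "form (a - a') b = form a b - form a' b" "form a (b - b') = form a b - form a b'"
  by (simp_all add: form_def algebra_simps sum_subtractf)
lemma form_zero [simp]: "form 0 b = 0" "form a 0 = 0"
  by (simp_all add: form_def)
lemma form_smult: "form (k *s a) b = k * form a b" "form a (k *s b) = k * form a b"
  by (simp_all add: form_def sum_distrib_left mult_ac)

lemma form_explicit: "form a b = 2 * (a$1*b$1 + a$2*b$2 + a$3*b$3 + a$4*b$4 + a$5*b$5 + a$6*b$6)
   - (a$1*b$3 + a$3*b$1) - (a$3*b$4 + a$4*b$3) - (a$4*b$5 + a$5*b$4) - (a$5*b$6 + a$6*b$5)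
   - (a$2*b$4 + a$4*b$2)"
  unfolding form_def UNIV_6
  by (simp add: cartan_def E6_edges_def doubleton_eq_iff algebra_simps)

text \<open>Explicit coordinates let the simplifier decide equalities and inner products of the
  listed roots by arithmetic on numerals.\<close>

definition vec6 :: "int \<Rightarrow> int \<Rightarrow> int \<Rightarrow> int \<Rightarrow> int \<Rightarrow> int \<Rightarrow> int ^ 6"
  where "vec6 a b c d e f = (\<chi> i. if i = 1 then a else if i = 2 then b else if i = 3 then c
     else if i = 4 then d else if i = 5 then e else f)"

lemma vec6_nth [simp]: "vec6 a b c d e f $ 1 = a" "vec6 a b c d e f $ 2 = b" "vec6 a b c d e f $ 3 = c"
  "vec6 a b c d e f $ 4 = d" "vec6 a b c d e f $ 5 = e" "vec6 a b c d e f $ 6 = f"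
  by (simp_all add: vec6_def)

lemma vec_eq_6: "(x :: 'a ^ 6) = y \<longleftrightarrow> x$1 = y$1 \<and> x$2 = y$2 \<and> x$3 = y$3 \<and> x$4 = y$4 \<and> x$5 = y$5 \<and> x$6 = y$6"
  unfolding vec_eq_iff forall_6 ..

lemma vec6_eq: "vec6 a b c d e f = vec6 a' b' c' d' e' f' \<longleftrightarrow> a = a' \<and> b = b' \<and> c = c' \<and> d = d' \<and> e = e' \<and> f = f'"
  by (simp add: vec_eq_6)

lemma vec6_add: "vec6 a b c d e f + vec6 a' b' c' d' e' f' = vec6 (a+a') (b+b') (c+c') (d+d') (e+e') (f+f')"
  by (simp add: vec_eq_6)

lemma beta_vec6:
  "beta 1 = vec6 0 0 0 0 0 1" "beta 2 = vec6 0 0 0 0 1 1" "beta 3 = vec6 0 0 0 1 1 1"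
  "beta 4 = vec6 0 0 1 1 1 1" "beta 5 = vec6 0 1 0 1 1 1" "beta 6 = vec6 0 1 1 1 1 1"
  "beta 7 = vec6 1 0 1 1 1 1" "beta 8 = vec6 1 1 1 1 1 1" "beta 9 = vec6 0 1 1 2 1 1"
  "beta 10 = vec6 1 1 1 2 1 1" "beta 11 = vec6 0 1 1 2 2 1" "beta 12 = vec6 1 1 2 2 1 1"
  "beta 13 = vec6 1 1 1 2 2 1" "beta 14 = vec6 1 1 2 2 2 1" "beta 15 = vec6 1 1 2 3 2 1"
  "beta 16 = vec6 1 2 2 3 2 1"
  by (simp_all add: beta_def Let_def vec_eq_6 simple_root_def axis_def)

lemma inj_beta: "beta i = beta j \<longleftrightarrow> i = j"
proof -
  have "\<forall>i j. beta i = beta j \<longleftrightarrow> i = j"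
    unfolding forall_16 by (simp add: beta_vec6 vec6_eq)
  then show ?thesis by blast
qed

lemma form_beta: "form (beta i) (beta i) = 2" and beta_6: "beta i $ 6 = 1"
proof -
  have "\<forall>i. form (beta i) (beta i) = 2 \<and> beta i $ 6 = 1"
    unfolding forall_16 form_explicit by (simp add: beta_vec6)
  then show "form (beta i) (beta i) = 2" "beta i $ 6 = 1" by blast+
qed

text \<open>
  The first five squares are those of twice the coordinates of the projection to the span of \<open>D\<^sub>5\<close>,
  with respect to the usual orthonormal basis.
\<close>

lemma form_squares: "4 * form a a = (2*a$1 - a$6)^2 + (2*(a$3-a$1) - a$6)^2 + (2*(a$4-a$3) - a$6)^2
   + (2*(a$5+a$2-a$4) - a$6)^2 + (2*(a$2-a$5) + a$6)^2 + 3 * (a$6)^2" for a :: "int ^ 6"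
  unfolding form_explicit by (simp add: power2_eq_square algebra_simps)

text \<open>The formulation with \<le> yields nonnegativity and definiteness at once.\<close>

lemma form_definite: "form a a \<le> 0 \<longleftrightarrow> a = 0" for a :: "int ^ 6"
proof
  assume *: "form a a \<le> 0"
  have "(2*a$1 - a$6)^2 + (2*(a$3-a$1) - a$6)^2 + (2*(a$4-a$3) - a$6)^2
   + (2*(a$5+a$2-a$4) - a$6)^2 + (2*(a$2-a$5) + a$6)^2 + 3 * (a$6)^2 \<le> 0"
    using * form_squares[of a] by linarith
  then have "(2*a$1 - a$6)^2 = 0 \<and> (2*(a$3-a$1) - a$6)^2 = 0 \<and> (2*(a$4-a$3) - a$6)^2 = 0
   \<and> (2*(a$5+a$2-a$4) - a$6)^2 = 0 \<and> (2*(a$2-a$5) + a$6)^2 = 0 \<and> (a$6)^2 = 0"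
    using zero_le_power2[of "2*a$1 - a$6"] zero_le_power2[of "2*(a$3-a$1) - a$6"]
      zero_le_power2[of "2*(a$4-a$3) - a$6"] zero_le_power2[of "2*(a$5+a$2-a$4) - a$6"]
      zero_le_power2[of "2*(a$2-a$5) + a$6"] zero_le_power2[of "a$6"] by linarith
  then show "a = 0" by (simp add: vec_eq_6)
qed simp

lemma square_gt_1: "(x::int)^2 \<ge> 4 \<or> x = 0 \<or> x = 1 \<or> x = -1"
proof -
  consider "x \<ge> 2" | "x \<le> -2" | "x = 0 \<or> x = 1 \<or> x = -1" by linarith
  then show ?thesis
  proof cases
    case 1 then show ?thesis using power_mono[of 2 x 2] by simp
  next
    case 2 then show ?thesis using power_mono[of 2 "-x" 2] by simp
  qed auto
qed

text \<open>The term \<open>3 * (a$6)^2\<close> in the sum of squares is at most 4 * 2 = 8, which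
  excludes a last coordinate of absolute value 2 or more. Hence only the degrees -1, 0, 1
  occur.\<close>

lemma root_6: assumes "\<alpha> \<in> Phi_E6" shows "\<alpha> $ 6 \<in> {-1, 0, 1}"
proof (rule ccontr)
  assume "\<alpha> $ 6 \<notin> {-1, 0, 1}"
  then have "(\<alpha> $ 6)^2 \<ge> 4" using square_gt_1[of "\<alpha> $ 6"] by auto
  moreover have "4 * form \<alpha> \<alpha> \<ge> 3 * (\<alpha> $ 6)^2" unfolding form_squares by simp
  ultimately show False using assms by (simp add: Phi_E6_def)
qed

text \<open>With last coordinate 1 the other five squares of \<open>form_squares\<close> add up to 8
  - 3 = 5. Their bases are odd, so each is 1 or -1. The sum and the difference of the second and
  fifth coordinates have the same parity, which fixes one of the five signs. The 16 solutions are
  the weights of a half-spin representation of \<open>D5\<close>.\<close>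

lemma root_1_beta: assumes "\<alpha> \<in> Phi_E6" "\<alpha> $ 6 = 1" shows "\<alpha> \<in> range beta"
proof -
  define a b c d e where ab: "a = 2*\<alpha>$1 - 1" "b = 2*(\<alpha>$3-\<alpha>$1) - 1" "c = 2*(\<alpha>$4-\<alpha>$3) - 1"
    "d = 2*(\<alpha>$5+\<alpha>$2-\<alpha>$4) - 1" "e = 2*(\<alpha>$2-\<alpha>$5) + 1"
  have s: "a^2 + b^2 + c^2 + d^2 + e^2 = 5"
    using form_squares[of \<alpha>] assms unfolding Phi_E6_def ab by simp
  have odd: "odd a" "odd b" "odd c" "odd d" "odd e" unfolding ab by simp_all
  have ge: "x^2 \<ge> 1" if "odd x" for x :: int
    using that square_gt_1[of x] by auto
  have pm: "x = 1 \<or> x = -1" if "odd x" "x^2 \<le> 1" for x :: int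
    using that square_gt_1[of x] by auto
  note g = odd[THEN ge]
  have "a^2 \<le> 1" "b^2 \<le> 1" "c^2 \<le> 1" "d^2 \<le> 1" "e^2 \<le> 1" using s g by linarith+
  with odd have pms: "a = 1 \<or> a = -1" "b = 1 \<or> b = -1" "c = 1 \<or> c = -1" "d = 1 \<or> d = -1" "e = 1 \<or> e = -1"
    using pm by blast+
  have mem: "\<alpha> = beta i \<Longrightarrow> \<alpha> \<in> range beta" for i by blast
  have "\<alpha> $ 1 = 0 \<or> \<alpha> $ 1 = 1" "\<alpha> $ 3 = \<alpha> $ 1 \<or> \<alpha> $ 3 = \<alpha> $ 1 + 1" "\<alpha> $ 4 = \<alpha> $ 3 \<or> \<alpha> $ 4 = \<alpha> $ 3 + 1"
    "\<alpha> $ 5 = \<alpha> $ 4 - \<alpha> $ 2 \<or> \<alpha> $ 5 = \<alpha> $ 4 - \<alpha> $ 2 + 1" "\<alpha> $ 2 = \<alpha> $ 5 \<or> \<alpha> $ 2 = \<alpha> $ 5 - 1"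
    using pms unfolding ab by presburger+
  then have "\<exists>i\<in>UNIV. \<alpha> = beta i"
    unfolding UNIV_16 vec_eq_6 using assms(2) apply (simp add: beta_vec6)
    by presburger
  then show ?thesis by blast
qed

section \<open>Signs of the cocycle F\<close>

lemma cocycle_add: "cocycle (a + b) g = cocycle a g * cocycle b g" "cocycle g (a + b) = cocycle g a * cocycle g b"
  unfolding cocycle_def UNIV_6
  by (simp_all flip: power_int_add) (simp_all add: algebra_simps)

lemma powi_minus_one: "(-1 :: complex) powi n = (if even n then 1 else - 1)"
  by (simp add: power_int_minus_left)

lemma powi_minus_one_parity:
  "m + n = f + 2 * k \<Longrightarrow> (-1 :: complex) powi m = (-1) powi f * (-1) powi n"
  unfolding powi_minus_one by (cases "even m"; cases "even n"; cases "even f"; simp; presburger)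

lemma cocycle_minus [simp]: "cocycle (- a) b = cocycle a b" "cocycle a (- b) = cocycle a b"
proof -
  have *: "m + n = 0 \<Longrightarrow> (-1::complex) powi m = (-1) powi n" for m n
    unfolding powi_minus_one by (metis even_add even_zero)
  show "cocycle (- a) b = cocycle a b" "cocycle a (- b) = cocycle a b"
    unfolding cocycle_def by (rule *, simp add: sum_negf)+
qed

lemma cocycle_diff: "cocycle (a - b) g = cocycle a g * cocycle b g" "cocycle g (a - b) = cocycle g a * cocycle g b"
  using cocycle_add[of a "- b"] cocycle_add(2)[of g a "- b"] by simp_all

lemma cocycle_cases: "cocycle a b = 1 \<or> cocycle a b = -1"
  unfolding cocycle_def powi_minus_one by auto

lemma cocycle_square [simp]: "cocycle a b * cocycle a b = 1" "cocycle a b * (cocycle a b * z) = z"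
  using cocycle_cases[of a b] by auto

text \<open>The exponent of F is bilinear and contains each edge of the diagram in one orientation
  only. Its symmetrization agrees with the form modulo 2: the diagonal terms coincide, and the edges
  enter with opposite signs.\<close>

lemma cocycle_swap: "cocycle b a = (-1) powi (form a b) * cocycle a b"
proof -
  let ?n = "\<lambda>k l :: int ^ 6. (\<Sum>i\<in>UNIV. k $ i * l $ i) + k $ 1 * l $ 3 + k $ 4 * l $ 2 + k $ 3 * l $ 4
      + k $ 5 * l $ 4 + k $ 6 * l $ 5"
  have "?n b a + ?n a b = form a b + 2 * (?n b a + ?n a b - (\<Sum>i\<in>UNIV. 2 * (a $ i * b $ i)))"
    unfolding form_explicit UNIV_6 by (simp add: algebra_simps)
  then show ?thesis unfolding cocycle_def by (rule powi_minus_one_parity)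
qed

text \<open>Half of \<open>form a a\<close> is the sum of the squares minus the edge terms, while
  the exponent of \<open>cocycle a a\<close> is the sum of the squares plus the edge terms; the two
  have the same parity.\<close>

lemma cocycle_self:
  assumes "form a a = 2"
  shows "cocycle a a = -1"
proof -
  let ?e = "a $ 1 * a $ 3 + a $ 4 * a $ 2 + a $ 3 * a $ 4 + a $ 5 * a $ 4 + a $ 6 * a $ 5"
  have "(\<Sum>i\<in>UNIV. a $ i * a $ i) + ?e = 1 + 2 * ?e"
    using assms unfolding form_explicit UNIV_6 by (simp add: algebra_simps)
  then have "cocycle a a = (-1) powi (1 + 2 * ?e)"
    by (simp add: cocycle_def add.assoc)
  then show ?thesis by (simp add: power_int_minus_left)
qed

lemma to_H_add: "to_H (a + b) = to_H a + to_H b" and to_H_minus: "to_H (- a) = - to_H a"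
  by (simp_all add: to_H_def vec_eq_iff)

lemma form_to_H: "form (to_H a) (to_H b) = of_int (form a b)"
  by (simp add: form_def to_H_def)

lemma root_minus [simp]: "- \<alpha> \<in> Phi_E6 \<longleftrightarrow> \<alpha> \<in> Phi_E6"
  by (simp add: Phi_E6_def form_minus)

lemma zero_not_root [simp]: "0 \<notin> Phi_E6"
  by (simp add: Phi_E6_def)

text \<open>Everything follows from definiteness applied to \<alpha> + \<beta> and \<alpha> -
  \<beta>, whose norms are 4 plus and 4 minus twice the inner product.\<close>

lemma form_roots_cases:
  assumes "\<alpha> \<in> Phi_E6" "\<beta> \<in> Phi_E6"
  shows "form \<alpha> \<beta> \<in> {-2, -1, 0, 1, 2}"
    and "form \<alpha> \<beta> = -2 \<longleftrightarrow> \<beta> = - \<alpha>"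
    and "\<alpha> + \<beta> \<in> Phi_E6 \<longleftrightarrow> form \<alpha> \<beta> = -1"
proof -
  have n: "form (\<alpha> + \<beta>) (\<alpha> + \<beta>) = 4 + 2 * form \<alpha> \<beta>" "form (\<alpha> - \<beta>) (\<alpha> - \<beta>) = 4 - 2 * form \<alpha> \<beta>"
    using assms form_sym[of \<beta> \<alpha>] by (simp_all add: Phi_E6_def form_add form_diff)
  have ge: "form a a \<ge> 0" for a :: "int^6"
    using form_definite[of a] by fastforce
  from n ge[of "\<alpha> + \<beta>"] ge[of "\<alpha> - \<beta>"] show "form \<alpha> \<beta> \<in> {-2, -1, 0, 1, 2}" by force
  have "form \<alpha> \<beta> = -2 \<longleftrightarrow> \<alpha> + \<beta> = 0"
    unfolding form_definite[symmetric] using n(1) ge[of "\<alpha> + \<beta>"] by linarith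
  then show "form \<alpha> \<beta> = -2 \<longleftrightarrow> \<beta> = - \<alpha>"
    by (simp add: add_eq_0_iff)
  show "\<alpha> + \<beta> \<in> Phi_E6 \<longleftrightarrow> form \<alpha> \<beta> = -1"
    using n by (auto simp: Phi_E6_def)
qed

section \<open>The bracket of \<open>E\<^sub>6\<close>\<close>

definition Hv :: "complex ^ 6 \<Rightarrow> e6_vec"
  where "Hv h = (h, 0)"

text \<open>In contrast to \<open>Evec\<close> the coefficient is part of the vector, so inductions
  over sums of root vectors need no scalar step.\<close>

definition Ev :: "int ^ 6 \<Rightarrow> complex \<Rightarrow> e6_vec"
  where "Ev \<alpha> c = (0, Poly_Mapping.single \<alpha> c)"

lemma Evec_Ev: "Evec \<alpha> = Ev \<alpha> 1" by (simp add: Evec_def Ev_def)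
lemma hvec_Hv: "hvec \<alpha> = Hv (to_H \<alpha>)" by (simp add: hvec_def Hv_def)

lemma snd_sum: "snd (sum f A) = (\<Sum>x\<in>A. snd (f x))"
  by (induction A rule: infinite_finite_induct) auto
lemma fst_sum: "fst (sum f A) = (\<Sum>x\<in>A. fst (f x))"
  by (induction A rule: infinite_finite_induct) auto

lemma lookup_map: "g 0 = 0 \<Longrightarrow> Poly_Mapping.lookup (Poly_Mapping.map g f) k = g (Poly_Mapping.lookup f k)"
  by (simp add: Poly_Mapping.map.rep_eq when_def)

lemma fst_scale [simp]: "fst (e6_scale k x) = k *s fst x"
  by (simp add: e6_scale_def)
lemma lookup_scale [simp]: "Poly_Mapping.lookup (snd (e6_scale k x)) \<alpha> = k * Poly_Mapping.lookup (snd x) \<alpha>"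
  by (simp add: e6_scale_def lookup_map)

lemma e6_vec_eqI:
  "fst x = fst y \<Longrightarrow> (\<And>\<alpha>. Poly_Mapping.lookup (snd x) \<alpha> = Poly_Mapping.lookup (snd y) \<alpha>) \<Longrightarrow> x = (y :: e6_vec)"
  by (simp add: prod_eq_iff poly_mapping_eqI)

lemma scale_Ev [simp]: "e6_scale k (Ev \<alpha> c) = Ev \<alpha> (k * c)"
  by (rule e6_vec_eqI) (simp_all add: Ev_def lookup_single when_def)
lemma scale_Hv [simp]: "e6_scale k (Hv h) = Hv (k *s h)"
  by (rule e6_vec_eqI) (simp_all add: Hv_def)

interpretation e6v: vector_space e6_scale
  by unfold_locales
    (rule e6_vec_eqI, simp_all add: lookup_add vector_add_ldistrib vector_sadd_rdistrib algebra_simps)+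

lemma mem_e6: "x \<in> e6 \<longleftrightarrow> (\<forall>\<alpha>. \<alpha> \<notin> Phi_E6 \<longrightarrow> Poly_Mapping.lookup (snd x) \<alpha> = 0)"
  by (auto simp: e6_def in_keys_iff)

lemma e6_subspace: "e6v.subspace e6"
  by (auto simp: e6v.subspace_def mem_e6 lookup_add)

lemma Ev_e6: "\<alpha> \<in> Phi_E6 \<Longrightarrow> Ev \<alpha> c \<in> e6"
  by (auto simp: mem_e6 Ev_def lookup_single when_def)
lemma Hv_e6: "Hv h \<in> e6"
  by (auto simp: mem_e6 Hv_def)

lemma e6_decomp:
  "x = Hv (fst x) + (\<Sum>\<alpha>\<in>Poly_Mapping.keys (snd x). Ev \<alpha> (Poly_Mapping.lookup (snd x) \<alpha>))"
proof (rule e6_vec_eqI)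
  fix \<alpha>
  show "Poly_Mapping.lookup (snd x) \<alpha> = Poly_Mapping.lookup (snd (Hv (fst x) +
     (\<Sum>\<alpha>\<in>Poly_Mapping.keys (snd x). Ev \<alpha> (Poly_Mapping.lookup (snd x) \<alpha>)))) \<alpha>"
    by (simp add: Hv_def Ev_def lookup_add snd_sum lookup_sum lookup_single when_def in_keys_iff)
qed (simp add: Hv_def Ev_def fst_sum)

lemma e6_induct [consumes 1, case_names H E add]:
  assumes "x \<in> e6" and H: "\<And>h. P (Hv h)" and E: "\<And>\<alpha> c. \<alpha> \<in> Phi_E6 \<Longrightarrow> P (Ev \<alpha> c)"
    and add: "\<And>x y. x \<in> e6 \<Longrightarrow> y \<in> e6 \<Longrightarrow> P x \<Longrightarrow> P y \<Longrightarrow> P (x + y)"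
  shows "P x"
proof -
  have "(\<Sum>\<alpha>\<in>S. Ev \<alpha> (f \<alpha>)) \<in> e6 \<and> P (\<Sum>\<alpha>\<in>S. Ev \<alpha> (f \<alpha>))"
    if "finite S" "S \<subseteq> Phi_E6" for S f
    using that
  proof (induction S)
    case empty
    have "Hv 0 = 0" by (simp add: Hv_def zero_prod_def)
    then show ?case using H[of 0] Hv_e6[of 0] by simp
  next
    case (insert \<alpha> S)
    then show ?case using add[OF Ev_e6[of \<alpha> "f \<alpha>"]] E e6v.subspace_add[OF e6_subspace] Ev_e6 by simp
  qed
  from this[of "Poly_Mapping.keys (snd x)" "Poly_Mapping.lookup (snd x)"]
  have "P (Hv (fst x) + (\<Sum>\<alpha>\<in>Poly_Mapping.keys (snd x). Ev \<alpha> (Poly_Mapping.lookup (snd x) \<alpha>)))"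
    using assms(1) add[OF Hv_e6 _ H] by (simp add: e6_def)
  then show ?thesis using e6_decomp[of x] by simp
qed

text \<open>Cancellation can make the support of a sum smaller than those of its summands, so
  additivity is proved over a common finite index set. The additional terms are zero.\<close>

lemma e6_bracket_superset:
  assumes "finite S" "finite T" "Poly_Mapping.keys (snd x) \<subseteq> S" "Poly_Mapping.keys (snd y) \<subseteq> T"
  shows "e6_bracket x y = (- (\<Sum>\<alpha>\<in>S. (Poly_Mapping.lookup (snd x) \<alpha> * Poly_Mapping.lookup (snd y) (- \<alpha>)) *s to_H \<alpha>),
         (\<Sum>\<beta>\<in>T. Poly_Mapping.single \<beta> (form (fst x) (to_H \<beta>) * Poly_Mapping.lookup (snd y) \<beta>))
         - (\<Sum>\<alpha>\<in>S. Poly_Mapping.single \<alpha> (form (fst y) (to_H \<alpha>) * Poly_Mapping.lookup (snd x) \<alpha>))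
         + (\<Sum>\<alpha>\<in>S. \<Sum>\<beta>\<in>T. if \<alpha> + \<beta> \<in> Phi_E6
             then Poly_Mapping.single (\<alpha> + \<beta>) (cocycle \<alpha> \<beta> * Poly_Mapping.lookup (snd x) \<alpha> * Poly_Mapping.lookup (snd y) \<beta>) else 0))"
proof -
  let ?K = "Poly_Mapping.keys (snd x)" and ?L = "Poly_Mapping.keys (snd y)"
  have a: "(\<Sum>\<alpha>\<in>?K. (Poly_Mapping.lookup (snd x) \<alpha> * Poly_Mapping.lookup (snd y) (- \<alpha>)) *s to_H \<alpha>)
    = (\<Sum>\<alpha>\<in>S. (Poly_Mapping.lookup (snd x) \<alpha> * Poly_Mapping.lookup (snd y) (- \<alpha>)) *s to_H \<alpha>)"
    by (rule sum.mono_neutral_left) (use assms in \<open>auto simp: in_keys_iff\<close>)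
  have b: "(\<Sum>\<beta>\<in>?L. Poly_Mapping.single \<beta> (form (fst x) (to_H \<beta>) * Poly_Mapping.lookup (snd y) \<beta>))
    = (\<Sum>\<beta>\<in>T. Poly_Mapping.single \<beta> (form (fst x) (to_H \<beta>) * Poly_Mapping.lookup (snd y) \<beta>))"
    by (rule sum.mono_neutral_left) (use assms in \<open>auto simp: in_keys_iff\<close>)
  have c: "(\<Sum>\<beta>\<in>?K. Poly_Mapping.single \<beta> (form (fst y) (to_H \<beta>) * Poly_Mapping.lookup (snd x) \<beta>))
    = (\<Sum>\<beta>\<in>S. Poly_Mapping.single \<beta> (form (fst y) (to_H \<beta>) * Poly_Mapping.lookup (snd x) \<beta>))"
    by (rule sum.mono_neutral_left) (use assms in \<open>auto simp: in_keys_iff\<close>)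
  let ?f = "\<lambda>\<alpha> \<beta>. if \<alpha> + \<beta> \<in> Phi_E6
             then Poly_Mapping.single (\<alpha> + \<beta>) (cocycle \<alpha> \<beta> * Poly_Mapping.lookup (snd x) \<alpha> * Poly_Mapping.lookup (snd y) \<beta>) else 0"
  have "(\<Sum>\<beta>\<in>?L. ?f \<alpha> \<beta>) = (\<Sum>\<beta>\<in>T. ?f \<alpha> \<beta>)" for \<alpha>
    by (rule sum.mono_neutral_left) (use assms in \<open>auto simp: in_keys_iff\<close>)
  then have "(\<Sum>\<alpha>\<in>?K. \<Sum>\<beta>\<in>?L. ?f \<alpha> \<beta>) = (\<Sum>\<alpha>\<in>?K. \<Sum>\<beta>\<in>T. ?f \<alpha> \<beta>)" by simp
  also have "\<dots> = (\<Sum>\<alpha>\<in>S. \<Sum>\<beta>\<in>T. ?f \<alpha> \<beta>)"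
    by (rule sum.mono_neutral_left) (use assms in \<open>auto simp: in_keys_iff intro!: sum.neutral\<close>)
  finally show ?thesis unfolding e6_bracket_def Let_def a b c by simp
qed

lemma e6_bracket_add: "e6_bracket (x + x') y = e6_bracket x y + e6_bracket x' y" (is ?A)
  "e6_bracket y (x + x') = e6_bracket y x + e6_bracket y x'" (is ?B)
proof -
  let ?K = "\<lambda>x :: e6_vec. Poly_Mapping.keys (snd x)"
  let ?S = "?K x \<union> ?K x' \<union> ?K (x + x')"
  have s: "finite ?S" "?K x \<subseteq> ?S" "?K x' \<subseteq> ?S" "?K (x + x') \<subseteq> ?S" by auto
  note sup = e6_bracket_superset[OF s(1) finite_keys[of "snd y"] s(2) order_refl]
    e6_bracket_superset[OF s(1) finite_keys[of "snd y"] s(3) order_refl]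
    e6_bracket_superset[OF s(1) finite_keys[of "snd y"] s(4) order_refl]
  note sup' = e6_bracket_superset[OF finite_keys[of "snd y"] s(1) order_refl s(2)]
    e6_bracket_superset[OF finite_keys[of "snd y"] s(1) order_refl s(3)]
    e6_bracket_superset[OF finite_keys[of "snd y"] s(1) order_refl s(4)]
  have i: "(if P then a + b else 0) = (if P then a else 0) + (if P then b else 0)" for P and a b :: "'x :: monoid_add"
    by simp
  show ?A
    unfolding sup
    by (simp add: lookup_add algebra_simps vector_sadd_rdistrib single_add sum.distrib form_add i cong: if_cong)
  show ?B
    unfolding sup'
    by (simp add: lookup_add algebra_simps vector_sadd_rdistrib single_add sum.distrib form_add i cong: if_cong)
qed

lemma e6_bracket_zero [simp]: "e6_bracket x 0 = 0" "e6_bracket 0 x = 0"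
  using e6_bracket_add(1)[of 0 0 x] e6_bracket_add(2)[of x 0 0] by simp_all

lemma e6_bracket_minus [simp]: "e6_bracket (- x) y = - e6_bracket x y" "e6_bracket y (- x) = - e6_bracket y x"
  using e6_bracket_add(1)[of x "- x" y] e6_bracket_add(2)[of y x "- x"] by (simp_all add: eq_neg_iff_add_eq_0 add.commute)

lemma bracket_HH [simp]: "e6_bracket (Hv h) (Hv h') = 0"
  by (simp add: e6_bracket_def Hv_def zero_prod_def)

lemma bracket_HE [simp]: "e6_bracket (Hv h) (Ev \<alpha> c) = Ev \<alpha> (form h (to_H \<alpha>) * c)"
  by (subst e6_bracket_superset[of "{}" "{\<alpha>}"]) (auto simp: Hv_def Ev_def)

lemma bracket_EH [simp]: "e6_bracket (Ev \<alpha> c) (Hv h) = Ev \<alpha> (- (form h (to_H \<alpha>) * c))"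
  by (subst e6_bracket_superset[of "{\<alpha>}" "{}"]) (auto simp: Hv_def Ev_def single_uminus)

lemma bracket_EE:
  assumes "\<alpha> \<in> Phi_E6" "\<beta> \<in> Phi_E6"
  shows "e6_bracket (Ev \<alpha> c) (Ev \<beta> d) = (if form \<alpha> \<beta> = -2 then Hv (- (c * d) *s to_H \<alpha>)
     else if form \<alpha> \<beta> = -1 then Ev (\<alpha> + \<beta>) (cocycle \<alpha> \<beta> * c * d) else 0)"
  using form_roots_cases[OF assms]
  by (subst e6_bracket_superset[of "{\<alpha>}" "{\<beta>}"])
     (auto simp: Hv_def Ev_def lookup_single when_def zero_prod_def vec_eq_iff)

lemma e6_closed: "x \<in> e6 \<Longrightarrow> y \<in> e6 \<Longrightarrow> e6_bracket x y \<in> e6"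
proof (induction x rule: e6_induct)
  case (H h)
  then show ?case
  proof (induction y rule: e6_induct)
    case (H h')
    then show ?case by (simp add: e6v.subspace_0[OF e6_subspace])
  qed (auto simp: Ev_e6 e6_bracket_add e6v.subspace_add[OF e6_subspace])
next
  case (E \<alpha> c)
  from E(2,1) show ?case
  proof (induction y rule: e6_induct)
    case (E \<beta> d)
    then show ?case using form_roots_cases[of \<alpha> \<beta>]
      by (simp add: bracket_EE Hv_e6 Ev_e6 e6v.subspace_0[OF e6_subspace])
  qed (auto simp: Ev_e6 e6_bracket_add e6v.subspace_add[OF e6_subspace])
qed (auto simp: e6_bracket_add e6v.subspace_add[OF e6_subspace])

lemma Hv_add: "Hv a + Hv b = Hv (a + b)" and Ev_add: "Ev \<alpha> c + Ev \<alpha> d = Ev \<alpha> (c + d)"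
  and Hv_0: "Hv 0 = 0" and Ev_0: "Ev \<alpha> 0 = 0" and Hv_minus: "Hv (- a) = - Hv a" and Ev_minus: "Ev \<alpha> (- c) = - Ev \<alpha> c"
  by (simp_all add: Hv_def Ev_def single_add single_uminus zero_prod_def)

text \<open>For roots with inner product -1 the cocycle changes sign when its arguments are swapped;
  an opposite pair gives -\<alpha> in one order and \<alpha> in the other.\<close>

lemma bracket_antisym: "x \<in> e6 \<Longrightarrow> y \<in> e6 \<Longrightarrow> e6_bracket y x = - e6_bracket x y"
proof (induction x rule: e6_induct)
  case (H h)
  then show ?case
  proof (induction y rule: e6_induct)
    case (E \<alpha> c)
    then show ?case by (simp add: Ev_minus)
  qed (auto simp: e6_bracket_add)
next
  case (E \<alpha> c)
  from E(2,1) show ?case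
  proof (induction y rule: e6_induct)
    case (E \<beta> d)
    have [simp]: "form \<beta> \<alpha> = form \<alpha> \<beta>" by (rule form_sym)
    have "form \<alpha> \<beta> = -1 \<Longrightarrow> cocycle \<beta> \<alpha> = - cocycle \<alpha> \<beta>"
      by (subst cocycle_swap) simp
    then show ?case using form_roots_cases(2)[OF E(2) E(1)] E
      by (auto simp: bracket_EE mult_ac add_ac to_H_minus Hv_minus Ev_minus)
  qed (auto simp: e6_bracket_add Ev_minus)
qed (auto simp: e6_bracket_add)

lemma root_forms [simp]: "\<alpha> \<in> Phi_E6 \<Longrightarrow> form \<alpha> \<alpha> = 2" "\<alpha> \<in> Phi_E6 \<Longrightarrow> cocycle \<alpha> \<alpha> = -1"
  by (simp_all add: Phi_E6_def cocycle_self)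

text \<open>A Cartan element can appear only if two of the roots are opposite or all three add up to
  0. Otherwise every nonzero term is a multiple of the root vector at \<alpha> + \<beta> + \<gamma>,
  and by bimultiplicativity the coefficients differ only by the sign of exchanging \<alpha> and
  \<beta>.\<close>

lemma jacobi_EEE:
  assumes "\<alpha> \<in> Phi_E6" "\<beta> \<in> Phi_E6" "\<gamma> \<in> Phi_E6"
  shows "e6_bracket (Ev \<alpha> a) (e6_bracket (Ev \<beta> b) (Ev \<gamma> c)) =
    e6_bracket (e6_bracket (Ev \<alpha> a) (Ev \<beta> b)) (Ev \<gamma> c) + e6_bracket (Ev \<beta> b) (e6_bracket (Ev \<alpha> a) (Ev \<gamma> c))"
proof -
  have sym: "form \<beta> \<alpha> = form \<alpha> \<beta>" "form \<gamma> \<alpha> = form \<alpha> \<gamma>" "form \<gamma> \<beta> = form \<beta> \<gamma>"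
    by (rule form_sym)+
  note c = form_roots_cases[OF assms(1,2)] form_roots_cases[OF assms(1,3)] form_roots_cases[OF assms(2,3)]
  have sw: "form x y = -1 \<Longrightarrow> cocycle y x = - cocycle x y" "form x y = 0 \<Longrightarrow> cocycle y x = cocycle x y"
    "form x y = 1 \<Longrightarrow> cocycle y x = - cocycle x y" for x y
    using cocycle_swap[of y x] by simp_all
  note basic = bracket_EE assms form_add form_minus form_diff cocycle_add cocycle_diff sym form_to_H to_H_minus to_H_add
    Ev_minus Hv_minus mult_ac form_smult Ev_0 Hv_0
  consider "\<beta> = - \<alpha>" | "\<gamma> = - \<alpha>" | "\<gamma> = - \<beta>" | "\<beta> \<noteq> - \<alpha>" "\<gamma> \<noteq> - \<alpha>" "\<gamma> \<noteq> - \<beta>" "\<alpha> + \<beta> + \<gamma> = 0"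
     | "\<beta> \<noteq> - \<alpha>" "\<gamma> \<noteq> - \<alpha>" "\<gamma> \<noteq> - \<beta>" "\<alpha> + \<beta> + \<gamma> \<noteq> 0" by blast
  then show ?thesis
  proof cases
    case 1
    consider "\<gamma> = - \<alpha>" "form \<alpha> \<gamma> = -2" | "form \<alpha> \<gamma> = -1" "\<alpha> + \<gamma> \<in> Phi_E6" | "form \<alpha> \<gamma> = 0"
      | "form \<alpha> \<gamma> = 1" "- \<alpha> + \<gamma> \<in> Phi_E6" | "\<gamma> = \<alpha>" "form \<alpha> \<gamma> = 2"
      using c(4-6) form_roots_cases[of "- \<alpha>" \<gamma>] assms by (auto simp: form_minus)
    then show ?thesis by cases (simp_all add: basic 1)
  next
    case 2
    consider "\<beta> = - \<alpha>" "form \<alpha> \<beta> = -2" | "form \<alpha> \<beta> = -1" "\<alpha> + \<beta> \<in> Phi_E6" | "form \<alpha> \<beta> = 0"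
      | "form \<alpha> \<beta> = 1" "\<beta> - \<alpha> \<in> Phi_E6" | "\<beta> = \<alpha>" "form \<alpha> \<beta> = 2"
      using c(1-3) form_roots_cases[of "- \<alpha>" \<beta>] assms by (auto simp: form_minus)
    then show ?thesis by cases (simp_all add: basic 2 sw[of \<alpha> \<beta>])
  next
    case 3
    consider "\<beta> = - \<alpha>" "form \<alpha> \<beta> = -2" | "form \<alpha> \<beta> = -1" "\<alpha> + \<beta> \<in> Phi_E6" | "form \<alpha> \<beta> = 0"
      | "form \<alpha> \<beta> = 1" "\<alpha> - \<beta> \<in> Phi_E6" | "\<beta> = \<alpha>" "form \<alpha> \<beta> = 2"
      using c(1-3) form_roots_cases[of \<alpha> "- \<beta>"] assms by (auto simp: form_minus)
    then show ?thesis by cases (simp_all add: basic 3 sw[of \<alpha> \<beta>])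
  next
    case 4
    then have g: "\<gamma> = - (\<alpha> + \<beta>)" by (metis add_eq_0_iff)
    have "form \<gamma> \<gamma> = 2" using assms by simp
    then have p: "form \<alpha> \<beta> = -1" unfolding g using assms by (simp add: form_add form_minus form_diff sym)
    then have ab: "\<alpha> + \<beta> \<in> Phi_E6" using c by simp
    have "- \<alpha> - \<beta> \<in> Phi_E6" using ab root_minus[of "\<alpha> + \<beta>"] by simp
    then show ?thesis using p ab sw(1)[OF p] unfolding g
      by (simp add: basic) (simp add: Hv_def prod_eq_iff vec_eq_iff algebra_simps)
  next
    case 5
    define p q r where pqr: "p = form \<alpha> \<beta>" "q = form \<beta> \<gamma>" "r = form \<alpha> \<gamma>"
    have "form (\<alpha> + \<beta> + \<gamma>) (\<alpha> + \<beta> + \<gamma>) > 0" using 5(4) form_definite[of "\<alpha> + \<beta> + \<gamma>"] by linarith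
    \<comment> \<open>The norm of \<alpha> + \<beta> + \<gamma> is 6 + 2 (p + q + r), which is
      positive here.\<close>
    then have "p + q + r \<ge> -2" using assms by (simp add: form_add pqr sym)
    moreover have "p \<in> {-1,0,1,2}" "q \<in> {-1,0,1,2}" "r \<in> {-1,0,1,2}"
      using c 5 unfolding pqr by auto
    \<comment> \<open>In the first three cases \<alpha> + \<beta> + \<gamma> is a root and exactly
      two of the three double brackets survive; in the fourth all three vanish.\<close>
    ultimately consider "p = -1" "q = -1" "r = 0" | "p = -1" "q = 0" "r = -1" | "p = 0" "q = -1" "r = -1"
      | "q = -1 \<Longrightarrow> p + r \<notin> {-1,-2}" "p = -1 \<Longrightarrow> q + r \<notin> {-1,-2}" "r = -1 \<Longrightarrow> p + q \<notin> {-1,-2}"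
        "p \<noteq> -2" "q \<noteq> -2" "r \<noteq> -2"
      by auto
    then show ?thesis
    proof cases
      case 1
      then show ?thesis using c by (simp add: basic pqr add_ac)
    next
      case 2
      then show ?thesis using c sw(1)[of \<alpha> \<beta>] by (simp add: basic pqr add_ac)
    next
      case 3
      then show ?thesis using c sw(2)[of \<alpha> \<beta>] by (simp add: basic pqr add_ac)
    next
      case r: 4
      show ?thesis using r c(3,6,9) by (cases "p = -1"; cases "q = -1"; cases "r = -1") (simp_all add: basic pqr)
    qed
  qed
qed

text \<open>Stated as the derivation property of the bracket with a root vector, which is the form
  needed for \<open>xi s\<close>: differentiation by the s-th variable will play the role of this
  derivation on operators.\<close>

lemma jacobi:
  assumes "\<alpha> \<in> Phi_E6" "x \<in> e6" "y \<in> e6"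
  shows "e6_bracket (Ev \<alpha> a) (e6_bracket x y) =
    e6_bracket (e6_bracket (Ev \<alpha> a) x) y + e6_bracket x (e6_bracket (Ev \<alpha> a) y)"
  using assms(2,3)
proof (induction x rule: e6_induct)
  case (H h)
  then show ?case
  proof (induction y rule: e6_induct)
    case (H h')
    show ?case by (simp add: mult_ac Ev_minus)
  next
    case (E \<beta> c)
    consider "\<beta> = - \<alpha>" | "form \<alpha> \<beta> = -1" "\<alpha> + \<beta> \<in> Phi_E6" | "form \<alpha> \<beta> \<noteq> -1" "form \<alpha> \<beta> \<noteq> -2"
      using form_roots_cases[OF assms(1) E(1)] by blast
    then show ?case
    proof cases
      case 1
      then show ?thesis
        using assms(1) by (simp add: bracket_EE form_minus to_H_minus mult_ac flip: Ev_minus Hv_minus)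
    next
      case 2
      then show ?thesis
        using assms(1) E(1) by (simp add: bracket_EE to_H_add form_add Ev_add distrib_left distrib_right mult_ac flip: Ev_minus Hv_minus)
    next
      case 3
      then show ?thesis using assms(1) E(1) by (simp add: bracket_EE)
    qed
  qed (simp_all add: e6_bracket_add)
next
  case (E \<beta> b)
  from E(2,1) show ?case
  proof (induction y rule: e6_induct)
    case (H h)
    consider "\<beta> = - \<alpha>" | "form \<alpha> \<beta> = -1" "\<alpha> + \<beta> \<in> Phi_E6" | "form \<alpha> \<beta> \<noteq> -1" "form \<alpha> \<beta> \<noteq> -2"
      using form_roots_cases[OF assms(1) H(1)] by blast
    moreover have "form \<beta> \<alpha> = form \<alpha> \<beta>" by (rule form_sym)
    moreover have "form \<alpha> \<beta> = -1 \<Longrightarrow> cocycle \<beta> \<alpha> = - cocycle \<alpha> \<beta>"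
      by (subst cocycle_swap) simp
    ultimately show ?case
      by cases (simp_all add: bracket_EE assms(1) H form_minus to_H_minus to_H_add form_add Ev_add Ev_0 Hv_0 algebra_simps
        Hv_add flip: Ev_minus Hv_minus)
  next
    case (E \<gamma> c)
    then show ?case using jacobi_EEE[OF assms(1)] by simp
  qed (simp_all add: e6_bracket_add)
qed (simp_all add: e6_bracket_add)

section \<open>The quadrics \<open>\<zeta>\<^sub>k\<close> and the structure constants\<close>

text \<open>
  \<open>gam k\<close> is the common value of \<open>\<beta>\<^sub>a + \<beta>\<^sub>b\<close> over the monomials \<open>x\<^sub>a x\<^sub>b\<close> of \<open>\<zeta>\<^sub>k\<close>, and \<open>eps k\<close> is the
  sign by which their coefficients differ from \<open>F(\<beta>\<^sub>a, \<beta>\<^sub>b)\<close>.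
\<close>

definition gam :: "10 \<Rightarrow> int ^ 6"
  where "gam = (\<lambda>_. 0)(1 := beta 1 + beta 11, 2 := beta 1 + beta 13, 3 := beta 1 + beta 14,
    4 := beta 1 + beta 15, 5 := beta 2 + beta 15, 6 := beta 7 + beta 16, 7 := beta 4 + beta 16,
    8 := beta 3 + beta 16, 9 := beta 2 + beta 16, 10 := beta 1 + beta 16)"

definition eps :: "10 \<Rightarrow> complex"
  where "eps k = (if k = 9 then 1 else -1)"

text \<open>This will turn out to be the Hessian of \<open>zeta k\<close>, written through root data
  so that products of its entries can be compared with brackets.\<close>

definition hess :: "10 \<Rightarrow> 16 \<Rightarrow> 16 \<Rightarrow> complex"
  where "hess k a b = (if beta a + beta b = gam k then eps k * cocycle (beta a) (beta b) else 0)"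

lemma gam_vec6:
  "gam 1 = vec6 0 1 1 2 2 2" "gam 2 = vec6 1 1 1 2 2 2" "gam 3 = vec6 1 1 2 2 2 2"
  "gam 4 = vec6 1 1 2 3 2 2" "gam 5 = vec6 1 1 2 3 3 2" "gam 6 = vec6 2 2 3 4 3 2"
  "gam 7 = vec6 1 2 3 4 3 2" "gam 8 = vec6 1 2 2 4 3 2" "gam 9 = vec6 1 2 2 3 3 2"
  "gam 10 = vec6 1 2 2 3 2 2"
  by (simp_all add: gam_def beta_vec6 vec6_add)

lemma inj_gam: "gam k = gam l \<longleftrightarrow> k = l"
proof -
  have "\<forall>k l. gam k = gam l \<longleftrightarrow> k = l"
    unfolding forall_10 by (simp add: gam_vec6 vec6_eq)
  then show ?thesis by blast
qed

lemma form_gam: "form (gam k) (gam k) = 4"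
proof -
  have "\<forall>k. form (gam k) (gam k) = 4"
    unfolding forall_10 form_explicit by (simp add: gam_vec6)
  then show ?thesis by blast
qed

text \<open>The norm of \<open>beta a + beta b\<close> is 4 plus twice the inner product, so only
  orthogonal pairs reach a vector of norm 4. That all of them do is checked on the 256 pairs. The
  ten sums project to the weights of the vector representation of \<open>D5\<close>.\<close>

lemma beta_orthogonal_iff: "form (beta a) (beta b) = 0 \<longleftrightarrow> (\<exists>k. beta a + beta b = gam k)"
proof
  assume "\<exists>k. beta a + beta b = gam k"
  then obtain k where "beta a + beta b = gam k" by blast
  then have "form (beta a + beta b) (beta a + beta b) = 4" using form_gam by simp
  then show "form (beta a) (beta b) = 0"
    by (simp add: form_add form_beta form_sym[of "beta b" "beta a"])
next
  have "\<forall>a b. form (beta a) (beta b) = 0 \<longrightarrow> (\<exists>k\<in>UNIV. beta a + beta b = gam k)"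
    unfolding forall_16 form_explicit UNIV_10
    by (simp add: beta_vec6 gam_vec6 vec6_add vec6_eq)
  then show "form (beta a) (beta b) = 0 \<Longrightarrow> \<exists>k. beta a + beta b = gam k" by blast
qed

lemma cocycle_vec6: "cocycle (vec6 a b c d e f) (vec6 a' b' c' d' e' f') =
   (-1) powi (a*a' + b*b' + c*c' + d*d' + e*e' + f*f' + a*c' + d*b' + c*d' + e*d' + f*e')"
  unfolding cocycle_def UNIV_6 by (simp add: algebra_simps)

section \<open>Derivatives of the quadrics\<close>

lemma pconst_simps [simp]: "pconst 0 = 0" "pconst 1 = 1" "pconst (- c) = - pconst c"
  and pconst_add: "pconst (c + d) = pconst c + pconst d"
  and pconst_mult: "pconst (c * d) = pconst c * pconst d"
  and pconst_diff: "pconst (c - d) = pconst c - pconst d"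
  by (simp_all add: pconst_def single_uminus single_add single_diff mult_single)

lemma pconst_sum: "pconst (sum f A) = (\<Sum>x\<in>A. pconst (f x))"
  by (induction A rule: infinite_finite_induct) (simp_all add: pconst_add)

text \<open>The double sum meets each monomial of \<open>zeta k\<close> once for either order of its
  two factors; hence the doubling on the left.\<close>

lemma zeta_hess: "zeta k + zeta k = (\<Sum>a\<in>UNIV. \<Sum>b\<in>UNIV. pconst (hess k a b) * pvar a * pvar b)"
proof -
  have "\<forall>k. zeta k + zeta k = (\<Sum>a\<in>UNIV. \<Sum>b\<in>UNIV. pconst (hess k a b) * pvar a * pvar b)"
    unfolding forall_10 UNIV_16 hess_def
    apply (simp add: beta_vec6 gam_vec6 vec6_add vec6_eq cocycle_vec6 powi_minus_one eps_def)
    apply (simp add: zeta_def Let_def algebra_simps)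
    done
  then show ?thesis by blast
qed

lemma pdiff_add: "pdiff i (f + g) = pdiff i f + pdiff i g"
  unfolding pdiff_def
  by (rule setsum_keys_plus_distrib) (simp_all add: algebra_simps single_add)

lemma pdiff_zero [simp]: "pdiff i 0 = 0"
  by (simp add: pdiff_def)

lemma pdiff_sum: "pdiff i (sum f A) = (\<Sum>x\<in>A. pdiff i (f x))"
  by (induction A rule: infinite_finite_induct) (simp_all add: pdiff_add)

lemma pdiff_single: "pdiff i (Poly_Mapping.single m c) =
    Poly_Mapping.single (m - Poly_Mapping.single i 1) (of_nat (Poly_Mapping.lookup m i) * c)"
  by (simp add: pdiff_def)

lemma pdiff_monomial2: "pdiff i (pconst c * pvar a * pvar b) =
   (if a = i then pconst c * pvar b else 0) + (if b = i then pconst c * pvar a else 0)"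
proof -
  let ?s = "\<lambda>a. Poly_Mapping.single a (1 :: nat)"
  have "pconst c * pvar a * pvar b = Poly_Mapping.single (?s a + ?s b) c"
    by (simp add: pconst_def pvar_def mult_single)
  moreover have "pconst c * pvar a = Poly_Mapping.single (?s a) c" for a
    by (simp add: pconst_def pvar_def mult_single)
  ultimately show ?thesis
    by (auto simp: pdiff_single lookup_add lookup_single when_def simp flip: single_add)
qed

lemma pdiff_monomial1: "pdiff i (pconst c * pvar a) = (if a = i then pconst c else 0)"
proof -
  have "pconst c * pvar a = Poly_Mapping.single (Poly_Mapping.single a 1) c"
    by (simp add: pconst_def pvar_def mult_single)
  then show ?thesis by (simp add: pdiff_single lookup_single when_def pconst_def)
qed

text \<open>Nonzero entries belong to orthogonal pairs, on which the cocycle is symmetric.\<close>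

lemma hess_sym: "hess k a b = hess k b a"
proof -
  have "cocycle (beta a) (beta b) = cocycle (beta b) (beta a)" if "beta a + beta b = gam k"
  proof -
    have "form (beta b) (beta a) = 0" using that beta_orthogonal_iff[of b a] by (metis add.commute)
    then show ?thesis using cocycle_swap[of "beta a" "beta b"] by simp
  qed
  then show ?thesis by (auto simp: hess_def add.commute)
qed

lemma if_sum_zero: "(\<Sum>b\<in>A. if P then f b else 0) = (if P then \<Sum>b\<in>A. f b else 0)"
  by simp

lemma pdiff2_zeta: "pdiff i (pdiff j (zeta k)) = pconst (hess k i j)"
proof -
  have "pdiff j (zeta k) + pdiff j (zeta k) = (\<Sum>a\<in>UNIV. \<Sum>b\<in>UNIV. pdiff j (pconst (hess k a b) * pvar a * pvar b))"
    by (simp only: pdiff_add[symmetric] zeta_hess pdiff_sum)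
  also have "\<dots> = (\<Sum>b\<in>UNIV. pconst (hess k j b) * pvar b) + (\<Sum>a\<in>UNIV. pconst (hess k a j) * pvar a)"
    by (simp add: pdiff_monomial2 sum.distrib if_sum_zero)
  also have "\<dots> = (\<Sum>a\<in>UNIV. pconst (2 * hess k a j) * pvar a)"
    by (simp only: hess_sym[of k j] mult_2 pconst_add distrib_right sum.distrib)
  finally have "pdiff i (pdiff j (zeta k)) + pdiff i (pdiff j (zeta k)) = pconst (2 * hess k i j)"
    by (simp only: pdiff_add[symmetric] pdiff_sum pdiff_monomial1) simp
  \<comment> \<open>The constant polynomial 1/2 undoes the doubling of
    \<open>zeta k\<close>.\<close>
  then have "pconst (1/2) * (pdiff i (pdiff j (zeta k)) + pdiff i (pdiff j (zeta k))) = pconst (1/2) * pconst (2 * hess k i j)"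
    by simp
  then have "pconst (1/2 + 1/2) * pdiff i (pdiff j (zeta k)) = pconst (1/2 * (2 * hess k i j))"
    by (simp only: pconst_add pconst_mult distrib_left distrib_right)
  then show ?thesis by simp
qed

section \<open>Structure constants of the double brackets\<close>

lemma root_beta [simp]: "beta i \<in> Phi_E6"
  using form_beta by (simp only: Phi_E6_def mem_Collect_eq)

text \<open>Inner product -1 would make \<open>beta i + beta j\<close> a root with last coordinate
  2, and -2 would make the two roots opposite although both have last coordinate 1.\<close>

lemma form_beta_cases: "form (beta i) (beta j) \<in> {0, 1, 2}"
  "form (beta i) (beta j) = 2 \<longleftrightarrow> i = j"
proof -
  have "form (beta i) (beta j) \<noteq> -2" "form (beta i) (beta j) \<noteq> -1"
    using form_roots_cases(2,3)[of "beta i" "beta j"] beta_6[of i] beta_6[of j] root_6[of "beta i + beta j"] by auto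
  then show "form (beta i) (beta j) \<in> {0, 1, 2}" using form_roots_cases(1)[of "beta i" "beta j"] by auto
  have "form (beta i) (beta j) = 2 \<longleftrightarrow> beta j = beta i"
    using form_roots_cases(2)[of "- beta i" "beta j"] by (simp add: form_minus)
  then show "form (beta i) (beta j) = 2 \<longleftrightarrow> i = j" by (auto simp: inj_beta)
qed

lemma xi_Ev: "xi i = Ev (beta i) 1" and eta_Ev: "eta i = Ev (- beta i) 1"
  by (simp_all add: xi_def eta_def Evec_Ev)

lemma lookup_Ev: "Poly_Mapping.lookup (snd (Ev \<alpha> c)) \<gamma> = (if \<alpha> = \<gamma> then c else 0)"
  by (simp add: Ev_def lookup_single when_def)

lemma lookup_Hv [simp]: "Poly_Mapping.lookup (snd (Hv h)) \<gamma> = 0"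
  by (simp add: Hv_def)

text \<open>At most one quadric contains the monomial \<open>x_i x_l\<close>, and its sign
  \<open>eps\<close> occurs squared; so the result can be stated without \<open>k\<close>.\<close>

lemma sum_hess: "(\<Sum>k\<in>UNIV. hess k j m * hess k i l) =
  (if form (beta i) (beta l) = 0 \<and> beta i + beta l = beta j + beta m
   then cocycle (beta j) (beta m) * cocycle (beta i) (beta l) else 0)"
proof (cases "form (beta i) (beta l) = 0")
  case True
  then obtain k0 where k0: "beta i + beta l = gam k0" using beta_orthogonal_iff by blast
  have *: "hess k j m * hess k i l = (if k = k0 then hess k0 j m * hess k0 i l else 0)" for k
    unfolding hess_def k0 inj_gam by (cases "k = k0") simp_all
  have "(\<Sum>k\<in>UNIV. hess k j m * hess k i l) = (\<Sum>k\<in>UNIV. if k = k0 then hess k0 j m * hess k0 i l else 0)"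
    by (rule sum.cong[OF refl *])
  then have "(\<Sum>k\<in>UNIV. hess k j m * hess k i l) = hess k0 j m * hess k0 i l"
    by simp
  moreover have "eps k0 * eps k0 = 1" by (simp add: eps_def)
  ultimately show ?thesis using True unfolding hess_def k0 by (simp add: eq_commute[of "gam k0"] mult_ac)
next
  case False
  then have "hess k i l = 0" for k using beta_orthogonal_iff by (auto simp: hess_def)
  then show ?thesis using False by simp
qed

lemma bracket_xi_eta: "e6_bracket (xi j) (eta i) =
  (if i = j then Hv (- to_H (beta j)) else if form (beta j) (beta i) = 1
   then Ev (beta j - beta i) (cocycle (beta j) (beta i)) else 0)"
  unfolding xi_Ev eta_Ev using form_beta_cases[of j i]
  by (auto simp: bracket_EE form_minus to_H_minus)

text \<open>The left side is the coefficient of \<open>eta m\<close> in [[xi j, eta i], eta l]. When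
  it is summed against \<open>x_j x_m\<close> times the l-th derivative, each of the two deltas
  produces \<open>x_i\<close> times the Euler operator, and the Hessian terms produce the
  quadrics.\<close>

lemma structure_constants:
  "phi l m (e6_bracket (xi j) (eta i)) = (if i = j \<and> l = m then 1 else 0) + (if j = l \<and> i = m then 1 else 0)
     - (\<Sum>k\<in>UNIV. hess k j m * hess k i l)"
proof -
  note c = form_beta_cases[of i l] form_beta_cases[of j i] form_beta_cases[of j l]
  have sym: "form (beta b) (beta a) = form (beta a) (beta b)" for a b by (rule form_sym)
  show ?thesis
  proof (cases "i = j")
    case True
    \<comment> \<open>The inner middle bracket is a Cartan element, which yields the inner product
      of \<open>beta j\<close> and \<open>beta l\<close>. Its values 0, 1, 2 are matched on the
      right by 1 - 1, 1 and 1 + 1.\<close>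
    then have "phi l m (e6_bracket (xi j) (eta i)) = (if l = m then of_int (form (beta j) (beta l)) else 0)"
      unfolding phi_def bracket_xi_eta
      by (simp add: eta_Ev lookup_Ev inj_beta to_H_minus form_minus form_to_H)
    then show ?thesis unfolding sum_hess using True c(1,2) by (auto simp: inj_beta)
  next
    case False
    have lhs: "phi l m (e6_bracket (xi j) (eta i)) = (if form (beta j) (beta i) = 1 \<and> form (beta j) (beta l) - form (beta i) (beta l) = 1
       \<and> beta j + beta m = beta i + beta l then cocycle (beta j) (beta i) * cocycle (beta j) (beta l) * cocycle (beta i) (beta l) else 0)"
    proof (cases "form (beta j) (beta i) = 1")
      case True
      then have r: "beta j - beta i \<in> Phi_E6" using form_roots_cases(3)[of "beta j" "- beta i"] by (simp add: form_minus)
      \<comment> \<open>The difference has degree 0 and \<open>beta l\<close> has degree 1, so they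
        cannot coincide and the bracket with \<open>eta l\<close> has no Cartan component.\<close>
      have "(beta j - beta i) $ 6 \<noteq> beta l $ 6" by (simp add: beta_6)
      then have n: "beta j - beta i \<noteq> beta l" by metis
      have "- beta l \<in> Phi_E6" by simp
      with n have n2: "form (beta j - beta i) (- beta l) \<noteq> -2"
        unfolding form_roots_cases(2)[OF r \<open>- beta l \<in> Phi_E6\<close>] neg_equal_iff_equal by metis
      have "phi l m (e6_bracket (xi j) (eta i)) =
        (if form (beta j - beta i) (- beta l) = -1 \<and> beta j - beta i - beta l = - beta m then cocycle (beta j) (beta i) * cocycle (beta j - beta i) (beta l) else 0)"
        using True False n2 unfolding phi_def bracket_xi_eta
        by (simp add: eta_Ev bracket_EE r lookup_Ev mult_ac)
      moreover have "beta j - beta i - beta l = - beta m \<longleftrightarrow> beta j + beta m = beta i + beta l"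
        unfolding eq_neg_iff_add_eq_0 right_minus_eq[of "beta j + beta m" "beta i + beta l", symmetric]
        by (simp add: algebra_simps)
      ultimately show ?thesis using True by (auto simp: form_diff form_minus cocycle_diff)
    qed (use False in \<open>simp add: phi_def bracket_xi_eta\<close>)
    show ?thesis
    proof (cases "j = l")
      case True
      \<comment> \<open>For inner product 1 the left side is 1 at \<open>m = i\<close>, since the
        cocycle is antisymmetric on this pair and is -1 on a root with itself. For inner product 0
        the left side vanishes, and on the right the squared sign cancels the delta.\<close>
      have "form (beta i) (beta j) = 1 \<Longrightarrow> cocycle (beta i) (beta j) = - cocycle (beta j) (beta i)"
        using cocycle_swap[of "beta i" "beta j"] by (simp add: sym[of j i])
      moreover have "form (beta i) (beta j) = 0 \<Longrightarrow> cocycle (beta i) (beta j) = cocycle (beta j) (beta i)"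
        using cocycle_swap[of "beta i" "beta j"] by (simp add: sym[of j i])
      moreover have "beta i + beta j = beta j + beta m \<longleftrightarrow> i = m" "beta j + beta m = beta i + beta j \<longleftrightarrow> i = m"
        by (auto simp: add.commute[of "beta i"] inj_beta)
      ultimately show ?thesis unfolding lhs sum_hess using True False c sym[of j i]
        by (auto simp: form_beta)
    next
      case jl: False
      have "form (beta j) (beta i) = 1 \<and> form (beta j) (beta l) = 1 \<and> cocycle (beta j) (beta m) = - cocycle (beta j) (beta i) * cocycle (beta j) (beta l)"
        if e: "beta i + beta l = beta j + beta m"
      proof -
        have m: "beta m = beta i + beta l - beta j" using e by (simp add: algebra_simps)
        \<comment> \<open>Both inner products on the right are at most 1, because \<open>j\<close>
          differs from \<open>i\<close> and \<open>l\<close>. Nonnegativity of the left side forces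
          both to be 1.\<close>
        have "form (beta j) (beta m) = form (beta j) (beta i) + form (beta j) (beta l) - 2"
          unfolding m by (simp add: form_add form_diff form_beta)
        then have "form (beta j) (beta i) = 1 \<and> form (beta j) (beta l) = 1"
          using c form_beta_cases[of j m] False jl by auto
        moreover have "cocycle (beta j) (beta m) = - cocycle (beta j) (beta i) * cocycle (beta j) (beta l)"
          unfolding m by (simp add: cocycle_add cocycle_diff)
        ultimately show ?thesis by blast
      qed
      then show ?thesis unfolding lhs sum_hess using jl False c by auto
    qed
  qed
qed

lemma if_pconst: "pconst (if P then a else b) = (if P then pconst a else pconst b)" by simp
lemma pconst_structure_constants: "pconst (phi l m (e6_bracket (xi s) (eta i))) = (if i = s \<and> l = m then 1 else 0)
      + (if s = l \<and> i = m then 1 else 0) - (\<Sum>k\<in>UNIV. pconst (hess k s m * hess k i l))"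
  apply (simp only: structure_constants pconst_diff pconst_add pconst_sum)
  apply (simp only: if_pconst pconst_simps)
  done
lemma P_op_coefficient: "pvar s * (pconst (phi l m (e6_bracket (xi s) (eta i))) * pvar m * d) =
      (if i = s \<and> l = m then pvar s * pvar m * d else 0)
      + (if s = l \<and> i = m then pvar s * pvar m * d else 0) - (\<Sum>k\<in>UNIV. pconst (hess k s m * hess k i l) * pvar s * pvar m * d)"
  unfolding pconst_structure_constants
  apply (simp only: left_diff_distrib right_diff_distrib distrib_left distrib_right sum_distrib_left sum_distrib_right)
  apply (intro arg_cong2[where f=minus] arg_cong2[where f=plus] sum.cong refl)
  apply (simp_all add: mult_ac)
  done
lemma sum_g0_diffop: "(\<Sum>s\<in>UNIV. pvar s * g0_diffop (e6_bracket (xi s) (eta i)) f) =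
    (\<Sum>s\<in>UNIV. \<Sum>l\<in>UNIV. \<Sum>m\<in>UNIV. (if i = s \<and> l = m then pvar s * pvar m * pdiff l f else 0)
      + (if s = l \<and> i = m then pvar s * pvar m * pdiff l f else 0) - (\<Sum>k\<in>UNIV. pconst (hess k s m * hess k i l) * pvar s * pvar m * pdiff l f))"
  unfolding P_op_coefficient[symmetric] g0_diffop_def
  apply (simp only: sum_distrib_left)
  done

text \<open>The factor 1/2 compensates two doublings at once: the two deltas of
  \<open>structure_constants\<close> give the Euler term twice, and \<open>zeta_hess\<close> gives
  every quadric twice.\<close>

lemma P_op_g0: "P_op i f = (\<Sum>s\<in>UNIV. pconst (1/2) * pvar s * g0_diffop (e6_bracket (xi s) (eta i)) f)"
proof -
  have half: "a = pconst (1/2) * (a + a)" for a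
  proof -
    have "pconst (1/2) * (a + a) = pconst (1/2 + 1/2) * a" by (simp only: pconst_add algebra_simps)
    then show ?thesis by simp
  qed
  let ?d = "\<lambda>l. pdiff l f"
  have "(\<Sum>s\<in>UNIV. pvar s * g0_diffop (e6_bracket (xi s) (eta i)) f) =
    (\<Sum>s\<in>UNIV. \<Sum>l\<in>UNIV. \<Sum>m\<in>UNIV. (if i = s \<and> l = m then pvar s * pvar m * ?d l else 0)
      + (if s = l \<and> i = m then pvar s * pvar m * ?d l else 0)
      - (\<Sum>k\<in>UNIV. pconst (hess k s m * hess k i l) * pvar s * pvar m * ?d l))"
    by (rule sum_g0_diffop)
  also have "\<dots> = (\<Sum>l\<in>UNIV. pvar i * pvar l * ?d l) + (\<Sum>l\<in>UNIV. pvar l * pvar i * ?d l)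
     - (\<Sum>s\<in>UNIV. \<Sum>l\<in>UNIV. \<Sum>m\<in>UNIV. \<Sum>k\<in>UNIV. pconst (hess k s m * hess k i l) * pvar s * pvar m * ?d l)"
  proof -
    have "(\<Sum>s\<in>UNIV. \<Sum>l\<in>UNIV. \<Sum>m\<in>UNIV. (if i = s \<and> l = m then pvar s * pvar m * ?d l else 0)) = (\<Sum>l\<in>UNIV. pvar i * pvar l * ?d l)"
    proof -
      have "(\<Sum>l\<in>UNIV. \<Sum>m\<in>UNIV. (if i = s \<and> l = m then pvar s * pvar m * ?d l else 0)) =
       (if s = i then (\<Sum>l\<in>UNIV. pvar s * pvar l * ?d l) else 0)" for s
        by auto
      then show ?thesis by simp
    qed
    moreover have "(\<Sum>s\<in>UNIV. \<Sum>l\<in>UNIV. \<Sum>m\<in>UNIV. (if s = l \<and> i = m then pvar s * pvar m * ?d l else 0)) = (\<Sum>l\<in>UNIV. pvar l * pvar i * ?d l)"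
    proof -
      have "(\<Sum>m\<in>UNIV. (if s = l \<and> i = m then pvar s * pvar m * ?d l else 0)) = (if l = s then pvar s * pvar i * ?d s else 0)" for s l
        by auto
      then show ?thesis by simp
    qed
    ultimately show ?thesis by (simp add: sum.distrib sum_subtractf)
  qed
  \<comment> \<open>With \<open>k\<close> outermost, the sum over \<open>s\<close> and
    \<open>m\<close> is twice the quadric and the sum over \<open>l\<close> is its factor in
    \<open>P_op\<close>.\<close>
  also have "(\<Sum>s\<in>UNIV. \<Sum>l\<in>UNIV. \<Sum>m\<in>UNIV. \<Sum>k\<in>UNIV. pconst (hess k s m * hess k i l) * pvar s * pvar m * ?d l)
     = (\<Sum>k\<in>UNIV. (zeta k + zeta k) * (\<Sum>l\<in>UNIV. pconst (hess k i l) * ?d l))"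
  proof -
    have "(\<Sum>s\<in>UNIV. \<Sum>l\<in>UNIV. \<Sum>m\<in>UNIV. \<Sum>k\<in>UNIV. pconst (hess k s m * hess k i l) * pvar s * pvar m * ?d l)
      = (\<Sum>s\<in>UNIV. \<Sum>l\<in>UNIV. \<Sum>k\<in>UNIV. \<Sum>m\<in>UNIV. pconst (hess k s m * hess k i l) * pvar s * pvar m * ?d l)"
      by (intro sum.cong refl sum.swap)
    also have "\<dots> = (\<Sum>s\<in>UNIV. \<Sum>k\<in>UNIV. \<Sum>l\<in>UNIV. \<Sum>m\<in>UNIV. pconst (hess k s m * hess k i l) * pvar s * pvar m * ?d l)"
      by (intro sum.cong refl sum.swap)
    also have "\<dots> = (\<Sum>k\<in>UNIV. \<Sum>s\<in>UNIV. \<Sum>l\<in>UNIV. \<Sum>m\<in>UNIV. pconst (hess k s m * hess k i l) * pvar s * pvar m * ?d l)"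
      by (rule sum.swap)
    also have "\<dots> = (\<Sum>k\<in>UNIV. (zeta k + zeta k) * (\<Sum>l\<in>UNIV. pconst (hess k i l) * ?d l))"
    proof (rule sum.cong[OF refl])
      fix k
      have "(\<Sum>s\<in>UNIV. \<Sum>l\<in>UNIV. \<Sum>m\<in>UNIV. pconst (hess k s m * hess k i l) * pvar s * pvar m * ?d l)
       = (\<Sum>s\<in>UNIV. \<Sum>m\<in>UNIV. \<Sum>l\<in>UNIV. pconst (hess k s m * hess k i l) * pvar s * pvar m * ?d l)"
        by (intro sum.cong refl sum.swap)
      also have "\<dots> = (zeta k + zeta k) * (\<Sum>l\<in>UNIV. pconst (hess k i l) * ?d l)"
        by (simp only: zeta_hess sum_distrib_right) (simp only: sum_distrib_left pconst_mult mult_ac)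
      finally show "(\<Sum>s\<in>UNIV. \<Sum>l\<in>UNIV. \<Sum>m\<in>UNIV. pconst (hess k s m * hess k i l) * pvar s * pvar m * ?d l)
        = (zeta k + zeta k) * (\<Sum>l\<in>UNIV. pconst (hess k i l) * ?d l)" .
    qed
    finally show ?thesis .
  qed
  also have "(\<Sum>l\<in>UNIV. pvar i * pvar l * ?d l) + (\<Sum>l\<in>UNIV. pvar l * pvar i * ?d l)
     - (\<Sum>k\<in>UNIV. (zeta k + zeta k) * (\<Sum>l\<in>UNIV. pconst (hess k i l) * ?d l)) = P_op i f + P_op i f"
  proof -
    have "(\<Sum>k\<in>UNIV. (zeta k + zeta k) * (\<Sum>l\<in>UNIV. pconst (hess k i l) * ?d l)) =
      (\<Sum>k\<in>UNIV. zeta k * (\<Sum>l\<in>UNIV. pconst (hess k i l) * ?d l)) + (\<Sum>k\<in>UNIV. zeta k * (\<Sum>l\<in>UNIV. pconst (hess k i l) * ?d l))"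
      by (simp only: distrib_right sum.distrib)
    moreover have "(\<Sum>l\<in>UNIV. pvar i * pvar l * ?d l) = pvar i * euler_op f" "(\<Sum>l\<in>UNIV. pvar l * pvar i * ?d l) = pvar i * euler_op f"
      unfolding euler_op_def sum_distrib_left by (simp_all only: mult_ac)
    ultimately show ?thesis unfolding P_op_def pdiff2_zeta by (simp only: diff_add_eq add_diff_eq diff_diff_eq2 diff_diff_eq ac_simps)
  qed
  finally have e: "P_op i f + P_op i f = (\<Sum>s\<in>UNIV. pvar s * g0_diffop (e6_bracket (xi s) (eta i)) f)"
    by (rule sym)
  have "P_op i f = pconst (1/2) * (P_op i f + P_op i f)" by (rule half)
  also have "\<dots> = (\<Sum>s\<in>UNIV. pconst (1/2) * pvar s * g0_diffop (e6_bracket (xi s) (eta i)) f)"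
    by (simp only: e sum_distrib_left mult.assoc)
  finally show ?thesis .
qed

section \<open>The grading by the last coordinate\<close>

definition gr :: "int \<Rightarrow> e6_vec set"
  where "gr k = {x \<in> e6. (\<forall>\<alpha>. \<alpha> $ 6 \<noteq> k \<longrightarrow> Poly_Mapping.lookup (snd x) \<alpha> = 0) \<and> (k \<noteq> 0 \<longrightarrow> fst x = 0)}"

lemma gr_subspace: "e6v.subspace (gr k)"
  using e6_subspace by (auto simp: e6v.subspace_def gr_def lookup_add)

lemma gr_e6: "x \<in> gr k \<Longrightarrow> x \<in> e6"
  by (simp add: gr_def)

lemma Ev_gr: "\<alpha> \<in> Phi_E6 \<Longrightarrow> \<alpha> $ 6 = k \<Longrightarrow> Ev \<alpha> c \<in> gr k"
  using Ev_e6 by (auto simp: gr_def lookup_Ev) (simp add: Ev_def)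

lemma Hv_gr: "Hv h \<in> gr 0"
  using Hv_e6 by (simp add: gr_def)

lemma xi_gr: "xi i \<in> gr 1" and eta_gr: "eta i \<in> gr (-1)"
  unfolding xi_Ev eta_Ev by (simp_all add: Ev_gr beta_6)

text \<open>The disjunction in clause \<open>H\<close> covers Cartan elements in degree 0 and the
  zero vector in every degree, the latter being the start of the induction.\<close>

lemma gr_induct [consumes 1, case_names H E add]:
  assumes "x \<in> gr k" and H: "\<And>h. k = 0 \<or> h = 0 \<Longrightarrow> P (Hv h)"
    and E: "\<And>\<alpha> c. \<alpha> \<in> Phi_E6 \<Longrightarrow> \<alpha> $ 6 = k \<Longrightarrow> P (Ev \<alpha> c)"
    and add: "\<And>x y. P x \<Longrightarrow> P y \<Longrightarrow> P (x + y)"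
  shows "P x"
proof -
  have "P (\<Sum>\<alpha>\<in>S. Ev \<alpha> (f \<alpha>))" if "finite S" "S \<subseteq> {\<alpha> \<in> Phi_E6. \<alpha> $ 6 = k}" for S f
    using that
  proof (induction S)
    case empty
    show ?case using H[of 0] by (simp add: Hv_0)
  next
    case (insert \<alpha> S)
    then show ?case using add[OF E] by simp
  qed
  moreover have "Poly_Mapping.keys (snd x) \<subseteq> {\<alpha> \<in> Phi_E6. \<alpha> $ 6 = k}"
    using assms(1) by (auto simp: gr_def mem_e6 in_keys_iff)
  moreover have "k = 0 \<or> fst x = 0" using assms(1) by (auto simp: gr_def)
  ultimately have "P (Hv (fst x) + (\<Sum>\<alpha>\<in>Poly_Mapping.keys (snd x). Ev \<alpha> (Poly_Mapping.lookup (snd x) \<alpha>)))"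
    using add[OF H] by simp
  then show ?thesis using e6_decomp[of x] by simp
qed

lemma bracket_gr: "x \<in> gr k \<Longrightarrow> y \<in> gr l \<Longrightarrow> e6_bracket x y \<in> gr (k + l)"
proof (induction x rule: gr_induct)
  case (H h)
  from H(2,1) show ?case
  proof (induction y rule: gr_induct)
    case (E \<beta> d)
    then show ?case by (auto simp: Ev_gr Hv_0 Ev_0 e6v.subspace_0[OF gr_subspace])
  qed (auto simp: e6_bracket_add e6v.subspace_0[OF gr_subspace] e6v.subspace_add[OF gr_subspace])
next
  case (E \<alpha> c)
  from E(3,1,2) show ?case
  proof (induction y rule: gr_induct)
    case (H h)
    then show ?case by (auto simp: Ev_gr Hv_0 Ev_0 e6v.subspace_0[OF gr_subspace])
  next
    case (E \<beta> d)
    show ?case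
    proof (cases "form \<alpha> \<beta> = -2")
      case True
      then have "\<beta> = - \<alpha>" using form_roots_cases E by blast
      then have "k + l = 0" using E by auto
      then show ?thesis using True E Hv_gr by (simp add: bracket_EE)
    next
      case False
      then show ?thesis using E form_roots_cases[of \<alpha> \<beta>]
        by (auto simp: bracket_EE e6v.subspace_0[OF gr_subspace] intro!: Ev_gr)
    qed
  qed (auto simp: e6_bracket_add e6v.subspace_0[OF gr_subspace] e6v.subspace_add[OF gr_subspace])
qed (auto simp: e6_bracket_add e6v.subspace_add[OF gr_subspace])

lemma gr_2: "x \<in> gr 2 \<Longrightarrow> x = 0"
proof (rule e6_vec_eqI)
  assume x: "x \<in> gr 2"
  show "fst x = fst 0" using x by (simp add: gr_def)
  fix \<alpha>
  have "\<alpha> $ 6 \<noteq> 2 \<or> \<alpha> \<notin> Phi_E6" using root_6[of \<alpha>] by auto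
  then show "Poly_Mapping.lookup (snd x) \<alpha> = Poly_Mapping.lookup (snd 0) \<alpha>"
    using x by (auto simp: gr_def mem_e6)
qed

lemma phi_add: "phi i j (x + y) = phi i j x + phi i j y"
  by (simp add: phi_def e6_bracket_add lookup_add)

lemma scale_plus: "e6_scale k (x + y) = e6_scale k x + e6_scale k y"
  by (rule e6v.scale_right_distrib)

lemma bracket_scale: "x \<in> e6 \<Longrightarrow> y \<in> e6 \<Longrightarrow> e6_bracket (e6_scale k x) y = e6_scale k (e6_bracket x y)"
proof (induction x rule: e6_induct)
  case (H h)
  then show ?case
    by (induction y rule: e6_induct) (simp_all add: e6_bracket_add scale_plus form_smult mult_ac)
next
  case (E \<alpha> c)
  from E(2,1) show ?case
    by (induction y rule: e6_induct) (auto simp: bracket_EE e6_bracket_add scale_plus mult_ac vec_eq_iff)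
qed (simp_all add: e6_bracket_add scale_plus)

lemma phi_scale: "x \<in> e6 \<Longrightarrow> phi i j (e6_scale k x) = k * phi i j x"
  using bracket_scale[OF _ gr_e6[OF eta_gr]] by (simp add: phi_def)

text \<open>Invariance of the Killing form in coordinates: on the span of the \<open>xi\<close> an
  element of degree 0 acts by minus the transpose of its matrix on the span of the
  \<open>eta\<close>.\<close>

lemma lookup_bracket_xi: "x \<in> e6 \<Longrightarrow> Poly_Mapping.lookup (snd (e6_bracket (xi s) x)) (beta i) = phi i s x"
proof (induction x rule: e6_induct)
  case (H h)
  then show ?case unfolding phi_def xi_Ev eta_Ev
    by (auto simp: lookup_Ev inj_beta to_H_minus form_minus)
next
  case (E \<alpha> c)
  have root: "- beta i \<in> Phi_E6" by simp
  have l: "Poly_Mapping.lookup (snd (e6_bracket (xi s) (Ev \<alpha> c))) (beta i) =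
     (if form (beta s) \<alpha> = -1 \<and> beta s + \<alpha> = beta i then cocycle (beta s) \<alpha> * c else 0)"
    unfolding xi_Ev using E by (simp add: bracket_EE lookup_Ev)
  have r: "phi i s (Ev \<alpha> c) =
     (if form \<alpha> (beta i) = 1 \<and> \<alpha> - beta i = - beta s then cocycle \<alpha> (beta i) * c else 0)"
    unfolding phi_def eta_Ev using E by (simp add: bracket_EE[OF _ root] lookup_Ev form_minus)
  show ?case
  proof (cases "\<alpha> = beta i - beta s")
    case True
    have "form (beta i) (beta s) = 1" using E form_roots_cases(3)[of "beta i" "- beta s"]
      unfolding True by (simp add: form_minus)
    then have "form (beta s) \<alpha> = -1" "form \<alpha> (beta i) = 1" unfolding True
      by (simp_all add: form_diff form_beta form_sym[of "beta s" "beta i"])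
    then show ?thesis unfolding l r by (simp add: True cocycle_diff)
  next
    case False
    then have "beta s + \<alpha> \<noteq> beta i" "\<alpha> - beta i \<noteq> - beta s"
      by (auto simp: algebra_simps)
    then show ?thesis unfolding l r by simp
  qed
qed (simp add: e6_bracket_add lookup_add phi_add)

lemma gr_1_expand: "x \<in> gr 1 \<Longrightarrow> x = (\<Sum>i\<in>UNIV. e6_scale (Poly_Mapping.lookup (snd x) (beta i)) (xi i))"
proof (rule e6_vec_eqI)
  assume x: "x \<in> gr 1"
  show "fst x = fst (\<Sum>i\<in>UNIV. e6_scale (Poly_Mapping.lookup (snd x) (beta i)) (xi i))"
    using x by (simp add: fst_sum xi_Ev gr_def) (simp add: Ev_def)
  fix \<alpha>
  show "Poly_Mapping.lookup (snd x) \<alpha> = Poly_Mapping.lookup (snd (\<Sum>i\<in>UNIV. e6_scale (Poly_Mapping.lookup (snd x) (beta i)) (xi i))) \<alpha>"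
  proof (cases "\<alpha> \<in> range beta")
    case True
    then show ?thesis by (auto simp: snd_sum lookup_sum xi_Ev lookup_Ev inj_beta)
  next
    case False
    then have "\<alpha> \<notin> Phi_E6 \<or> \<alpha> $ 6 \<noteq> 1" using root_1_beta by blast
    then have "Poly_Mapping.lookup (snd x) \<alpha> = 0" using x by (auto simp: gr_def mem_e6)
    moreover have "beta i \<noteq> \<alpha>" for i using False by auto
    ultimately show ?thesis by (auto simp: snd_sum lookup_sum xi_Ev lookup_Ev)
  qed
qed

lemma bracket_xi_g0: "u \<in> gr 0 \<Longrightarrow> e6_bracket (xi s) u = (\<Sum>i\<in>UNIV. e6_scale (phi i s u) (xi i))"
  using gr_1_expand[OF bracket_gr[OF xi_gr, of u 0, simplified]] by (simp add: lookup_bracket_xi gr_e6)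

lemma e6_parts:
  assumes "x \<in> e6"
  defines "a \<equiv> \<lambda>i. Poly_Mapping.lookup (snd x) (- beta i)"
  defines "b \<equiv> \<lambda>i. Poly_Mapping.lookup (snd x) (beta i)"
  shows "x - (\<Sum>i\<in>UNIV. e6_scale (a i) (eta i)) - (\<Sum>i\<in>UNIV. e6_scale (b i) (xi i)) \<in> gr 0"
proof -
  let ?u = "x - (\<Sum>i\<in>UNIV. e6_scale (a i) (eta i)) - (\<Sum>i\<in>UNIV. e6_scale (b i) (xi i))"
  have "e6_scale (a i) (eta i) \<in> e6" "e6_scale (b i) (xi i) \<in> e6" for i
    using eta_gr xi_gr gr_e6 e6v.subspace_scale[OF e6_subspace] by blast+
  then have "?u \<in> e6"
    using assms(1) by (intro e6v.subspace_diff[OF e6_subspace] e6v.subspace_sum[OF e6_subspace])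
  moreover have "Poly_Mapping.lookup (snd ?u) \<alpha> = 0" if nz: "\<alpha> $ 6 \<noteq> 0" and rt: "\<alpha> \<in> Phi_E6" for \<alpha>
  proof -
    have e: "Poly_Mapping.lookup (snd ?u) \<alpha> = Poly_Mapping.lookup (snd x) \<alpha>
      - (\<Sum>i\<in>UNIV. if - beta i = \<alpha> then a i else 0) - (\<Sum>i\<in>UNIV. if beta i = \<alpha> then b i else 0)"
      by (simp add: lookup_minus snd_sum lookup_sum xi_Ev eta_Ev lookup_Ev if_distrib cong: if_cong)
    have "\<alpha> $ 6 = 1 \<or> \<alpha> $ 6 = -1" using root_6[OF rt] nz by auto
    then show ?thesis
    proof
      assume "\<alpha> $ 6 = 1"
      then obtain j where j: "\<alpha> = beta j" using root_1_beta[OF rt] by blast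
      have "- beta i \<noteq> beta j" for i using beta_6[of i] beta_6[of j] by (metis vector_uminus_component one_neq_neg_one)
      then show ?thesis unfolding e unfolding j by (simp add: inj_beta b_def)
    next
      assume "\<alpha> $ 6 = -1"
      then have "- \<alpha> \<in> range beta" using root_1_beta[of "- \<alpha>"] rt by simp
      then obtain j where "- \<alpha> = beta j" by blast
      then have j: "\<alpha> = - beta j" by (metis minus_minus)
      have "beta i \<noteq> - beta j" for i using beta_6[of i] beta_6[of j] by (metis vector_uminus_component one_neq_neg_one)
      then show ?thesis unfolding e unfolding j by (simp add: inj_beta a_def)
    qed
  qed
  ultimately show ?thesis unfolding gr_def mem_e6 by blast
qed

section \<open>The orthogonal Lie algebra\<close>

interpretation matv: vector_space mat_scale
  by unfold_locales (simp_all add: mat_scale_def vec_eq_iff algebra_simps)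

lemma mat_unit_nth: "mat_unit i j $ r $ s = (if r = of_nat i \<and> s = of_nat j then 1 else 0)"
  by (simp add: mat_unit_def)

text \<open>Adding \<open>5\<close> in the index type \<open>10\<close> is the involution that exchanges the two isotropic halves.\<close>

definition skew10 :: "(complex ^ 10 ^ 10) set"
  where "skew10 = {A. \<forall>i j. A $ i $ j = - (A $ (j + 5) $ (i + 5))}"

lemma add_5_5 [simp]: "i + 5 + 5 = (i :: 10)"
proof -
  have "(5 :: 10) + 5 = 0" by simp
  then show ?thesis by (simp only: add.assoc add_0_right)
qed

lemma add_5_eq: "r + 5 = s \<longleftrightarrow> r = s + (5 :: 10)"
  by (metis add_5_5)

lemma skew10D: "A \<in> skew10 \<Longrightarrow> A $ i $ j = - (A $ (j + 5) $ (i + 5))"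
  unfolding skew10_def by blast

lemma skew10I: "(\<And>i j. A $ i $ j = - (A $ (j + 5) $ (i + 5))) \<Longrightarrow> A \<in> skew10"
  unfolding skew10_def by blast

lemma skew10_subspace: "matv.subspace skew10"
  unfolding matv.subspace_def
proof (intro conjI ballI allI)
  show "0 \<in> skew10" by (rule skew10I) simp
next
  fix A B assume A: "A \<in> skew10" and B: "B \<in> skew10"
  show "A + B \<in> skew10"
  proof (rule skew10I)
    fix i j show "(A + B) $ i $ j = - ((A + B) $ (j + 5) $ (i + 5))"
      using skew10D[OF A, of i j] skew10D[OF B, of i j] by simp
  qed
next
  fix k A assume A: "A \<in> skew10"
  show "mat_scale k A \<in> skew10"
  proof (rule skew10I)
    fix i j show "mat_scale k A $ i $ j = - (mat_scale k A $ (j + 5) $ (i + 5))"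
      using skew10D[OF A, of i j] by (simp add: mat_scale_def)
  qed
qed

lemma skew10_unit: "mat_unit i j - mat_unit k l \<in> skew10"
  if "of_nat k = (of_nat j + 5 :: 10)" "of_nat l = (of_nat i + 5 :: 10)"
proof (rule skew10I)
  fix r s :: 10
  note e = add_5_eq[of s "of_nat i"] add_5_eq[of r "of_nat j"] add_right_cancel
  show "(mat_unit i j - mat_unit k l) $ r $ s = - ((mat_unit i j - mat_unit k l) $ (s + 5) $ (r + 5))"
    unfolding vector_minus_component mat_unit_nth that e by (simp add: conj_commute)
qed

text \<open>Sending a matrix to the one with entries \<open>A $ (j + 5) $ (i + 5)\<close> reverses
  products, and on \<open>skew10\<close> this map is minus the identity.\<close>

lemma skew10_commutator: "A \<in> skew10 \<Longrightarrow> B \<in> skew10 \<Longrightarrow> mat_commutator A B \<in> skew10"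
proof -
  assume A: "A \<in> skew10" and B: "B \<in> skew10"
  have *: "(P ** Q) $ i $ j = (Q ** P) $ (j + 5) $ (i + 5)" if "P \<in> skew10" "Q \<in> skew10" for P Q i j
  proof -
    have "(P ** Q) $ i $ j = (\<Sum>k\<in>UNIV. Q $ (j + 5) $ (k + 5) * P $ (k + 5) $ (i + 5))"
    proof -
      have "P $ i $ k * Q $ k $ j = Q $ (j + 5) $ (k + 5) * P $ (k + 5) $ (i + 5)" for k
        using skew10D[OF that(1), of i k] skew10D[OF that(2), of k j] by simp
      then show ?thesis by (simp add: matrix_matrix_mult_def)
    qed
    also have "\<dots> = (\<Sum>k\<in>UNIV. Q $ (j + 5) $ k * P $ k $ (i + 5))"
      by (rule sum.reindex_bij_witness[of _ "\<lambda>k. k + 5" "\<lambda>k. k + 5"]) simp_all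
    finally show ?thesis by (simp add: matrix_matrix_mult_def)
  qed
  show ?thesis
  proof (rule skew10I)
    fix i j show "mat_commutator A B $ i $ j = - (mat_commutator A B $ (j + 5) $ (i + 5))"
      unfolding mat_commutator_def using *[OF A B, of i j] *[OF B A, of i j] by simp
  qed
qed

text \<open>Membership in the span becomes a linear condition on the entries, through which closure
  under commutators can be shown.\<close>

lemma o10_skew: "o10 = skew10"
proof
  show "o10 \<subseteq> skew10"
    unfolding o10_def by (rule matv.span_minimal[OF _ skew10_subspace]) (auto intro!: skew10_unit)
  \<comment> \<open>Here \<open>k\<close> and \<open>l\<close> are the images of \<open>j\<close>
    and \<open>i\<close> under the involution, represented in 1, ..., 10 because
    \<open>mat_unit\<close> takes natural numbers.\<close>
  have gen: "mat_unit i j - mat_unit k l \<in> o10"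
    if "1 \<le> i" "i \<le> 10" "1 \<le> j" "j \<le> 10" "k = (if j \<le> 5 then j + 5 else j - 5)" "l = (if i \<le> 5 then i + 5 else i - 5)" for i j k l
  proof -
    have g1: "mat_unit i j - mat_unit (5 + j) (5 + i) \<in> o10" if "i \<in> {1..5}" "j \<in> {1..5}" for i j
      unfolding o10_def using that by (intro matv.span_base) blast
    have g2: "mat_unit p (5 + q) - mat_unit q (5 + p) \<in> o10" "mat_unit (5 + p) q - mat_unit (5 + q) p \<in> o10"
      if "1 \<le> p" "p < q" "q \<le> 5" for p q
      unfolding o10_def using that by (intro matv.span_base; blast)+
    have neg: "a - b \<in> o10 \<Longrightarrow> b - a \<in> o10" for a b
      unfolding o10_def using matv.span_neg[of "a - b"] by simp
    have zero: "0 \<in> o10" unfolding o10_def by (rule matv.span_zero)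
    consider "i \<le> 5" "j \<le> 5" | "i > 5" "j > 5" | "i \<le> 5" "j > 5" | "i > 5" "j \<le> 5" by linarith
    then show ?thesis
    proof cases
      case 1
      then have "k = 5 + j" "l = 5 + i" using that by simp_all
      then show ?thesis using 1 that(1-4) g1[of i j] by simp
    next
      case 2
      then have kl: "l \<in> {1..5}" "k \<in> {1..5}" "i = 5 + l" "j = 5 + k" using that by auto
      then show ?thesis using neg[OF g1[of k l]] by simp
    next
      case 3
      define q where "q = j - 5"
      have q: "j = 5 + q" "k = q" "l = 5 + i" "1 \<le> q" "q \<le> 5" using 3 that unfolding q_def by auto
      consider "i < q" | "i = q" | "q < i" by linarith
      then show ?thesis
        using q that(1) \<open>i \<le> 5\<close> g2(1)[of i q] neg[OF g2(1)[of q i]] zero by cases simp_all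
    next
      case 4
      define p where "p = i - 5"
      have p: "i = 5 + p" "k = 5 + j" "l = p" "1 \<le> p" "p \<le> 5" using 4 that unfolding p_def by auto
      consider "p < j" | "p = j" | "j < p" by linarith
      then show ?thesis
        using p that(3) \<open>j \<le> 5\<close> g2(2)[of p j] neg[OF g2(2)[of j p]] zero by cases simp_all
    qed
  qed
  \<comment> \<open>\<open>U r s\<close> is twice the skew part of a matrix unit, which accounts for
    the coefficient \<open>A $ r $ s / 2\<close> in the expansion of \<open>A\<close>.\<close>
  define U where "U r s = (\<chi> r' s'. if r' = r \<and> s' = s then 1 else (0 :: complex)) -
    (\<chi> r' s'. if r' = s + 5 \<and> s' = r + 5 then 1 else 0)" for r s :: 10
  have "U r s \<in> o10" for r s
  proof -
    have ex: "\<exists>n. 1 \<le> n \<and> n \<le> 10 \<and> of_nat n = x \<and> of_nat (if n \<le> 5 then n + 5 else n - 5) = x + 5" for x :: 10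
    proof -
      have "\<forall>x :: 10. \<exists>n\<in>{1,2,3,4,5,6,7,8,9,10}. of_nat n = x \<and> of_nat (if n \<le> 5 then n + 5 else n - 5) = x + 5"
        unfolding forall_10 by simp
      then obtain n where "n\<in>{1,2,3,4,5,6,7,8,9,10}" "of_nat n = x" "of_nat (if n \<le> 5 then n + 5 else n - 5) = x + 5" by blast
      then show ?thesis by (intro exI[of _ n]) auto
    qed
    obtain i where i: "1 \<le> i" "i \<le> 10" "of_nat i = r" "of_nat (if i \<le> 5 then i + 5 else i - 5) = r + 5" using ex[of r] by blast
    obtain j where j: "1 \<le> j" "j \<le> 10" "of_nat j = s" "of_nat (if j \<le> 5 then j + 5 else j - 5) = s + 5" using ex[of s] by blast
    show ?thesis using gen[OF i(1,2) j(1,2) refl refl] unfolding mat_unit_def i(3,4) j(3,4) U_def .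
  qed
  then have mem: "(\<Sum>r\<in>UNIV. \<Sum>s\<in>UNIV. mat_scale (A $ r $ s / 2) (U r s)) \<in> o10" for A
    unfolding o10_def by (intro matv.span_sum matv.span_scale)
  have expand: "A = (\<Sum>r\<in>UNIV. \<Sum>s\<in>UNIV. mat_scale (A $ r $ s / 2) (U r s))" if "A \<in> skew10" for A
  proof -
    have "(\<Sum>r\<in>UNIV. \<Sum>s\<in>UNIV. A $ r $ s / 2 * U r s $ i $ j) = A $ i $ j" for i j
    proof -
      have *: "A $ r $ s / 2 * U r s $ i $ j = (if r = i then (if s = j then A $ i $ j / 2 else 0) else 0)
        - (if r = j + 5 then (if s = i + 5 then A $ (j + 5) $ (i + 5) / 2 else 0) else 0)" for r s
        unfolding U_def add_5_eq[of i s] add_5_eq[of j r] by auto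
      have "A $ (j + 5) $ (i + 5) = - (A $ i $ j)" using skew10D[OF that, of i j] by simp
      then show ?thesis unfolding * sum_subtractf if_sum_zero by simp
    qed
    then show ?thesis by (simp add: vec_eq_iff mat_scale_def)
  qed
  show "skew10 \<subseteq> o10"
  proof
    fix A assume "A \<in> skew10"
    then show "A \<in> o10" using mem[of A] by (simp only: expand[symmetric])
  qed
qed

lemma o10_subspace: "matv.subspace o10"
  by (simp add: o10_skew skew10_subspace)

lemma o10_commutator: "A \<in> o10 \<Longrightarrow> B \<in> o10 \<Longrightarrow> mat_commutator A B \<in> o10"
  unfolding o10_skew by (rule skew10_commutator)

section \<open>\<open>D5\<close> and the central line inside degree 0\<close>

lemma Phi_D5_iff: "\<alpha> \<in> Phi_D5 \<longleftrightarrow> \<alpha> \<in> Phi_E6 \<and> \<alpha> $ 6 = 0"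
proof -
  have "\<alpha> \<in> range (\<lambda>k. \<Sum>i\<in>{1,2,3,4,5}. k i *s simple_root i) \<longleftrightarrow> \<alpha> $ 6 = 0"
  proof
    assume "\<alpha> $ 6 = 0"
    then have "\<alpha> = (\<Sum>i\<in>{1,2,3,4,5}. \<alpha> $ i *s simple_root i)"
      by (simp add: vec_eq_6 simple_root_def axis_def)
    then show "\<alpha> \<in> range (\<lambda>k. \<Sum>i\<in>{1,2,3,4,5}. k i *s simple_root i)"
      by (rule range_eqI[where x = "\<lambda>i. \<alpha> $ i"])
  qed (auto simp: simple_root_def axis_def)
  then show ?thesis by (auto simp: Phi_D5_def)
qed

lemma gD5_iff: "x \<in> gD5 \<longleftrightarrow> x \<in> gr 0 \<and> fst x $ 6 = 0"
proof
  let ?V = "{x \<in> gr 0. fst x $ 6 = 0}"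
  have "e6v.subspace ?V" using gr_subspace[of 0] by (auto simp: e6v.subspace_def)
  moreover have "(\<lambda>i. hvec (simple_root i)) ` {1,2,3,4,5} \<union> Evec ` Phi_D5 \<subseteq> ?V"
    unfolding hvec_Hv Evec_Ev using Hv_gr Ev_gr
    by (auto simp: Phi_D5_iff) (auto simp: Hv_def Ev_def to_H_def simple_root_def axis_def)
  ultimately have "gD5 \<subseteq> ?V" unfolding gD5_def by (intro e6v.span_minimal)
  then show "x \<in> gD5 \<Longrightarrow> x \<in> gr 0 \<and> fst x $ 6 = 0" by blast
next
  assume x: "x \<in> gr 0 \<and> fst x $ 6 = 0"
  have "Hv h \<in> gD5" if "h $ 6 = 0" for h
  proof -
    have "Hv h = (\<Sum>i\<in>{1,2,3,4,5}. e6_scale (h $ i) (hvec (simple_root i)))"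
      using that unfolding hvec_Hv scale_Hv
      by (simp add: Hv_add) (rule arg_cong[of _ _ Hv], simp add: vec_eq_6 to_H_def simple_root_def axis_def)
    moreover have "(\<Sum>i\<in>{1,2,3,4,5}. e6_scale (h $ i) (hvec (simple_root i))) \<in> gD5"
      unfolding gD5_def by (intro e6v.span_sum e6v.span_scale e6v.span_base) auto
    ultimately show ?thesis by simp
  qed
  moreover have "Ev \<alpha> c \<in> gD5" if "\<alpha> \<in> Phi_D5" for \<alpha> c
  proof -
    have "Ev \<alpha> c = e6_scale c (Evec \<alpha>)" by (simp add: Evec_Ev)
    moreover have "e6_scale c (Evec \<alpha>) \<in> gD5"
      unfolding gD5_def by (rule e6v.span_scale, rule e6v.span_base) (use that in blast)
    ultimately show ?thesis by simp
  qed
  moreover have "Poly_Mapping.keys (snd x) \<subseteq> Phi_D5"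
    using x by (auto simp: gr_def Phi_D5_iff mem_e6 in_keys_iff)
  ultimately show "x \<in> gD5" using x
    by (subst e6_decomp) (auto simp: gD5_def intro!: e6v.span_add e6v.span_sum)
qed

lemma alpha_hat_Hv: "alpha_hat = Hv (to_H (vec6 2 3 4 6 5 4))"
proof -
  have "2 *s simple_root 1 + 3 *s simple_root 2 + 4 *s simple_root 3
    + 6 *s simple_root 4 + 5 *s simple_root 5 + 4 *s simple_root 6 = vec6 2 3 4 6 5 4"
    by (simp add: vec_eq_6 simple_root_def axis_def)
  then show ?thesis by (simp add: alpha_hat_def hvec_Hv)
qed

lemma alpha_hat_gr: "alpha_hat \<in> gr 0"
  by (simp add: alpha_hat_Hv Hv_gr)

text \<open>The inner product with \<open>alpha_hat\<close> is three times the last coordinate. So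
  \<open>alpha_hat\<close> acts on every root vector by three times its degree, hence by 0 in degree
  0.\<close>

lemma alpha_hat_central: "x \<in> gr 0 \<Longrightarrow> e6_bracket alpha_hat x = 0" "x \<in> gr 0 \<Longrightarrow> e6_bracket x alpha_hat = 0"
proof -
  show *: "e6_bracket alpha_hat x = 0" if "x \<in> gr 0" for x
    using that
  proof (induction x rule: gr_induct)
    case (E \<alpha> c)
    have "form (vec6 2 3 4 6 5 4) \<alpha> = 3 * \<alpha> $ 6" unfolding form_explicit by simp
    then show ?case using E by (simp add: alpha_hat_Hv form_to_H Ev_0)
  qed (simp_all add: alpha_hat_Hv e6_bracket_add)
  show "e6_bracket x alpha_hat = 0" if "x \<in> gr 0" for x
    using *[OF that] bracket_antisym[OF gr_e6[OF alpha_hat_gr] gr_e6[OF that]] by simp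
qed

text \<open>The divisor 4 is the last coordinate of \<open>alpha_hat\<close>; the Cartan part of an
  element of \<open>gD5\<close> has last coordinate 0.\<close>

lemma gD5_part:
  assumes "u \<in> gr 0"
  shows "u - e6_scale t alpha_hat \<in> gD5 \<longleftrightarrow> t = fst u $ 6 / 4"
proof -
  have "u - e6_scale t alpha_hat \<in> gr 0"
    using assms alpha_hat_gr e6v.subspace_diff[OF gr_subspace] e6v.subspace_scale[OF gr_subspace] by blast
  then show ?thesis by (auto simp: gD5_iff alpha_hat_Hv Hv_def to_H_def)
qed

definition d5_part :: "e6_vec \<Rightarrow> e6_vec"
  where "d5_part u = u - e6_scale (fst u $ 6 / 4) alpha_hat"

lemma d5_part_gD5: "u \<in> gr 0 \<Longrightarrow> d5_part u \<in> gD5"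
  unfolding d5_part_def by (simp add: gD5_part)

lemma d5_part_gD5_id: "u \<in> gD5 \<Longrightarrow> d5_part u = u"
  by (simp add: d5_part_def gD5_iff)

lemma d5_part_add: "d5_part (u + v) = d5_part u + d5_part v"
  by (simp add: d5_part_def add_divide_distrib e6v.scale_left_distrib)

lemma d5_part_scale: "d5_part (e6_scale k u) = e6_scale k (d5_part u)"
  by (simp add: d5_part_def e6v.scale_right_diff_distrib)

lemma rho_eq:
  assumes "u \<in> gr 0"
  shows "rho c \<nu> sm am u v = am (inv_into o10 \<nu> (d5_part u)) v + sm (fst u $ 6 / 4 * (2 * c)) v"
proof -
  have "(THE t. u - e6_scale t alpha_hat \<in> gD5) = fst u $ 6 / 4"
    using gD5_part[OF assms] by (intro the_equality) auto
  then show ?thesis by (simp only: rho_def Let_def d5_part_def)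
qed

text \<open>Since \<open>alpha_hat\<close> is central in degree 0, brackets there are brackets in
  \<open>D5\<close>; thus the scalar \<open>c\<close> does not enter \<open>rho\<close> of a
  bracket.\<close>

lemma bracket_g0:
  assumes "u \<in> gr 0" "v \<in> gr 0"
  shows "e6_bracket u v = e6_bracket (d5_part u) (d5_part v)"
proof -
  have uv: "u = d5_part u + e6_scale (fst u $ 6 / 4) alpha_hat" "v = d5_part v + e6_scale (fst v $ 6 / 4) alpha_hat"
    by (simp_all add: d5_part_def)
  have d: "d5_part u \<in> gr 0" "d5_part v \<in> gr 0" using assms d5_part_gD5 by (simp_all add: gD5_iff)
  have s: "e6_scale k alpha_hat \<in> gr 0" for k using alpha_hat_gr e6v.subspace_scale[OF gr_subspace] by blast
  have z: "e6_bracket (e6_scale k alpha_hat) x = 0" "e6_bracket x (e6_scale k alpha_hat) = 0" if "x \<in> gr 0" for k x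
  proof -
    show "e6_bracket (e6_scale k alpha_hat) x = 0"
      by (simp add: bracket_scale[OF gr_e6[OF alpha_hat_gr] gr_e6[OF that]] alpha_hat_central(1)[OF that])
    then show "e6_bracket x (e6_scale k alpha_hat) = 0" using bracket_antisym[OF gr_e6[OF s] gr_e6[OF that], of k] by simp
  qed
  show ?thesis
    by (subst uv(1), subst uv(2)) (simp add: e6_bracket_add z d s)
qed

section \<open>Operators on the tensor product\<close>

lemma poly_mapping_sum_single: "w = (\<Sum>m\<in>Poly_Mapping.keys w. Poly_Mapping.single m (Poly_Mapping.lookup w m))"
  by (rule poly_mapping_eqI) (simp add: lookup_sum lookup_single when_def in_keys_iff)

text \<open>Single terms carry arbitrary coefficients, so additivity is enough and no scalars need
  to be considered.\<close>

lemma additive_eqI: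
  fixes F G :: "('a \<Rightarrow>\<^sub>0 'b :: ab_group_add) \<Rightarrow> 'c :: ab_group_add"
  assumes F: "\<And>w w'. F (w + w') = F w + F w'" and G: "\<And>w w'. G (w + w') = G w + G w'"
    and eq: "\<And>m v. F (Poly_Mapping.single m v) = G (Poly_Mapping.single m v)"
  shows "F w = G w"
proof -
  have "F 0 = 0" "G 0 = 0" using F[of 0 0] G[of 0 0] by simp_all
  then have "F (\<Sum>m\<in>S. Poly_Mapping.single m (f m)) = G (\<Sum>m\<in>S. Poly_Mapping.single m (f m))" for S f
    by (induction S rule: infinite_finite_induct) (simp_all add: F G eq)
  then show ?thesis using poly_mapping_sum_single[of w] by metis
qed

text \<open>Differential calculus on polynomials with coefficients in M, using only the vector space
  structure of M. The Lie algebra enters through the numbers \<open>phi\<close> alone.\<close>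

locale mhat = vector_space sm for sm :: "complex \<Rightarrow> 'm::ab_group_add \<Rightarrow> 'm"
begin

abbreviation "S \<equiv> mhat_scale sm"
abbreviation "D \<equiv> xi_op sm"

definition X :: "16 \<Rightarrow> 'm mhat \<Rightarrow> 'm mhat"
  where "X r = tensor_lift (\<lambda>f v. tensor sm (pvar r * f) v)"

lemma lookup_S [simp]: "Poly_Mapping.lookup (S k w) m = sm k (Poly_Mapping.lookup w m)"
  by (simp add: mhat_scale_def lookup_map)

lemma lookup_tensor: "Poly_Mapping.lookup (tensor sm f v) m = sm (Poly_Mapping.lookup f m) v"
  by (simp add: tensor_def lookup_map)

lemma tensor_add: "tensor sm (f + g) v = tensor sm f v + tensor sm g v"
  "tensor sm f (v + v') = tensor sm f v + tensor sm f v'"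
  by (rule poly_mapping_eqI, simp add: lookup_tensor lookup_add scale_left_distrib scale_right_distrib)+

lemma tensor_zero [simp]: "tensor sm 0 v = 0" "tensor sm f 0 = 0"
  by (rule poly_mapping_eqI, simp add: lookup_tensor)+

lemma tensor_sum: "tensor sm (sum f A) v = (\<Sum>a\<in>A. tensor sm (f a) v)"
  by (induction A rule: infinite_finite_induct) (simp_all add: tensor_add)

lemma tensor_single [simp]: "tensor sm (Poly_Mapping.single m a) v = Poly_Mapping.single m (sm a v)"
  by (rule poly_mapping_eqI) (simp add: lookup_tensor lookup_single when_def)

lemma S_single [simp]: "S k (Poly_Mapping.single m v) = Poly_Mapping.single m (sm k v)"
  by (rule poly_mapping_eqI) (simp add: lookup_single when_def)

sublocale hat: vector_space S
  by unfold_locales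
    (rule poly_mapping_eqI, simp add: lookup_add scale_left_distrib scale_right_distrib)+

lemma tensor_lift_add:
  assumes "\<And>f v v'. B f (v + v') = B f v + B f v'"
  shows "tensor_lift B (w + w') = tensor_lift B w + tensor_lift B w'"
proof -
  have "B f 0 = 0" for f using assms[of f 0 0] by simp
  then show ?thesis unfolding tensor_lift_def
    by (intro setsum_keys_plus_distrib) (simp_all add: assms)
qed

lemma tensor_lift_single:
  assumes "\<And>f v v'. B f (v + v') = B f v + B f v'"
  shows "tensor_lift B (Poly_Mapping.single m v) = B (Poly_Mapping.single m 1) v"
proof -
  have "B f 0 = 0" for f using assms[of f 0 0] by simp
  then show ?thesis by (simp add: tensor_lift_def)
qed

lemma X_add: "X r (w + w') = X r w + X r w'" and D_add: "D i (w + w') = D i w + D i w'"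
  unfolding X_def xi_op_def by (rule tensor_lift_add, rule tensor_add)+

lemma X_single [simp]: "X r (Poly_Mapping.single m v) = Poly_Mapping.single (Poly_Mapping.single r 1 + m) v"
  unfolding X_def by (subst tensor_lift_single) (simp_all add: tensor_add pvar_def mult_single)

lemma D_single [simp]: "D i (Poly_Mapping.single m v) =
    Poly_Mapping.single (m - Poly_Mapping.single i 1) (sm (of_nat (Poly_Mapping.lookup m i)) v)"
  unfolding xi_op_def by (subst tensor_lift_single) (simp_all add: tensor_add pdiff_single)

lemma X_zero [simp]: "X r 0 = 0" and D_zero [simp]: "D i 0 = 0"
  using X_add[of r 0 0] D_add[of i 0 0] by simp_all

lemma X_sum: "X r (sum f A) = (\<Sum>a\<in>A. X r (f a))" and D_sum: "D i (sum f A) = (\<Sum>a\<in>A. D i (f a))"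
  by (induction A rule: infinite_finite_induct, simp_all add: X_add D_add)+

lemma X_S: "X r (S k w) = S k (X r w)"
  by (rule additive_eqI[of "\<lambda>w. X r (S k w)"]) (simp_all add: X_add hat.scale_right_distrib)

lemma D_S: "D i (S k w) = S k (D i w)"
  by (rule additive_eqI[of "\<lambda>w. D i (S k w)"]) (simp_all add: D_add hat.scale_right_distrib mult.commute)

lemma D_D: "D i (D j w) = D j (D i w)"
proof (rule additive_eqI[of "\<lambda>w. D i (D j w)"])
  fix m and v :: 'm
  show "D i (D j (Poly_Mapping.single m v)) = D j (D i (Poly_Mapping.single m v))"
  proof (cases "i = j")
    case False
    have "m - Poly_Mapping.single j (Suc 0) - Poly_Mapping.single i (Suc 0) =
      m - Poly_Mapping.single i (Suc 0) - Poly_Mapping.single j (Suc 0)"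
      by (rule poly_mapping_eqI) (simp add: lookup_minus)
    then show ?thesis using False by (simp add: lookup_minus lookup_single when_def mult.commute)
  qed simp
qed (simp_all add: D_add)

lemma D_X: "D i (X j w) = X j (D i w) + (if i = j then w else 0)"
proof (rule additive_eqI[of "\<lambda>w. D i (X j w)"])
  fix m and v :: 'm
  let ?e = "\<lambda>i. Poly_Mapping.single i (1 :: nat)"
  show "D i (X j (Poly_Mapping.single m v)) = X j (D i (Poly_Mapping.single m v)) + (if i = j then Poly_Mapping.single m v else 0)"
  proof (cases "i = j")
    case True
    \<comment> \<open>Subtraction of exponents truncates at 0. If the exponent is already 0, the
      numerical factor of the derivative removes the term.\<close>
    have "?e j + (m - ?e j) = m" if "Poly_Mapping.lookup m j \<noteq> 0"
      by (rule poly_mapping_eqI) (use that in \<open>auto simp: lookup_add lookup_minus lookup_single when_def\<close>)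
    then show ?thesis using True
      by (cases "Poly_Mapping.lookup m j = 0")
        (simp_all add: lookup_add scale_left_distrib single_add add.commute)
  next
    case False
    have "?e j + m - ?e i = ?e j + (m - ?e i)"
      by (rule poly_mapping_eqI) (use False in \<open>auto simp: lookup_add lookup_minus lookup_single when_def\<close>)
    then show ?thesis using False by (simp add: lookup_add lookup_single when_def)
  qed
qed (simp_all add: X_add D_add)

lemma tensor_pvar: "tensor sm (pvar r * g) v = X r (tensor sm g v)"
  by (rule additive_eqI[of "\<lambda>g. tensor sm (pvar r * g) v"])
    (simp_all add: tensor_add X_add distrib_left pvar_def mult_single)

lemma tensor_pconst: "tensor sm (pconst k * g) v = S k (tensor sm g v)"
  by (rule additive_eqI[of "\<lambda>g. tensor sm (pconst k * g) v"])
    (simp_all add: tensor_add hat.scale_right_distrib distrib_left pconst_def mult_single)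

lemma tensor_pdiff: "tensor sm (pdiff i g) v = D i (tensor sm g v)"
  by (rule additive_eqI[of "\<lambda>g. tensor sm (pdiff i g) v"])
    (simp_all add: tensor_add D_add pdiff_add pdiff_single)

text \<open>\<open>L u\<close> is the operator \<open>u|\<^sub>A \<otimes> 1\<close>, without the action of \<open>u\<close> on \<open>M\<close>.\<close>

definition L :: "e6_vec \<Rightarrow> 'm mhat \<Rightarrow> 'm mhat"
  where "L u w = (\<Sum>i\<in>UNIV. \<Sum>j\<in>UNIV. S (phi i j u) (X j (D i w)))"

lemma L_add: "L u (w + w') = L u w + L u w'"
  by (simp add: L_def D_add X_add hat.scale_right_distrib sum.distrib)

lemma tensor_g0_diffop: "tensor sm (g0_diffop u f) v = L u (tensor sm f v)"
  by (simp add: g0_diffop_def L_def tensor_sum tensor_pconst tensor_pvar tensor_pdiff mult.assoc)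

text \<open>By \<open>bracket_xi_g0\<close> the additional term is the operator belonging to
  [xi s, u].\<close>

lemma D_L: "D s (L u w) = L u (D s w) + (\<Sum>i\<in>UNIV. S (phi i s u) (D i w))"
proof -
  have "D s (L u w) = (\<Sum>i\<in>UNIV. \<Sum>j\<in>UNIV. S (phi i j u) (X j (D i (D s w)))
     + (if j = s then S (phi i s u) (D i w) else 0))"
    unfolding L_def D_sum D_S D_X D_D[of s]
    by (intro sum.cong refl) (simp add: hat.scale_right_distrib)
  then show ?thesis by (simp add: L_def sum.distrib)
qed

definition ct :: "'m mhat \<Rightarrow> 'm"
  where "ct w = Poly_Mapping.lookup w 0"

lemma ct_simps [simp]: "ct (w + w') = ct w + ct w'" "ct 0 = 0" "ct (S k w) = sm k (ct w)"
   "ct (- w) = - ct w" "ct (w - w') = ct w - ct w'"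
  by (simp_all add: ct_def lookup_add lookup_minus)

lemma ct_sum: "ct (sum f A) = (\<Sum>a\<in>A. ct (f a))"
  by (simp add: ct_def lookup_sum)

lemma ct_X [simp]: "ct (X r w) = 0"
proof (rule additive_eqI[of "\<lambda>w. ct (X r w)" "\<lambda>_. 0"])
  fix m and v :: 'm
  have "Poly_Mapping.lookup (Poly_Mapping.single r (1 :: nat) + m) r \<noteq> Poly_Mapping.lookup 0 r"
    by (simp add: lookup_add)
  then have "Poly_Mapping.single r (1 :: nat) + m \<noteq> 0" by metis
  then show "ct (X r (Poly_Mapping.single m v)) = 0"
    by (simp add: ct_def lookup_single_not_eq)
qed (simp_all add: X_add)

lemma lookup_D: "Poly_Mapping.lookup (D i w) m = sm (of_nat (Poly_Mapping.lookup m i + 1)) (Poly_Mapping.lookup w (m + Poly_Mapping.single i 1))"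
proof (rule additive_eqI[of "\<lambda>w. Poly_Mapping.lookup (D i w) m"])
  fix n and v :: 'm
  let ?e = "Poly_Mapping.single i (1 :: nat)"
  show "Poly_Mapping.lookup (D i (Poly_Mapping.single n v)) m =
    sm (of_nat (Poly_Mapping.lookup m i + 1)) (Poly_Mapping.lookup (Poly_Mapping.single n v) (m + ?e))"
  proof (cases "n = m + ?e")
    case True
    then show ?thesis by (simp add: lookup_add add.commute)
  next
    case False
    have "n = m + ?e" if "n - ?e = m" "Poly_Mapping.lookup n i \<noteq> 0"
      unfolding that(1)[symmetric]
      by (rule poly_mapping_eqI) (use that(2) in \<open>auto simp: lookup_add lookup_minus lookup_single when_def\<close>)
    then show ?thesis using False by (auto simp: lookup_single when_def)
  qed
qed (simp_all add: D_add lookup_add scale_right_distrib)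

text \<open>Characteristic 0 enters here: lowering one exponent of \<open>m\<close> leads to a
  coefficient of a derivative that is a positive integer times the coefficient of \<open>w\<close>
  at \<open>m\<close>.\<close>

lemma D_all_zero:
  assumes "\<And>i. D i w = 0" and "m \<noteq> 0"
  shows "Poly_Mapping.lookup w m = 0"
proof -
  obtain i where i: "Poly_Mapping.lookup m i \<noteq> 0"
    using assms(2) by (metis lookup_zero poly_mapping_eqI)
  let ?n = "m - Poly_Mapping.single i 1"
  have "?n + Poly_Mapping.single i 1 = m"
    by (rule poly_mapping_eqI) (use i in \<open>auto simp: lookup_add lookup_minus lookup_single when_def\<close>)
  then have "sm (of_nat (Poly_Mapping.lookup ?n i + 1)) (Poly_Mapping.lookup w m) = 0"
    using lookup_D[of i w ?n] assms(1) by simp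
  then show ?thesis by (metis scale_eq_0_iff of_nat_eq_0_iff Suc_eq_plus1 nat.distinct(1))
qed

end

section \<open>Decomposition into homogeneous parts\<close>

lemma gr_minus_1_expand:
  assumes x: "x \<in> gr (-1)"
  shows "x = (\<Sum>i\<in>UNIV. e6_scale (Poly_Mapping.lookup (snd x) (- beta i)) (eta i))"
proof (rule e6_vec_eqI)
  show "fst x = fst (\<Sum>i\<in>UNIV. e6_scale (Poly_Mapping.lookup (snd x) (- beta i)) (eta i))"
    using x by (simp add: fst_sum eta_Ev gr_def) (simp add: Ev_def)
  fix \<alpha>
  show "Poly_Mapping.lookup (snd x) \<alpha> = Poly_Mapping.lookup (snd (\<Sum>i\<in>UNIV. e6_scale (Poly_Mapping.lookup (snd x) (- beta i)) (eta i))) \<alpha>"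
  proof (cases "- \<alpha> \<in> range beta")
    case True
    then obtain j where "- \<alpha> = beta j" by blast
    then have j: "\<alpha> = - beta j" by (metis minus_minus)
    show ?thesis unfolding j by (simp add: snd_sum lookup_sum eta_Ev lookup_Ev inj_beta)
  next
    case False
    then have "\<alpha> \<notin> Phi_E6 \<or> \<alpha> $ 6 \<noteq> -1" using root_1_beta[of "- \<alpha>"] by auto
    then have "Poly_Mapping.lookup (snd x) \<alpha> = 0" using x by (auto simp: gr_def mem_e6)
    moreover have "- beta i \<noteq> \<alpha>" for i using False by auto
    ultimately show ?thesis by (auto simp: snd_sum lookup_sum eta_Ev lookup_Ev)
  qed
qed

lemma gr_minus_2:
  assumes x: "x \<in> gr (-2)"
  shows "x = 0"
proof (rule e6_vec_eqI)
  show "fst x = fst 0" using x by (simp add: gr_def)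
  fix \<alpha>
  have "\<alpha> $ 6 \<noteq> -2 \<or> \<alpha> \<notin> Phi_E6" using root_6[of \<alpha>] by auto
  then show "Poly_Mapping.lookup (snd x) \<alpha> = Poly_Mapping.lookup (snd 0) \<alpha>"
    using x by (auto simp: gr_def mem_e6)
qed

lemma g_minus_gr: "g_minus = gr (-1)"
proof
  show "g_minus \<subseteq> gr (-1)"
    unfolding g_minus_def using eta_gr by (intro e6v.span_minimal gr_subspace) auto
  show "gr (-1) \<subseteq> g_minus"
  proof
    fix x assume "x \<in> gr (-1)"
    have "(\<Sum>i\<in>UNIV. e6_scale (Poly_Mapping.lookup (snd x) (- beta i)) (eta i)) \<in> g_minus"
      unfolding g_minus_def by (intro e6v.span_sum e6v.span_scale e6v.span_base) blast
    then show "x \<in> g_minus" using gr_minus_1_expand[OF \<open>x \<in> gr (-1)\<close>] by simp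
  qed
qed

definition deg0 :: "e6_vec \<Rightarrow> e6_vec"
  where "deg0 x = x - (\<Sum>i\<in>UNIV. e6_scale (Poly_Mapping.lookup (snd x) (- beta i)) (eta i))
    - (\<Sum>i\<in>UNIV. e6_scale (Poly_Mapping.lookup (snd x) (beta i)) (xi i))"

lemma deg0_gr: "x \<in> e6 \<Longrightarrow> deg0 x \<in> gr 0"
  unfolding deg0_def by (rule e6_parts)

lemma deg0_add: "deg0 (x + y) = deg0 x + deg0 y"
  by (simp add: deg0_def lookup_add e6v.scale_left_distrib sum.distrib algebra_simps)

lemma deg0_scale: "deg0 (e6_scale k x) = e6_scale k (deg0 x)"
  by (simp add: deg0_def e6v.scale_right_diff_distrib e6v.scale_sum_right)

lemma e6_split:
  assumes "x \<in> e6"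
  obtains a b c where "a \<in> gr (-1)" "b \<in> gr 0" "c \<in> gr 1" "x = a + b + c"
proof
  let ?a = "\<Sum>i\<in>UNIV. e6_scale (Poly_Mapping.lookup (snd x) (- beta i)) (eta i)"
  let ?c = "\<Sum>i\<in>UNIV. e6_scale (Poly_Mapping.lookup (snd x) (beta i)) (xi i)"
  show "?a \<in> gr (-1)" "?c \<in> gr 1"
    by (intro e6v.subspace_sum e6v.subspace_scale gr_subspace eta_gr xi_gr)+
  show "deg0 x \<in> gr 0" by (rule deg0_gr[OF assms])
  show "x = ?a + deg0 x + ?c" by (simp add: deg0_def)
qed

lemma gr_lookup_beta:
  "x \<in> gr k \<Longrightarrow> k \<noteq> 1 \<Longrightarrow> Poly_Mapping.lookup (snd x) (beta i) = 0"
  "x \<in> gr k \<Longrightarrow> k \<noteq> -1 \<Longrightarrow> Poly_Mapping.lookup (snd x) (- beta i) = 0"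
  by (auto simp: gr_def beta_6)

lemma bracket_xi_eta_gr: "e6_bracket (xi s) (eta i) \<in> gr 0"
  using bracket_gr[OF xi_gr eta_gr] by simp

text \<open>By \<open>lookup_bracket_xi\<close> both sides are coefficients of \<open>xi l\<close>
  in double brackets of \<open>xi s\<close>, \<open>xi t\<close> and \<open>eta i\<close>; the
  symmetry reflects that the \<open>xi\<close> commute. It is read off from the Hessian
  formula.\<close>

lemma phi_xi_eta_sym: "phi l s (e6_bracket (xi t) (eta i)) = phi l t (e6_bracket (xi s) (eta i))"
proof -
  have "(\<Sum>k\<in>UNIV. hess k t s * hess k i l) = (\<Sum>k\<in>UNIV. hess k s t * hess k i l)"
    by (subst hess_sym) (rule refl)
  then show ?thesis
    unfolding structure_constants by (cases "i = t"; cases "i = s"; cases "l = s"; cases "l = t") simp_all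
qed

section \<open>The action on the tensor product and its commutators with derivatives\<close>

locale e6_setting = mhat sm for sm :: "complex \<Rightarrow> 'm::ab_group_add \<Rightarrow> 'm" +
  fixes c :: complex and \<nu> :: "complex ^ 10 ^ 10 \<Rightarrow> e6_vec" and am :: "complex ^ 10 ^ 10 \<Rightarrow> 'm \<Rightarrow> 'm"
  assumes nu: "is_nu \<nu>" and lie_M: "lie_module o10 mat_scale mat_commutator sm UNIV am"
begin

abbreviation "r \<equiv> rho c \<nu> sm am"
abbreviation "op \<equiv> e6_action c \<nu> sm am"
abbreviation "N \<equiv> inv_into o10 \<nu>"

lemma nu_simps:
  "bij_betw \<nu> o10 gD5"
  "A \<in> o10 \<Longrightarrow> B \<in> o10 \<Longrightarrow> \<nu> (A + B) = \<nu> A + \<nu> B"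
  "A \<in> o10 \<Longrightarrow> \<nu> (mat_scale k A) = e6_scale k (\<nu> A)"
  "A \<in> o10 \<Longrightarrow> B \<in> o10 \<Longrightarrow> \<nu> (mat_commutator A B) = e6_bracket (\<nu> A) (\<nu> B)"
  using nu unfolding is_nu_def by blast+

lemma am_simps:
  "A \<in> o10 \<Longrightarrow> B \<in> o10 \<Longrightarrow> am (A + B) v = am A v + am B v"
  "A \<in> o10 \<Longrightarrow> am (mat_scale k A) v = sm k (am A v)"
  "A \<in> o10 \<Longrightarrow> am A (v + w) = am A v + am A w"
  "A \<in> o10 \<Longrightarrow> am A (sm k v) = sm k (am A v)"
  "A \<in> o10 \<Longrightarrow> B \<in> o10 \<Longrightarrow> am (mat_commutator A B) v = am A (am B v) - am B (am A v)"
  using lie_M unfolding lie_module_def by blast+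

lemma N: "x \<in> gD5 \<Longrightarrow> N x \<in> o10" "x \<in> gD5 \<Longrightarrow> \<nu> (N x) = x" "A \<in> o10 \<Longrightarrow> N (\<nu> A) = A"
  using nu_simps(1) by (auto simp: bij_betw_def inv_into_into f_inv_into_f)

lemma N_eqI: "A \<in> o10 \<Longrightarrow> \<nu> A = x \<Longrightarrow> N x = A"
  using N(3) by blast

text \<open>Transport along the inverse requires \<open>o10\<close> to be closed under commutators.
  Closure of \<open>gD5\<close> under brackets results from the same transport.\<close>

lemma N_hom:
  assumes "x \<in> gD5" "y \<in> gD5"
  shows "N (x + y) = N x + N y" "N (e6_scale k x) = mat_scale k (N x)"
    "N (e6_bracket x y) = mat_commutator (N x) (N y)" "e6_bracket x y \<in> gD5"
proof -
  note m = N(1)[OF assms(1)] N(1)[OF assms(2)]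
  note s = N(2)[OF assms(1)] N(2)[OF assms(2)]
  show "N (x + y) = N x + N y"
    by (rule N_eqI) (simp_all add: nu_simps m s matv.subspace_add[OF o10_subspace])
  show "N (e6_scale k x) = mat_scale k (N x)"
    by (rule N_eqI) (simp_all add: nu_simps m s matv.subspace_scale[OF o10_subspace])
  show "N (e6_bracket x y) = mat_commutator (N x) (N y)"
    by (rule N_eqI) (simp_all add: nu_simps m s o10_commutator)
  have "\<nu> (mat_commutator (N x) (N y)) \<in> gD5"
    using nu_simps(1) o10_commutator[OF m] by (auto simp: bij_betw_def)
  then show "e6_bracket x y \<in> gD5" by (simp add: nu_simps m s)
qed

lemma N_d5: "u \<in> gr 0 \<Longrightarrow> N (d5_part u) \<in> o10"
  using N(1) d5_part_gD5 by blast

lemma r_add_right: "u \<in> gr 0 \<Longrightarrow> r u (v + w) = r u v + r u w"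
  by (simp add: rho_eq am_simps N_d5 scale_right_distrib)

lemma r_scale_right: "u \<in> gr 0 \<Longrightarrow> r u (sm k v) = sm k (r u v)"
  by (simp add: rho_eq am_simps N_d5 scale_right_distrib mult.commute)

lemma r_add: "u \<in> gr 0 \<Longrightarrow> u' \<in> gr 0 \<Longrightarrow> r (u + u') v = r u v + r u' v"
  using e6v.subspace_add[OF gr_subspace]
  by (simp add: rho_eq d5_part_add N_hom d5_part_gD5 am_simps N_d5 add_divide_distrib distrib_right scale_left_distrib)

lemma r_scale: "u \<in> gr 0 \<Longrightarrow> r (e6_scale k u) v = sm k (r u v)"
  using e6v.subspace_scale[OF gr_subspace] d5_part_gD5[of u]
  by (simp add: rho_eq d5_part_scale N_hom(2)[of "d5_part u" "d5_part u"] am_simps N_d5 scale_right_distrib mult.assoc)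

lemma r_gD5: "u \<in> gD5 \<Longrightarrow> r u v = am (N u) v"
  by (simp add: rho_eq gD5_iff d5_part_gD5_id)

lemma r_bracket:
  assumes "u \<in> gr 0" "u' \<in> gr 0"
  shows "r (e6_bracket u u') v = r u (r u' v) - r u' (r u v)"
proof -
  note d = d5_part_gD5[OF assms(1)] d5_part_gD5[OF assms(2)]
  note A = N(1)[OF d(1)] N(1)[OF d(2)]
  have "r (e6_bracket u u') v = am (N (d5_part u)) (am (N (d5_part u')) v) - am (N (d5_part u')) (am (N (d5_part u)) v)"
    unfolding bracket_g0[OF assms] by (simp add: r_gD5 N_hom d am_simps A)
  also have "\<dots> = r u (r u' v) - r u' (r u v)"
    by (simp add: rho_eq assms am_simps A scale_right_distrib mult.commute)
  finally show ?thesis .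
qed

lemma r_zero [simp]: "u \<in> gr 0 \<Longrightarrow> r u 0 = 0"
  using r_add_right[of u 0 0] by simp

text \<open>The counterpart of \<open>L u\<close>: the identity on polynomials tensored with the
  action of \<open>u\<close> on M.\<close>

definition R :: "e6_vec \<Rightarrow> 'm mhat \<Rightarrow> 'm mhat"
  where "R u = Poly_Mapping.map (r u)"

lemma lookup_R: "u \<in> gr 0 \<Longrightarrow> Poly_Mapping.lookup (R u w) m = r u (Poly_Mapping.lookup w m)"
  by (simp add: R_def lookup_map)

lemma R_add: "u \<in> gr 0 \<Longrightarrow> R u (w + w') = R u w + R u w'"
  by (rule poly_mapping_eqI) (simp add: lookup_R lookup_add r_add_right)

lemma R_S: "u \<in> gr 0 \<Longrightarrow> R u (S k w) = S k (R u w)"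
  by (rule poly_mapping_eqI) (simp add: lookup_R r_scale_right)

lemma D_R: "u \<in> gr 0 \<Longrightarrow> D s (R u w) = R u (D s w)"
  by (rule poly_mapping_eqI) (simp only: lookup_R lookup_D r_scale_right)

lemma R_single: "u \<in> gr 0 \<Longrightarrow> R u (Poly_Mapping.single m v) = Poly_Mapping.single m (r u v)"
  by (rule poly_mapping_eqI) (simp add: lookup_R lookup_single when_def)

lemma g0_op_eq:
  assumes u: "u \<in> gr 0"
  shows "g0_op c \<nu> sm am u w = L u w + R u w"
proof (rule additive_eqI[of "g0_op c \<nu> sm am u"])
  let ?B = "\<lambda>f v. tensor sm (g0_diffop u f) v + tensor sm f (r u v)"
  have B: "?B f (v + v') = ?B f v + ?B f v'" for f v v'
    by (simp add: tensor_add r_add_right[OF u])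
  show "g0_op c \<nu> sm am u (w + w') = g0_op c \<nu> sm am u w + g0_op c \<nu> sm am u w'" for w w'
    unfolding g0_op_def by (rule tensor_lift_add, rule B)
  show "g0_op c \<nu> sm am u (Poly_Mapping.single m v) = L u (Poly_Mapping.single m v) + R u (Poly_Mapping.single m v)" for m v
    unfolding g0_op_def by (subst tensor_lift_single, rule B) (simp add: tensor_g0_diffop R_single[OF u])
qed (simp add: L_add R_add[OF u])

text \<open>Through \<open>P_op_g0\<close> the differential part involves the same brackets
  [xi s, eta i] as the part acting on M, so both can be differentiated together.\<close>

lemma eta_op_eq: "eta_op c \<nu> sm am i w =
  (\<Sum>s\<in>UNIV. X s (S (1/2) (L (e6_bracket (xi s) (eta i)) w) + R (e6_bracket (xi s) (eta i)) w))"
proof (rule additive_eqI[of "eta_op c \<nu> sm am i"])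
  let ?B = "\<lambda>f v. tensor sm (P_op i f) v
    + (\<Sum>s\<in>UNIV. tensor sm (pvar s * f) (r (e6_bracket (xi s) (eta i)) v))"
  have B: "?B f (v + v') = ?B f v + ?B f v'" for f v v'
    by (simp add: tensor_add r_add_right[OF bracket_xi_eta_gr] sum.distrib)
  show "eta_op c \<nu> sm am i (w + w') = eta_op c \<nu> sm am i w + eta_op c \<nu> sm am i w'" for w w'
    unfolding eta_op_def by (rule tensor_lift_add, rule B)
  fix m v
  show "eta_op c \<nu> sm am i (Poly_Mapping.single m v) =
    (\<Sum>s\<in>UNIV. X s (S (1/2) (L (e6_bracket (xi s) (eta i)) (Poly_Mapping.single m v)) + R (e6_bracket (xi s) (eta i)) (Poly_Mapping.single m v)))"
    unfolding eta_op_def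
    by (subst tensor_lift_single, rule B)
      (simp add: P_op_g0 tensor_sum tensor_pconst tensor_pvar tensor_g0_diffop R_single[OF bracket_xi_eta_gr] X_add X_S
        mult.assoc sum.distrib)
qed (simp add: L_add R_add[OF bracket_xi_eta_gr] X_add hat.scale_right_distrib sum.distrib)

lemma L_S: "L u (S k w) = S k (L u w)"
  by (simp add: L_def D_S X_S hat.scale_sum_right mult.commute)

lemma L_u_add: "L (u + u') w = L u w + L u' w"
  by (simp add: L_def phi_add hat.scale_left_distrib sum.distrib)

lemma L_u_scale: "u \<in> e6 \<Longrightarrow> L (e6_scale k u) w = S k (L u w)"
  by (simp add: L_def phi_scale hat.scale_sum_right)

lemma op_eq: "op x w = (\<Sum>i\<in>UNIV. S (Poly_Mapping.lookup (snd x) (- beta i)) (eta_op c \<nu> sm am i w))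
   + g0_op c \<nu> sm am (deg0 x) w + (\<Sum>i\<in>UNIV. S (Poly_Mapping.lookup (snd x) (beta i)) (D i w))"
  by (simp add: e6_action_def Let_def deg0_def)

lemma op_add:
  assumes "x \<in> e6" "y \<in> e6"
  shows "op (x + y) w = op x w + op y w"
proof -
  have "R (deg0 x + deg0 y) w = R (deg0 x) w + R (deg0 y) w"
    using deg0_gr[OF assms(1)] deg0_gr[OF assms(2)] e6v.subspace_add[OF gr_subspace]
    by (intro poly_mapping_eqI) (simp add: lookup_R lookup_add r_add)
  then show ?thesis
    using deg0_gr[OF assms(1)] deg0_gr[OF assms(2)] e6v.subspace_add[OF gr_subspace]
    by (simp add: op_eq deg0_add lookup_add hat.scale_left_distrib sum.distrib g0_op_eq L_u_add)
qed

lemma op_scale: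
  assumes "x \<in> e6"
  shows "op (e6_scale k x) w = S k (op x w)"
proof -
  have "R (e6_scale k (deg0 x)) w = S k (R (deg0 x) w)"
    using deg0_gr[OF assms] e6v.subspace_scale[OF gr_subspace]
    by (intro poly_mapping_eqI) (simp add: lookup_R r_scale)
  then show ?thesis
    using deg0_gr[OF assms] e6v.subspace_scale[OF gr_subspace]
    by (simp add: op_eq deg0_scale hat.scale_right_distrib hat.scale_sum_right g0_op_eq L_u_scale gr_e6)
qed

lemma op_zero [simp]: "op 0 w = 0"
  using op_add[of 0 0 w] e6v.subspace_0[OF e6_subspace] by simp

lemma op_minus: "x \<in> e6 \<Longrightarrow> op (- x) w = - op x w"
  using op_scale[of x "-1" w] by simp

lemma op_sum: "(\<And>i. i \<in> I \<Longrightarrow> f i \<in> e6) \<Longrightarrow> op (sum f I) w = (\<Sum>i\<in>I. op (f i) w)"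
proof (induction I rule: infinite_finite_induct)
  case (insert i I)
  then show ?case using op_add[of "f i" "sum f I" w] e6v.subspace_sum[OF e6_subspace, of I f] by simp
qed simp_all

lemma eta_op_add: "eta_op c \<nu> sm am i (w + w') = eta_op c \<nu> sm am i w + eta_op c \<nu> sm am i w'"
  by (simp add: eta_op_eq L_add R_add[OF bracket_xi_eta_gr] X_add hat.scale_right_distrib sum.distrib)

lemma eta_op_S: "eta_op c \<nu> sm am i (S k w) = S k (eta_op c \<nu> sm am i w)"
  by (simp add: eta_op_eq L_S R_S[OF bracket_xi_eta_gr] X_S X_add hat.scale_right_distrib hat.scale_sum_right mult.commute)

lemma op_add_right: "x \<in> e6 \<Longrightarrow> op x (w + w') = op x w + op x w'"
  using deg0_gr[of x] by (simp add: op_eq eta_op_add g0_op_eq L_add R_add D_add hat.scale_right_distrib sum.distrib)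

lemma op_S: "x \<in> e6 \<Longrightarrow> op x (S k w) = S k (op x w)"
  using deg0_gr[of x]
  by (simp add: op_eq eta_op_S g0_op_eq L_S R_S D_S hat.scale_right_distrib hat.scale_sum_right mult.commute)

lemma op_zero_right [simp]: "x \<in> e6 \<Longrightarrow> op x 0 = 0"
  using op_add_right[of x 0 0] by simp

lemma op_gr_0: "u \<in> gr 0 \<Longrightarrow> op u w = g0_op c \<nu> sm am u w"
  by (simp add: op_eq deg0_def gr_lookup_beta)

lemma deg0_xi: "deg0 (xi i) = 0" and deg0_eta: "deg0 (eta i) = 0"
  using gr_1_expand[OF xi_gr, of i] gr_minus_1_expand[OF eta_gr, of i]
    gr_lookup_beta(1)[OF eta_gr] gr_lookup_beta(2)[OF xi_gr]
  by (simp_all add: deg0_def)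

lemma g0_op_zero: "g0_op c \<nu> sm am 0 w = 0"
  using op_gr_0[of 0 w] e6v.subspace_0[OF gr_subspace] by simp

lemma op_xi: "op (xi i) w = D i w"
proof -
  have "Poly_Mapping.lookup (snd (xi i)) (beta j) = (if j = i then 1 else 0)" for j
    by (auto simp: xi_Ev lookup_Ev inj_beta)
  moreover have "(\<Sum>j\<in>UNIV. S (if j = i then 1 else 0) (D j w)) = D i w"
    by (simp add: if_distrib[of "\<lambda>k. S k _"] cong: if_cong)
  ultimately show ?thesis
    using gr_lookup_beta(2)[OF xi_gr] by (simp add: op_eq deg0_xi g0_op_zero)
qed

lemma op_eta: "op (eta i) w = eta_op c \<nu> sm am i w"
proof -
  have "Poly_Mapping.lookup (snd (eta i)) (- beta j) = (if j = i then 1 else 0)" for j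
    by (auto simp: eta_Ev lookup_Ev inj_beta)
  moreover have "(\<Sum>j\<in>UNIV. S (if j = i then 1 else 0) (eta_op c \<nu> sm am j w)) = eta_op c \<nu> sm am i w"
    by (simp add: if_distrib[of "\<lambda>k. S k _"] cong: if_cong)
  ultimately show ?thesis
    using gr_lookup_beta(1)[OF eta_gr] by (simp add: op_eq deg0_eta g0_op_zero)
qed

lemma D_g0_op: "u \<in> gr 0 \<Longrightarrow> D s (g0_op c \<nu> sm am u w) = g0_op c \<nu> sm am u (D s w) + (\<Sum>i\<in>UNIV. S (phi i s u) (D i w))"
  by (simp add: g0_op_eq D_add D_L D_R algebra_simps)

text \<open>Differentiating the explicit variable gives \<open>L\<close> with factor 1/2 and the
  whole of \<open>R\<close>. The commutator with the inner \<open>L\<close> gives, by symmetry, the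
  other half of \<open>L\<close>.\<close>

lemma D_eta_op: "D s (eta_op c \<nu> sm am i w) = eta_op c \<nu> sm am i (D s w) + g0_op c \<nu> sm am (e6_bracket (xi s) (eta i)) w"
proof -
  let ?A = "\<lambda>t. e6_bracket (xi t) (eta i)"
  let ?Y = "\<lambda>t w. S (1/2) (L (?A t) w) + R (?A t) w"
  have DY: "D s (?Y t w) = ?Y t (D s w) + S (1/2) (\<Sum>l\<in>UNIV. S (phi l s (?A t)) (D l w))" for t
    by (simp add: D_add D_S D_L D_R[OF bracket_xi_eta_gr] hat.scale_right_distrib algebra_simps)
  have "D s (eta_op c \<nu> sm am i w) = (\<Sum>t\<in>UNIV. X t (?Y t (D s w))
      + S (1/2) (\<Sum>l\<in>UNIV. S (phi l t (?A s)) (X t (D l w))) + (if t = s then ?Y s w else 0))"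
    unfolding eta_op_eq D_sum
  proof (rule sum.cong[OF refl])
    fix t
    have "D s (X t (?Y t w)) = X t (?Y t (D s w)) + X t (S (1/2) (\<Sum>l\<in>UNIV. S (phi l s (?A t)) (D l w)))
       + (if t = s then ?Y s w else 0)"
      unfolding D_X DY X_add[of t "?Y t (D s w)"] by auto
    \<comment> \<open>The symmetry exchanges \<open>s\<close> and \<open>t\<close>, so the sum over
      \<open>t\<close> rebuilds \<open>L\<close> of the one bracket [xi s, eta i].\<close>
    also have "X t (S (1/2) (\<Sum>l\<in>UNIV. S (phi l s (?A t)) (D l w))) = S (1/2) (\<Sum>l\<in>UNIV. S (phi l t (?A s)) (X t (D l w)))"
      unfolding phi_xi_eta_sym[of _ s t] by (simp add: X_S X_sum)
    finally show "D s (X t (?Y t w)) = X t (?Y t (D s w)) + S (1/2) (\<Sum>l\<in>UNIV. S (phi l t (?A s)) (X t (D l w)))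
       + (if t = s then ?Y s w else 0)" .
  qed
  also have "\<dots> = eta_op c \<nu> sm am i (D s w) + S (1/2) (\<Sum>t\<in>UNIV. \<Sum>l\<in>UNIV. S (phi l t (?A s)) (X t (D l w))) + ?Y s w"
    by (simp add: sum.distrib eta_op_eq flip: hat.scale_sum_right)
  also have "(\<Sum>t\<in>UNIV. \<Sum>l\<in>UNIV. S (phi l t (?A s)) (X t (D l w))) = L (?A s) w"
    unfolding L_def by (rule sum.swap)
  also have "eta_op c \<nu> sm am i (D s w) + S (1/2) (L (?A s) w) + ?Y s w = eta_op c \<nu> sm am i (D s w) + g0_op c \<nu> sm am (?A s) w"
    using hat.scale_left_distrib[of "1/2" "1/2" "L (?A s) w"]
    by (simp add: g0_op_eq[OF bracket_xi_eta_gr] add.assoc)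
  finally show ?thesis .
qed

text \<open>Each degree rests on a different fact: degree 1 on the vanishing of brackets of degree
  2, degree 0 on the duality in \<open>bracket_xi_g0\<close>, degree -1 on
  \<open>D_eta_op\<close>.\<close>

lemma D_op:
  assumes "x \<in> e6"
  shows "D s (op x w) = op x (D s w) + op (e6_bracket (xi s) x) w"
proof -
  let ?P = "\<lambda>x. D s (op x w) = op x (D s w) + op (e6_bracket (xi s) x) w"
  have xi_e6: "xi s \<in> e6" for s using xi_gr gr_e6 by blast
  have eta_e6: "eta s \<in> e6" for s using eta_gr gr_e6 by blast
  have bs: "e6_bracket (xi s) (e6_scale k y) = e6_scale k (e6_bracket (xi s) y)" if "y \<in> e6" for k y
  proof -
    have ky: "e6_scale k y \<in> e6" using that e6v.subspace_scale[OF e6_subspace] by blast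
    show ?thesis unfolding bracket_antisym[OF ky xi_e6] bracket_antisym[OF that xi_e6] bracket_scale[OF that xi_e6] by simp
  qed
  have add: "?P (y + z)" if "?P y" "?P z" "y \<in> e6" "z \<in> e6" for y z
    using that e6_closed[OF xi_e6 that(3)] e6_closed[OF xi_e6 that(4)]
    by (simp add: op_add e6_bracket_add D_add)
  have scale: "?P (e6_scale k y)" if "?P y" "y \<in> e6" for y k
    using that e6_closed[OF xi_e6 that(2)] by (simp add: op_scale bs D_S hat.scale_right_distrib)
  have zero: "?P 0" by simp
  have sum: "?P (sum f UNIV)" if "\<And>i. ?P (f i)" "\<And>i. f i \<in> e6" for f :: "16 \<Rightarrow> e6_vec"
  proof -
    have "sum f I \<in> e6 \<and> ?P (sum f I)" for I
      by (induction I rule: infinite_finite_induct)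
        (use that zero add e6v.subspace_0[OF e6_subspace] e6v.subspace_add[OF e6_subspace] in auto)
    then show ?thesis by blast
  qed
  have xi: "?P (xi i)" for i
  proof -
    have "e6_bracket (xi s) (xi i) = 0"
      using gr_2[of "e6_bracket (xi s) (xi i)"] bracket_gr[OF xi_gr xi_gr] by simp
    then show ?thesis by (simp add: op_xi D_D)
  qed
  have eta: "?P (eta i)" for i
    by (simp add: op_eta D_eta_op op_gr_0[OF bracket_xi_eta_gr])
  have g0: "?P u" if "u \<in> gr 0" for u
  proof -
    have "op (e6_bracket (xi s) u) w = (\<Sum>i\<in>UNIV. S (phi i s u) (D i w))"
      unfolding bracket_xi_g0[OF that]
      by (subst op_sum) (simp_all add: op_scale xi_e6 op_xi e6v.subspace_scale[OF e6_subspace])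
    then show ?thesis using that by (simp add: op_gr_0 D_g0_op)
  qed
  obtain a b d where abd: "a \<in> gr (-1)" "b \<in> gr 0" "d \<in> gr 1" "x = a + b + d"
    using e6_split[OF assms] by blast
  have "?P a" by (subst (1 2 3) gr_minus_1_expand[OF abd(1)])
    (intro sum scale eta e6v.subspace_scale[OF e6_subspace] eta_e6)
  moreover have "?P d" by (subst (1 2 3) gr_1_expand[OF abd(3)])
    (intro sum scale xi e6v.subspace_scale[OF e6_subspace] xi_e6)
  moreover have e6: "a \<in> e6" "b \<in> e6" "d \<in> e6" using abd gr_e6 by blast+
  moreover have "a + b \<in> e6" using e6v.subspace_add[OF e6_subspace] e6 by blast
  ultimately show ?thesis unfolding abd(4)
    using g0[OF abd(2)] by (intro add)
qed

end

section \<open>Vanishing detected by derivatives and constant terms\<close>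

definition mdeg :: "monom16 \<Rightarrow> nat"
  where "mdeg m = (\<Sum>i\<in>UNIV. Poly_Mapping.lookup m i)"

lemma mdeg_single: "mdeg (m + Poly_Mapping.single i 1) = mdeg m + 1"
  by (simp add: mdeg_def lookup_add sum.distrib lookup_single when_def)

context mhat
begin

text \<open>The bound is strict, so that bound 0 means \<open>w = 0\<close> and inductions can start
  at the zero vector.\<close>

definition below :: "nat \<Rightarrow> 'm mhat \<Rightarrow> bool"
  where "below n w \<longleftrightarrow> (\<forall>m\<in>Poly_Mapping.keys w. mdeg m < n)"

lemma below_0: "below 0 w \<Longrightarrow> w = 0"
  by (rule poly_mapping_eqI) (auto simp: below_def in_keys_iff)

lemma below_D:
  assumes "below (Suc n) w"
  shows "below n (D i w)"
  unfolding below_def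
proof
  fix m assume "m \<in> Poly_Mapping.keys (D i w)"
  then have "m + Poly_Mapping.single i 1 \<in> Poly_Mapping.keys w"
    by (auto simp: in_keys_iff lookup_D)
  then have "mdeg (m + Poly_Mapping.single i 1) < Suc n" using assms unfolding below_def by blast
  then show "mdeg m < n" by (simp only: mdeg_single)
qed

lemma below_ex: "\<exists>n. below n w"
proof (intro exI)
  show "below (Suc (\<Sum>m\<in>Poly_Mapping.keys w. mdeg m)) w"
    unfolding below_def
  proof
    fix m assume "m \<in> Poly_Mapping.keys w"
    then have "mdeg m \<le> (\<Sum>m\<in>Poly_Mapping.keys w. mdeg m)" by (intro member_le_sum) simp_all
    then show "mdeg m < Suc (\<Sum>m\<in>Poly_Mapping.keys w. mdeg m)" by simp
  qed
qed

lemma const_if_D_zero: "(\<And>i. D i w = 0) \<Longrightarrow> w = Poly_Mapping.single 0 (ct w)"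
  using D_all_zero[of w] by (intro poly_mapping_eqI) (auto simp: lookup_single when_def ct_def)

text \<open>The coefficients of \<open>F w\<close> are determined by its iterated derivatives, whose constant terms vanish.\<close>

lemma zero_if_commutes_D:
  assumes D: "\<And>i w. D i (F w) = F (D i w)" and ct: "\<And>w. ct (F w) = 0" and zero: "F 0 = 0"
  shows "F w = 0"
proof -
  have "below n w \<Longrightarrow> F w = 0" for n w
  proof (induction n arbitrary: w)
    case 0
    then show ?case using below_0 zero by blast
  next
    case (Suc n)
    then have "D i (F w) = 0" for i using below_D[OF Suc.prems] D by simp
    then show ?case using const_if_D_zero[of "F w"] ct by simp
  qed
  then show ?thesis using below_ex by blast
qed

lemma tensor_1: "tensor sm 1 v = Poly_Mapping.single 0 v"
  using tensor_single[of 0 1 v] by simp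

end

context e6_setting
begin

lemma ct_op_gr_0: "u \<in> gr 0 \<Longrightarrow> ct (op u w) = r u (ct w)"
  by (simp add: op_gr_0 g0_op_eq L_def ct_sum) (simp add: ct_def lookup_R)

text \<open>Every summand of \<open>eta_op\<close> begins with multiplication by a variable.\<close>

lemma ct_op_gr_minus_1: "x \<in> gr (-1) \<Longrightarrow> ct (op x w) = 0"
proof -
  assume x: "x \<in> gr (-1)"
  have e: "e6_scale k (eta i) \<in> e6" for k i
    using eta_gr gr_e6 e6v.subspace_scale[OF e6_subspace] by blast
  have "op x w = (\<Sum>i\<in>UNIV. op (e6_scale (Poly_Mapping.lookup (snd x) (- beta i)) (eta i)) w)"
    by (subst gr_minus_1_expand[OF x]) (rule op_sum, rule e)
  then show ?thesis
    by (simp add: ct_sum op_scale gr_e6[OF eta_gr] op_eta eta_op_eq)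
qed

section \<open>The defect of the bracket law\<close>

definition Z :: "e6_vec \<Rightarrow> e6_vec \<Rightarrow> 'm mhat \<Rightarrow> 'm mhat"
  where "Z x y w = op (e6_bracket x y) w - (op x (op y w) - op y (op x w))"

lemma Z_add: "x \<in> e6 \<Longrightarrow> x' \<in> e6 \<Longrightarrow> y \<in> e6 \<Longrightarrow> Z (x + x') y w = Z x y w + Z x' y w"
  "x \<in> e6 \<Longrightarrow> x' \<in> e6 \<Longrightarrow> y \<in> e6 \<Longrightarrow> Z y (x + x') w = Z y x w + Z y x' w"
  by (simp_all add: Z_def e6_bracket_add op_add op_add_right e6_closed)

lemma Z_swap: "x \<in> e6 \<Longrightarrow> y \<in> e6 \<Longrightarrow> Z y x w = - Z x y w"
  by (simp add: Z_def bracket_antisym[of x y] op_minus e6_closed)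

text \<open>\<open>D_op\<close> is precisely the bracket law for \<open>xi s\<close>.\<close>

lemma Z_xi: "y \<in> e6 \<Longrightarrow> Z (xi s) y w = 0"
  by (simp add: Z_def op_xi D_op)

lemma xi_e6: "xi s \<in> e6"
  using xi_gr gr_e6 by blast

lemma Z_gr_1:
  assumes "x \<in> gr 1" "y \<in> e6"
  shows "Z x y w = 0" "Z y x w = 0"
proof -
  have s: "e6_scale k (xi i) \<in> e6" for k i
    using xi_e6 e6v.subspace_scale[OF e6_subspace] by blast
  have scale: "Z (e6_scale k (xi i)) y w = 0" for k i
    using Z_xi[OF assms(2), of i w] assms(2)
    by (simp add: Z_def bracket_scale op_scale op_S xi_e6 e6_closed flip: hat.scale_right_diff_distrib)
  have sum: "(\<Sum>i\<in>I. e6_scale (k i) (xi i)) \<in> e6 \<and> Z (\<Sum>i\<in>I. e6_scale (k i) (xi i)) y w = 0" for k and I :: "16 set"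
  proof (induction I rule: infinite_finite_induct)
    case (insert i I)
    then show ?case using Z_add(1)[OF s _ assms(2)] scale e6v.subspace_add[OF e6_subspace s] by simp
  qed (use e6v.subspace_0[OF e6_subspace] assms(2) in \<open>simp_all add: Z_def\<close>)
  show "Z x y w = 0" by (subst gr_1_expand[OF assms(1)]) (rule sum[THEN conjunct2])
  then show "Z y x w = 0" using Z_swap[OF gr_e6[OF assms(1)] assms(2), of w] by simp
qed

text \<open>All operators in the defect obey the Leibniz rule \<open>D_op\<close>, and
  \<open>jacobi\<close> provides it for the bracket inside. So differentiating the defect amounts to
  bracketing each argument with \<open>xi s\<close>.\<close>

lemma D_Z:
  assumes "x \<in> e6" "y \<in> e6"
  shows "D s (Z x y w) = Z x y (D s w) + Z (e6_bracket (xi s) x) y w + Z x (e6_bracket (xi s) y) w"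
proof -
  have D_diff: "D s (w - w') = D s w - D s w'" for w w'
    using D_add[of s "w - w'" w'] by simp
  have j: "e6_bracket (xi s) (e6_bracket x y) = e6_bracket (e6_bracket (xi s) x) y + e6_bracket x (e6_bracket (xi s) y)"
    unfolding xi_Ev by (rule jacobi[OF root_beta assms])
  have e: "e6_bracket (xi s) x \<in> e6" "e6_bracket (xi s) y \<in> e6"
    using e6_closed xi_e6 assms by blast+
  show ?thesis
    unfolding Z_def D_diff
    by (simp add: D_op e6_closed assms e xi_e6 j op_add op_add_right algebra_simps)
qed

lemma bracket_xi_gr: "x \<in> gr k \<Longrightarrow> e6_bracket (xi s) x \<in> gr (1 + k)"
  by (rule bracket_gr[OF xi_gr])

lemma Z_0 [simp]: "x \<in> e6 \<Longrightarrow> y \<in> e6 \<Longrightarrow> Z x y 0 = 0"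
  by (simp add: Z_def e6_closed)

text \<open>Both correction terms in \<open>D_Z\<close> have an argument of degree 1 and vanish. On
  constant terms the claim is that \<open>rho\<close> is a representation.\<close>

lemma Z_gr_0_0: "u \<in> gr 0 \<Longrightarrow> v \<in> gr 0 \<Longrightarrow> Z u v w = 0"
proof (rule zero_if_commutes_D[where F = "Z u v"])
  assume u: "u \<in> gr 0" and v: "v \<in> gr 0"
  note e = gr_e6[OF u] gr_e6[OF v]
  show "D s (Z u v w) = Z u v (D s w)" for s w
    using bracket_xi_gr[OF u, of s] bracket_xi_gr[OF v, of s] by (simp add: D_Z e Z_gr_1)
  show "ct (Z u v w) = 0" for w
    using u v bracket_gr[OF u v] by (simp add: Z_def ct_op_gr_0 r_bracket)
  show "Z u v 0 = 0" using e by simp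
qed

text \<open>The corrections are defects in degrees 0, 0 and -1, 1, already known to vanish.
  Operators of degree -1 leave no constant term, and those of degree 0 cannot create one from
  nothing.\<close>

lemma Z_gr_minus_1_0:
  assumes x: "x \<in> gr (-1)" and u: "u \<in> gr 0"
  shows "Z x u w = 0" "Z u x w = 0"
proof -
  note e = gr_e6[OF x] gr_e6[OF u]
  show "Z x u w = 0"
  proof (rule zero_if_commutes_D[where F = "Z x u"])
    show "D s (Z x u w) = Z x u (D s w)" for s w
      using bracket_xi_gr[OF x, of s] bracket_xi_gr[OF u, of s] u by (simp add: D_Z e Z_gr_1 Z_gr_0_0)
    show "ct (Z x u w) = 0" for w
      using x u bracket_gr[OF x u] by (simp add: Z_def ct_op_gr_0 ct_op_gr_minus_1)
    show "Z x u 0 = 0" using e by simp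
  qed
  then show "Z u x w = 0" using Z_swap[OF e] by simp
qed

text \<open>The corrections are defects in degrees 0 and -1. The bracket lies in degree -2 and is 0,
  which leaves products of operators of degree -1, without constant term.\<close>

lemma Z_gr_minus_1_minus_1:
  assumes x: "x \<in> gr (-1)" and y: "y \<in> gr (-1)"
  shows "Z x y w = 0"
proof (rule zero_if_commutes_D[where F = "Z x y"])
  note e = gr_e6[OF x] gr_e6[OF y]
  show "D s (Z x y w) = Z x y (D s w)" for s w
    using bracket_xi_gr[OF x, of s] bracket_xi_gr[OF y, of s] x y by (simp add: D_Z e Z_gr_minus_1_0)
  have "e6_bracket x y = 0" using bracket_gr[OF x y] gr_minus_2 by simp
  then show "ct (Z x y w) = 0" for w
    using x y by (simp add: Z_def ct_op_gr_minus_1)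
  show "Z x y 0 = 0" using e by simp
qed

lemma op_bracket:
  assumes "x \<in> e6" "y \<in> e6"
  shows "op (e6_bracket x y) w = op x (op y w) - op y (op x w)"
proof -
  obtain a b d where x: "a \<in> gr (-1)" "b \<in> gr 0" "d \<in> gr 1" "x = a + b + d"
    using e6_split[OF assms(1)] by blast
  obtain a' b' d' where y: "a' \<in> gr (-1)" "b' \<in> gr 0" "d' \<in> gr 1" "y = a' + b' + d'"
    using e6_split[OF assms(2)] by blast
  note e = x(1-3)[THEN gr_e6] y(1-3)[THEN gr_e6]
  note e' = e6v.subspace_add[OF e6_subspace e(1,2)] e6v.subspace_add[OF e6_subspace e(4,5)]
  have "Z x y w = Z (a + b) (a' + b') w"
    unfolding x(4) y(4) using e e' x y assms
    by (simp add: Z_add Z_gr_1 e6v.subspace_add[OF e6_subspace])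
  also have "\<dots> = 0"
    using e e' x(1,2) y(1,2) by (simp add: Z_add Z_gr_0_0 Z_gr_minus_1_0 Z_gr_minus_1_minus_1)
  finally show ?thesis by (simp add: Z_def)
qed

section \<open>The submodule generated by M\<close>

abbreviation "V \<equiv> U_minus_M c \<nu> sm am"

lemma V_subspace: "hat.subspace V"
  unfolding U_minus_M_def enveloping_image_def by (rule hat.subspace_span)

lemma V_gen: "set ys \<subseteq> gr (-1) \<Longrightarrow> foldr op ys (Poly_Mapping.single 0 v) \<in> V"
  unfolding U_minus_M_def enveloping_image_def g_minus_gr
  by (rule hat.span_base) (auto simp flip: tensor_1)

lemma V_const: "Poly_Mapping.single 0 v \<in> V"
  using V_gen[of "[]"] by simp

lemma V_minimal:
  assumes "hat.subspace W" and "\<And>ys v. set ys \<subseteq> gr (-1) \<Longrightarrow> foldr op ys (Poly_Mapping.single 0 v) \<in> W"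
  shows "V \<subseteq> W"
  unfolding U_minus_M_def enveloping_image_def g_minus_gr
  by (rule hat.span_minimal[OF _ assms(1)]) (use assms(2) in \<open>auto simp: tensor_1\<close>)

lemma op_preimage_subspace:
  assumes "x \<in> e6"
  shows "hat.subspace {w. op x w \<in> V}"
  using V_subspace assms by (auto simp: hat.subspace_def op_add_right op_S)

text \<open>The vectors that \<open>x\<close> sends into \<open>V\<close> form a subspace, so words
  applied to constants suffice as tests.\<close>

lemma V_closed_gens:
  assumes "x \<in> e6" and "\<And>ys v. set ys \<subseteq> gr (-1) \<Longrightarrow> op x (foldr op ys (Poly_Mapping.single 0 v)) \<in> V"
  shows "w \<in> V \<Longrightarrow> op x w \<in> V"
  using V_minimal[OF op_preimage_subspace[OF assms(1)]] assms(2) by blast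

lemma V_closed_minus_1: "x \<in> gr (-1) \<Longrightarrow> w \<in> V \<Longrightarrow> op x w \<in> V"
proof (rule V_closed_gens)
  fix ys v assume "x \<in> gr (-1)" "set ys \<subseteq> gr (-1)"
  then show "op x (foldr op ys (Poly_Mapping.single 0 v)) \<in> V" using V_gen[of "x # ys" v] by simp
qed (auto simp: gr_e6)

lemma op_g0_const: "u \<in> gr 0 \<Longrightarrow> op u (Poly_Mapping.single 0 v) = Poly_Mapping.single 0 (r u v)"
  by (simp add: op_gr_0 g0_op_eq L_def R_single)

text \<open>Moving \<open>u\<close> past a letter \<open>y\<close> of the word costs [u, y], which
  again has degree -1 and preserves \<open>V\<close>.\<close>

lemma V_closed_0:
  assumes u: "u \<in> gr 0"
  shows "w \<in> V \<Longrightarrow> op u w \<in> V"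
proof (rule V_closed_gens)
  show "u \<in> e6" using u by (rule gr_e6)
  fix ys v assume "set ys \<subseteq> gr (-1)"
  then show "op u (foldr op ys (Poly_Mapping.single 0 v)) \<in> V"
  proof (induction ys)
    case Nil
    then show ?case using V_const by (simp add: op_g0_const u)
  next
    case (Cons y ys)
    let ?w = "foldr op ys (Poly_Mapping.single 0 v)"
    have y: "y \<in> gr (-1)" using Cons by simp
    have "op u (op y ?w) = op (e6_bracket u y) ?w + op y (op u ?w)"
      by (simp add: op_bracket[OF gr_e6[OF u] gr_e6[OF y]])
    moreover have "op (e6_bracket u y) ?w \<in> V"
      using V_closed_minus_1 bracket_gr[OF u y] V_gen Cons by simp
    moreover have "op y (op u ?w) \<in> V" using V_closed_minus_1[OF y] Cons by simp
    ultimately show ?case using hat.subspace_add[OF V_subspace] by simp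
  qed
qed

lemma op_gr_1:
  assumes "x \<in> gr 1"
  shows "op x w = (\<Sum>i\<in>UNIV. S (Poly_Mapping.lookup (snd x) (beta i)) (D i w))"
  by (subst gr_1_expand[OF assms], subst op_sum) (simp_all add: e6v.subspace_scale[OF e6_subspace] xi_e6 op_scale op_xi)

text \<open>The same induction one degree higher: the correction [x, y] has degree 0 and is handled
  by \<open>V_closed_0\<close>, and the empty word is a constant, which derivatives kill.\<close>

lemma V_closed_1:
  assumes x: "x \<in> gr 1"
  shows "w \<in> V \<Longrightarrow> op x w \<in> V"
proof (rule V_closed_gens)
  show "x \<in> e6" using x by (rule gr_e6)
  fix ys v assume "set ys \<subseteq> gr (-1)"
  then show "op x (foldr op ys (Poly_Mapping.single 0 v)) \<in> V"
  proof (induction ys)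
    case Nil
    then show ?case using hat.subspace_0[OF V_subspace] by (simp add: op_gr_1 x)
  next
    case (Cons y ys)
    let ?w = "foldr op ys (Poly_Mapping.single 0 v)"
    have y: "y \<in> gr (-1)" using Cons by simp
    have "op x (op y ?w) = op (e6_bracket x y) ?w + op y (op x ?w)"
      by (simp add: op_bracket[OF gr_e6[OF x] gr_e6[OF y]])
    moreover have "op (e6_bracket x y) ?w \<in> V"
      using V_closed_0 bracket_gr[OF x y] V_gen Cons by simp
    moreover have "op y (op x ?w) \<in> V" using V_closed_minus_1[OF y] Cons by simp
    ultimately show ?case using hat.subspace_add[OF V_subspace] by simp
  qed
qed

lemma V_closed:
  assumes "x \<in> e6" "w \<in> V"
  shows "op x w \<in> V"
proof -
  obtain a b d where x: "a \<in> gr (-1)" "b \<in> gr 0" "d \<in> gr 1" "x = a + b + d"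
    using e6_split[OF assms(1)] by blast
  note e = x(1-3)[THEN gr_e6]
  have "op x w = op a w + op b w + op d w"
    unfolding x(4) using e e6v.subspace_add[OF e6_subspace e(1,2)] by (simp add: op_add)
  then show ?thesis
    using V_closed_minus_1[OF x(1) assms(2)] V_closed_0[OF x(2) assms(2)] V_closed_1[OF x(3) assms(2)]
      hat.subspace_add[OF V_subspace] by simp
qed

lemma lie_module_V: "lie_module e6 e6_scale e6_bracket S V op"
  unfolding lie_module_def
  using hat.vector_space_axioms V_subspace V_closed op_add op_scale op_add_right op_S op_bracket
  by blast

lemma submodule_meets_M:
  assumes W: "lie_submodule e6 S V op W" and "w \<in> W" "w \<noteq> 0"
  obtains v where "v \<noteq> 0" "Poly_Mapping.single 0 v \<in> W"
proof -
  have D_W: "D i w \<in> W" if "w \<in> W" for i w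
    using W that xi_e6 unfolding lie_submodule_def op_xi[symmetric] by blast
  have ind: "below n w \<Longrightarrow> w \<in> W \<Longrightarrow> w \<noteq> 0 \<Longrightarrow> \<exists>v. v \<noteq> 0 \<and> Poly_Mapping.single 0 v \<in> W" for n w
  proof (induction n arbitrary: w)
    case 0
    then show ?case using below_0 by blast
  next
    case (Suc n)
    show ?case
    proof (cases "\<exists>i. D i w \<noteq> 0")
      case True
      then show ?thesis using Suc.IH below_D[OF Suc.prems(1)] D_W[OF Suc.prems(2)] by blast
    next
      case False
      then have c: "w = Poly_Mapping.single 0 (ct w)" using const_if_D_zero by blast
      then have "ct w \<noteq> 0" using Suc.prems(3) by (metis single_zero)
      then show ?thesis using c Suc.prems(2) by metis
    qed
  qed
  obtain n where "below n w" using below_ex by blast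
  from ind[OF this assms(2,3)] show ?thesis using that by blast
qed

lemma V_irreducible:
  assumes irr: "irreducible_lie_module o10 mat_scale mat_commutator sm UNIV am"
  shows "irreducible_lie_module e6 e6_scale e6_bracket S V op"
  unfolding irreducible_lie_module_def
proof (intro conjI allI impI)
  show "lie_module e6 e6_scale e6_bracket S V op" by (rule lie_module_V)
  have "(UNIV :: 'm set) \<noteq> {0}" using irr by (simp add: irreducible_lie_module_def)
  then obtain v :: 'm where "v \<noteq> 0" by blast
  then have "Poly_Mapping.single (0 :: monom16) v \<noteq> 0" by (metis lookup_single_eq lookup_zero)
  then show "V \<noteq> {0}" using V_const[of v] by blast
next
  fix W assume W: "lie_submodule e6 S V op W"
  have sub: "hat.subspace W" and WV: "W \<subseteq> V" and op_W: "\<And>x w. x \<in> e6 \<Longrightarrow> w \<in> W \<Longrightarrow> op x w \<in> W"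
    using W by (auto simp: lie_submodule_def)
  show "W = {0} \<or> W = V"
  proof (cases "W \<subseteq> {0}")
    case True
    then show ?thesis using hat.subspace_0[OF sub] by blast
  next
    case False
    then obtain v where v: "v \<noteq> 0" "Poly_Mapping.single 0 v \<in> W"
      using submodule_meets_M[OF W] by blast
    \<comment> \<open>The intersection of \<open>W\<close> with M, seen inside M; it is a nonzero
      submodule.\<close>
    let ?W = "{v. Poly_Mapping.single 0 v \<in> W}"
    have "subspace ?W"
    proof (rule subspaceI)
      show "0 \<in> ?W" using hat.subspace_0[OF sub] by simp
      show "x + y \<in> ?W" if "x \<in> ?W" "y \<in> ?W" for x y
        using hat.subspace_add[OF sub] that by (simp add: single_add)
      show "sm k x \<in> ?W" if "x \<in> ?W" for k x
        using hat.subspace_scale[OF sub, of _ k] that by (simp flip: S_single)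
    qed
    moreover have "am A v \<in> ?W" if "A \<in> o10" "v \<in> ?W" for A v
    proof -
      have g: "\<nu> A \<in> gD5" using nu_simps(1) that(1) by (auto simp: bij_betw_def)
      then have u: "\<nu> A \<in> gr 0" by (simp add: gD5_iff)
      \<comment> \<open>On constants the differential part vanishes, and \<open>N\<close> undoes
        \<nu>, so only the original action of \<open>A\<close> remains.\<close>
      have "op (\<nu> A) (Poly_Mapping.single 0 v) = Poly_Mapping.single 0 (am A v)"
        using N(3)[OF that(1)] by (simp add: op_g0_const[OF u] r_gD5[OF g])
      then show ?thesis using op_W[OF gr_e6[OF u]] that(2) by (metis mem_Collect_eq)
    qed
    ultimately have "lie_submodule o10 sm UNIV am ?W" by (simp add: lie_submodule_def)
    then have "?W = {0} \<or> ?W = UNIV" using irr unfolding irreducible_lie_module_def by blast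
    then have "?W = UNIV" using v by blast
    then have base: "Poly_Mapping.single 0 v \<in> W" for v by blast
    have "foldr op ys (Poly_Mapping.single 0 v) \<in> W" if "set ys \<subseteq> gr (-1)" for ys v
      using that by (induction ys) (auto simp: base op_W gr_e6)
    then have "V \<subseteq> W" by (rule V_minimal[OF sub])
    then show ?thesis using WV by blast
  qed
qed

end

theorem proposition5p2:
  fixes c :: complex
    and \<nu> :: "complex ^ 10 ^ 10 \<Rightarrow> e6_vec"
    and sm :: "complex \<Rightarrow> 'm::ab_group_add \<Rightarrow> 'm"
    and am :: "complex ^ 10 ^ 10 \<Rightarrow> 'm \<Rightarrow> 'm"
  assumes "is_nu \<nu>"
    and "irreducible_lie_module o10 mat_scale mat_commutator sm UNIV am"
  shows "irreducible_lie_module e6 e6_scale e6_bracket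
    (mhat_scale sm) (U_minus_M c \<nu> sm am) (e6_action c \<nu> sm am)"
proof -
  have "lie_module o10 mat_scale mat_commutator sm UNIV am"
    using assms(2) by (simp add: irreducible_lie_module_def)
  moreover from this have "vector_space sm" by (simp add: lie_module_def)
  ultimately interpret e6_setting sm c \<nu> am
    using assms(1) by (simp add: e6_setting_def e6_setting_axioms_def mhat_def)
  show ?thesis by (rule V_irreducible[OF assms(2)])
qed

end
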